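(* Let $A$ be the coordinate ring of a normal affine surface over $\mathbb{C}$ equipped with a nontrivial $\mathbb{C}^*$-action, let $A=\bigoplus_{i\in\mathbb{Z}}A_i$ be the corresponding grading, and let $\delta$ be the infinitesimal generator of this action, i.e. the derivation with $\delta(a)=\deg(a)\cdot a$ for homogeneous $a\in A$. Assume that $\mathrm{ML}(A)\neq\mathbb{C}$, $\operatorname{Spec}(A)\not\cong\mathbb{C}^*\times\mathbb{C}^*$ and $\operatorname{Spec}(A)\not\cong\mathbb{A}^1_{\mathbb{C}}\times\mathbb{C}^*$. Then every semisimple derivation $\tilde\delta$ on $A$ is of the form $$\tilde\delta=c\cdot\exp(-\partial)\,\delta\,\exp(\partial)$$ for some $c\in\mathbb{C}$ and some locally nilpotent derivation $\partial$ on $A$. Consequently, any two effective $\mathbb{C}^*$-actions on $A$, after possibly switching one of them by the automorphism $\lambda\mapsto\lambda^{-1}$ of $\mathbb{C}^*$, are conjugate via an automorphism of $A$ provided by a $\mathbb{C}_+$-action on $A$ (i.e. of the form $\exp(\partial)$ with $\partial$ a locally nilpotent derivation of $A$) and, moreover, they coincide (after this possible switching) whenever $\mathrm{ML}(A)=A$.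
   Context: Surfaces are irreducible. All derivations are $\mathbb{C}$-linear. A derivation $\partial:A\to A$ is locally nilpotent if for every $a\in A$ there is $n$ with $\partial^n(a)=0$; then $\exp(\partial)=\sum_{i\ge0}\partial^i/i!$ is an automorphism of $A$, and $\mathbb{C}_+$-actions on $\operatorname{Spec} A$ correspond to locally nilpotent derivations $\partial$ via $t\mapsto\exp(t\partial)$. $\mathrm{LND}(A)$ is the set of all locally nilpotent derivations of $A$ and $\mathrm{ML}(A)=\bigcap_{\partial\in \mathrm{LND}(A)}\ker\partial$ is the Makar-Limanov invariant. A derivation is semisimple if $A$ has a $\mathbb{C}$-basis consisting of its eigenvectors. A $\mathbb{C}^*$-action on $\operatorname{Spec}A$ corresponds to a grading $A=\bigoplus_{i\in\mathbb{Z}}A_i$ with $\lambda.a=\lambda^i a$ for $a\in A_i$. *)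

theory Defs
  imports
    Complex_Main
    "HOL-Library.Poly_Mapping"
    "HOL-Library.Product_Plus"
    "HOL-Library.Extended_Nat"
    "HOL-Computational_Algebra.Polynomial"
    "HOL-Computational_Algebra.Fraction_Field"
begin

text \<open>
  A commutative complex algebra is a type of class \<open>comm_ring_1\<close> together with a scalar
  multiplication by complex numbers, which is an explicit argument of all notions below.
\<close>

locale complex_algebra = vector_space scale
  for scale :: "complex \<Rightarrow> 'a::comm_ring_1 \<Rightarrow> 'a" +
  assumes scale_mult_left: "scale c (x * y) = scale c x * y"

definition algebra_hom ::
  "(complex \<Rightarrow> 'a::comm_ring_1 \<Rightarrow> 'a) \<Rightarrow> (complex \<Rightarrow> 'b::comm_ring_1 \<Rightarrow> 'b) \<Rightarrow> ('a \<Rightarrow> 'b) \<Rightarrow> bool" where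
  "algebra_hom s1 s2 f \<longleftrightarrow>
     Vector_Spaces.linear s1 s2 f \<and> f 1 = 1 \<and> (\<forall>x y. f (x * y) = f x * f y)"

definition algebra_isomorphic ::
  "(complex \<Rightarrow> 'a::comm_ring_1 \<Rightarrow> 'a) \<Rightarrow> (complex \<Rightarrow> 'b::comm_ring_1 \<Rightarrow> 'b) \<Rightarrow> bool" where
  "algebra_isomorphic s1 s2 \<longleftrightarrow> (\<exists>f. algebra_hom s1 s2 f \<and> bij f)"

definition subalgebra :: "(complex \<Rightarrow> 'a::comm_ring_1 \<Rightarrow> 'a) \<Rightarrow> 'a set \<Rightarrow> bool" where
  "subalgebra scale B \<longleftrightarrow>
     module.subspace scale B \<and> 1 \<in> B \<and> (\<forall>x\<in>B. \<forall>y\<in>B. x * y \<in> B)"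

definition finitely_generated_algebra :: "(complex \<Rightarrow> 'a::comm_ring_1 \<Rightarrow> 'a) \<Rightarrow> bool" where
  "finitely_generated_algebra scale \<longleftrightarrow>
     (\<exists>S. finite S \<and> (\<forall>B. subalgebra scale B \<and> S \<subseteq> B \<longrightarrow> B = UNIV))"

text \<open>
  The monoid algebra of a commutative monoid \<open>'m\<close> is the type \<open>'m \<Rightarrow>\<^sub>0 complex\<close> with the
  convolution product; complex numbers are embedded as the multiples of the monomial with exponent 0.
  For \<open>'m = int \<times> int\<close> this is \<open>\<complex>[x, 1/x, y, 1/y]\<close>, the coordinate ring of the torus
  \<open>\<complex>* \<times> \<complex>*\<close>, and for \<open>'m = nat \<times> int\<close> it is \<open>\<complex>[x, y, 1/y]\<close>, the coordinate ring of
  the product of the affine line and \<open>\<complex>*\<close>.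
\<close>

definition monoid_algebra_scale ::
  "complex \<Rightarrow> ('m::comm_monoid_add \<Rightarrow>\<^sub>0 complex) \<Rightarrow> ('m \<Rightarrow>\<^sub>0 complex)" where
  "monoid_algebra_scale c p = Poly_Mapping.single 0 c * p"

definition torus_algebra :: "complex \<Rightarrow> (int \<times> int \<Rightarrow>\<^sub>0 complex) \<Rightarrow> (int \<times> int \<Rightarrow>\<^sub>0 complex)" where
  "torus_algebra = monoid_algebra_scale"

definition line_times_Cstar_algebra ::
  "complex \<Rightarrow> (nat \<times> int \<Rightarrow>\<^sub>0 complex) \<Rightarrow> (nat \<times> int \<Rightarrow>\<^sub>0 complex)" where
  "line_times_Cstar_algebra = monoid_algebra_scale"


text \<open>Ideals of a ring are its submodules as a module over itself.\<close>

definition prime_ideal :: "'a::comm_ring_1 set \<Rightarrow> bool" where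
  "prime_ideal P \<longleftrightarrow>
     module.subspace ((*) :: 'a \<Rightarrow> 'a \<Rightarrow> 'a) P \<and> P \<noteq> UNIV \<and>
     (\<forall>x y. x * y \<in> P \<longrightarrow> x \<in> P \<or> y \<in> P)"

definition prime_chain :: "nat \<Rightarrow> (nat \<Rightarrow> 'a::comm_ring_1 set) \<Rightarrow> bool" where
  "prime_chain n P \<longleftrightarrow> (\<forall>i\<le>n. prime_ideal (P i)) \<and> (\<forall>i<n. P i \<subset> P (Suc i))"

definition krull_dim :: "'a::comm_ring_1 itself \<Rightarrow> enat" where
  "krull_dim _ = Sup {enat n | n. \<exists>P :: nat \<Rightarrow> 'a set. prime_chain n P}"

definition integrally_closed :: "'a::idom itself \<Rightarrow> bool" where
  "integrally_closed _ \<longleftrightarrow>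
     (\<forall>z :: 'a fract.
        (\<exists>p :: 'a poly. lead_coeff p = 1 \<and> poly (map_poly (\<lambda>a. Fract a 1) p) z = 0)
        \<longrightarrow> (\<exists>a. z = Fract a 1))"

text \<open>
  The scalar multiplication of the coordinate ring is the argument; irreducibility and
  reducedness of the surface are expressed by the class \<open>idom\<close>.
\<close>

definition normal_affine_surface :: "(complex \<Rightarrow> 'a::idom \<Rightarrow> 'a) \<Rightarrow> bool" where
  "normal_affine_surface scale \<longleftrightarrow>
     complex_algebra scale \<and> finitely_generated_algebra scale \<and>
     krull_dim TYPE('a) = 2 \<and> integrally_closed TYPE('a)"


definition derivation :: "(complex \<Rightarrow> 'a::comm_ring_1 \<Rightarrow> 'a) \<Rightarrow> ('a \<Rightarrow> 'a) \<Rightarrow> bool" where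
  "derivation scale D \<longleftrightarrow>
     Vector_Spaces.linear scale scale D \<and> (\<forall>x y. D (x * y) = D x * y + x * D y)"

definition LND :: "(complex \<Rightarrow> 'a::comm_ring_1 \<Rightarrow> 'a) \<Rightarrow> ('a \<Rightarrow> 'a) set" where
  "LND scale = {D. derivation scale D \<and> (\<forall>a. \<exists>n. (D ^^ n) a = 0)}"

definition makar_limanov :: "(complex \<Rightarrow> 'a::comm_ring_1 \<Rightarrow> 'a) \<Rightarrow> 'a set" where
  "makar_limanov scale = (\<Inter>D\<in>LND scale. {a. D a = 0})"

text \<open>
  The exponential series; the sum over all \<open>i\<close> with nonzero summand is only meaningful
  for locally nilpotent \<open>D\<close>, where it is finite.
\<close>

definition lnd_exp :: "(complex \<Rightarrow> 'a::comm_ring_1 \<Rightarrow> 'a) \<Rightarrow> ('a \<Rightarrow> 'a) \<Rightarrow> 'a \<Rightarrow> 'a" where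
  "lnd_exp scale D a = Sum_any (\<lambda>i. scale (1 / fact i) ((D ^^ i) a))"

definition semisimple_derivation :: "(complex \<Rightarrow> 'a::comm_ring_1 \<Rightarrow> 'a) \<Rightarrow> ('a \<Rightarrow> 'a) \<Rightarrow> bool" where
  "semisimple_derivation scale D \<longleftrightarrow>
     derivation scale D \<and>
     (\<exists>B. \<not> module.dependent scale B \<and> module.span scale B = UNIV \<and>
          (\<forall>b\<in>B. \<exists>c. D b = scale c b))"


text \<open>
  An algebraic action of \<open>\<complex>*\<close> on the spectrum, given by the induced automorphisms \<open>\<rho> \<lambda>\<close> of
  the algebra for \<open>\<lambda> \<noteq> 0\<close>; the value \<open>\<rho> 0\<close> is irrelevant. The last condition says that the
  action map is a morphism of varieties: each \<open>\<rho> \<lambda> a\<close> is a Laurent polynomial in \<open>\<lambda>\<close> with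
  coefficients \<open>f i\<close> in the algebra.
\<close>

definition Cstar_action :: "(complex \<Rightarrow> 'a::comm_ring_1 \<Rightarrow> 'a) \<Rightarrow> (complex \<Rightarrow> 'a \<Rightarrow> 'a) \<Rightarrow> bool" where
  "Cstar_action scale \<rho> \<longleftrightarrow>
     (\<forall>l. l \<noteq> 0 \<longrightarrow> algebra_hom scale scale (\<rho> l) \<and> bij (\<rho> l)) \<and>
     \<rho> 1 = id \<and>
     (\<forall>l m. l \<noteq> 0 \<longrightarrow> m \<noteq> 0 \<longrightarrow> \<rho> (l * m) = \<rho> l \<circ> \<rho> m) \<and>
     (\<forall>a. \<exists>f :: int \<Rightarrow> 'a. finite {i. f i \<noteq> 0} \<and>
        (\<forall>l. l \<noteq> 0 \<longrightarrow> \<rho> l a = (\<Sum>i | f i \<noteq> 0. scale (l powi i) (f i))))"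

definition nontrivial_action :: "(complex \<Rightarrow> 'a \<Rightarrow> 'a) \<Rightarrow> bool" where
  "nontrivial_action \<rho> \<longleftrightarrow> (\<exists>l. l \<noteq> 0 \<and> \<rho> l \<noteq> id)"

definition effective_action :: "(complex \<Rightarrow> 'a \<Rightarrow> 'a) \<Rightarrow> bool" where
  "effective_action \<rho> \<longleftrightarrow> (\<forall>l. l \<noteq> 0 \<longrightarrow> \<rho> l = id \<longrightarrow> l = 1)"

definition graded_part ::
  "(complex \<Rightarrow> 'a::comm_ring_1 \<Rightarrow> 'a) \<Rightarrow> (complex \<Rightarrow> 'a \<Rightarrow> 'a) \<Rightarrow> int \<Rightarrow> 'a set" where
  "graded_part scale \<rho> i = {a. \<forall>l. l \<noteq> 0 \<longrightarrow> \<rho> l a = scale (l powi i) a}"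

definition infinitesimal_generator ::
  "(complex \<Rightarrow> 'a::comm_ring_1 \<Rightarrow> 'a) \<Rightarrow> (complex \<Rightarrow> 'a \<Rightarrow> 'a) \<Rightarrow> ('a \<Rightarrow> 'a) \<Rightarrow> bool" where
  "infinitesimal_generator scale \<rho> \<delta> \<longleftrightarrow>
     derivation scale \<delta> \<and>
     (\<forall>i. \<forall>a\<in>graded_part scale \<rho> i. \<delta> a = scale (of_int i) a)"

end

theory Submission
  imports
    Defs
    "HOL-Computational_Algebra.Fundamental_Theorem_Algebra"
    "HOL-Analysis.Continuum_Not_Denumerable"
begin

text \<open>
  Write \<open>N\<close> for the set of locally nilpotent derivations and \<open>K\<close> for the Makar-Limanov invariant of the
  coordinate ring \<open>A\<close>. The theorem is an analogue of the conjugacy of maximal tori in a solvable group: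
  \<open>N\<close> is an abelian Lie algebra that is normalized by the semisimple derivations, each of these plays the
  role of a maximal torus, and \<open>exp N\<close> that of the unipotent radical.

  The transcendence degree of \<open>A\<close> is at most two: three algebraically independent elements would give
  a chain of four prime ideals (\<open>algebraic_over_third\<close>). A derivation kills every element
  that is algebraic over its kernel, so counting transcendence degrees determines derivations. Since
  \<open>K\<close> contains a nonconstant element, it is the kernel of every nonzero member of \<open>N\<close>, and any two
  members of \<open>N\<close> are proportional over the fraction field of \<open>K\<close>. Hence \<open>N\<close> is a vector space of
  pairwise commuting derivations (\<open>LND_iff_slice\<close>, \<open>LND_commute\<close>).

  For a semisimple derivation \<open>d\<close>, every derivation of the finitely generated algebra \<open>A\<close> is a finite
  sum of eigenvectors of \<open>ad d\<close>. The summand of extremal weight of a locally nilpotent derivation is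
  locally nilpotent, and so \<open>N\<close> is spanned by eigenvectors of \<open>ad d\<close> and \<open>K\<close> is stable under \<open>d\<close>. The
  heart of the proof is \<open>diagonal_component_LND\<close>: if \<open>d\<close> comes from a grading by integers, then all
  components of nonzero degree of a second semisimple derivation \<open>T\<close> are in \<open>N\<close>. Consequently
  \<open>n = [d, T]\<close> is in \<open>N\<close>, and \<open>ad d\<close> and \<open>ad T\<close> commute on \<open>N\<close>, because \<open>ad n\<close> vanishes there. As \<open>n\<close> is
  a commutator with \<open>d\<close> and with \<open>T\<close>, it has no component of weight zero for either, and the equation
  \<open>[T, [d, D]] = n\<close> has a solution \<open>D\<close> in \<open>N\<close>. Then \<open>exp(-D) d exp(D) = d + [d, D]\<close> commutes with \<open>T\<close>
  (\<open>diagonal_conjugate_proportional\<close>).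

  It remains to see that commuting semisimple derivations of \<open>A\<close> are proportional. Otherwise \<open>A\<close> is
  graded by a lattice of rank two with one-dimensional pieces, and by normality it is the algebra of
  a saturated finitely generated monoid in the plane. The monomials on a facet of the cone of the monoid
  span the kernel of a locally nilpotent derivation. So with two facets the Makar-Limanov invariant is trivial,
  with one facet the surface is the product of a line and a punctured line, and with no facet it is a
  torus (\<open>toric_trichotomy\<close>, \<open>commuting_diagonal_proportional\<close>).

  For two effective actions the factor of proportionality carries the weights of one action to those
  of the other. Both sets of weights generate the integers, and so the factor is \<open>1\<close> or \<open>-1\<close>.
\<close>

section \<open>Complex algebras and derivations\<close>

locale complex_domain = complex_algebra scale
  for scale :: "complex \<Rightarrow> 'a::idom \<Rightarrow> 'a"
begin

lemma scale_mult_right: "scale c (x * y) = x * scale c y"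
  by (metis mult.commute scale_mult_left)

lemma scale_eq_const_mult: "scale c x = scale c 1 * x"
  by (metis mult_1 scale_mult_left)

lemma scale_mult_scale: "scale b x * scale c y = scale (b * c) (x * y)"
  by (metis scale_mult_left scale_mult_right scale_scale)

lemma of_nat_eq_scale: "of_nat n * x = scale (of_nat n) x"
  by (induction n) (simp_all add: algebra_simps scale_left_distrib)

lemma of_nat_neq_0: "n > 0 \<Longrightarrow> of_nat n \<noteq> (0 :: 'a)"
  using of_nat_eq_scale[of n 1] by simp

definition weight_space :: "('a \<Rightarrow> 'a) \<Rightarrow> complex \<Rightarrow> 'a set" where
  "weight_space T \<alpha> = {a. T a = scale \<alpha> a}"

lemma subalgebraD:
  assumes "subalgebra scale R"
  shows "subspace R" "1 \<in> R" "0 \<in> R" "scale c 1 \<in> R"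
    and "x \<in> R \<Longrightarrow> y \<in> R \<Longrightarrow> x * y \<in> R"
    and "x \<in> R \<Longrightarrow> y \<in> R \<Longrightarrow> x + y \<in> R"
    and "x \<in> R \<Longrightarrow> y \<in> R \<Longrightarrow> x - y \<in> R"
    and "x \<in> R \<Longrightarrow> scale c x \<in> R"
    and "x \<in> R \<Longrightarrow> x ^ n \<in> R"
proof -
  show R: "subspace R" "1 \<in> R" using assms by (auto simp: subalgebra_def)
  have m: "x * y \<in> R" if "x \<in> R" "y \<in> R" for x y
    using assms that by (auto simp: subalgebra_def)
  show "0 \<in> R" "scale c 1 \<in> R" using R by (auto intro: subspace_0 subspace_scale)
  show "x \<in> R \<Longrightarrow> y \<in> R \<Longrightarrow> x * y \<in> R" by (rule m)
  show "x \<in> R \<Longrightarrow> y \<in> R \<Longrightarrow> x + y \<in> R" using R by (auto intro: subspace_add)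
  show "x \<in> R \<Longrightarrow> y \<in> R \<Longrightarrow> x - y \<in> R" using R by (auto intro: subspace_diff)
  show "x \<in> R \<Longrightarrow> scale c x \<in> R" using R by (auto intro: subspace_scale)
  show "x \<in> R \<Longrightarrow> x ^ n \<in> R" using R m by (induction n) auto
qed

lemma poly_in_subalgebra:
  assumes "subalgebra scale R" "\<And>i. coeff p i \<in> R" "z \<in> R"
  shows "poly p z \<in> R"
  unfolding poly_altdef
  by (intro subspace_sum subalgebraD[OF assms(1)] assms)

lemma linearD:
  assumes "Vector_Spaces.linear scale scale T"
  shows "T (x + y) = T x + T y" "T (scale c x) = scale c (T x)" "T 0 = 0"
    "T (x - y) = T x - T y" "T (- x) = - T x" "T (sum f S) = (\<Sum>i\<in>S. T (f i))"
proof -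
  interpret Vector_Spaces.linear scale scale T by fact
  show "T (x + y) = T x + T y" "T (scale c x) = scale c (T x)" "T 0 = 0"
    "T (x - y) = T x - T y" "T (- x) = - T x" "T (sum f S) = (\<Sum>i\<in>S. T (f i))"
    by (simp_all add: add scale diff neg sum)
qed

lemma linearI:
  assumes "\<And>x y. T (x + y) = T x + T y" "\<And>c x. T (scale c x) = scale c (T x)"
  shows "Vector_Spaces.linear scale scale T"
  unfolding module_hom_iff_linear[symmetric] module_hom_def module_hom_axioms_def
  using assms module_axioms by auto

lemma linear_funpow:
  assumes "Vector_Spaces.linear scale scale T"
  shows "Vector_Spaces.linear scale scale (T ^^ n)"
  by (intro linearI; induction n) (simp_all add: linearD[OF assms])

lemma derivation_linear: "derivation scale D \<Longrightarrow> Vector_Spaces.linear scale scale D"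
  by (simp add: derivation_def)

lemma derivationI:
  assumes "\<And>x y. D (x + y) = D x + D y" "\<And>c x. D (scale c x) = scale c (D x)"
    and "\<And>x y. D (x * y) = D x * y + x * D y"
  shows "derivation scale D"
  unfolding derivation_def using linearI assms by auto

lemma derivationD:
  assumes "derivation scale D"
  shows "D (x + y) = D x + D y" "D (scale c x) = scale c (D x)" "D 0 = 0"
    "D (x - y) = D x - D y" "D (- x) = - D x" "D (sum f S) = (\<Sum>i\<in>S. D (f i))"
    "D (x * y) = D x * y + x * D y" "D 1 = 0" "D (scale c 1) = 0"
proof -
  note l = linearD[OF derivation_linear[OF assms]]
  show m: "D (x * y) = D x * y + x * D y" for x y
    using assms by (auto simp: derivation_def)
  have "D 1 = D 1 + D 1" using m[of 1 1] by (simp del: one_add_one)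
  then show one: "D 1 = 0" by (metis add_cancel_right_right)
  show "D (scale c 1) = 0" using l(2)[of c 1] one by simp
qed (use linearD[OF derivation_linear[OF assms]] in auto)

lemma derivation_power:
  assumes "derivation scale D"
  shows "D (x ^ n) = of_nat n * x ^ (n - 1) * D x"
proof (induction n)
  case (Suc n)
  then show ?case
    by (cases n) (simp_all add: derivationD[OF assms] algebra_simps)
qed (simp add: derivationD[OF assms])

lemma derivation_poly:
  assumes "derivation scale D" "\<And>i. D (coeff p i) = 0"
  shows "D (poly p x) = poly (pderiv p) x * D x"
  using assms(2)
proof (induction p)
  case 0
  then show ?case by (simp add: derivationD[OF assms(1)])
next
  case (pCons a p)
  have a: "D a = 0" using pCons.prems[of 0] by simp
  have "D (coeff p i) = 0" for i using pCons.prems[of "Suc i"] by simp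
  then have "D (poly p x) = poly (pderiv p) x * D x" by (rule pCons.IH)
  then show ?case
    by (simp add: derivationD[OF assms(1)] a pderiv_pCons algebra_simps)
qed

lemma kernel_subalgebra:
  assumes "derivation scale D"
  shows "subalgebra scale {a. D a = 0}"
  unfolding subalgebra_def
  by (auto intro!: subspaceI simp: derivationD[OF assms])

lemma subalgebra_Int: "subalgebra scale R \<Longrightarrow> subalgebra scale R' \<Longrightarrow> subalgebra scale (R \<inter> R')"
  unfolding subalgebra_def by (auto intro: subspace_inter)

lemma constants_subalgebra: "subalgebra scale (range (\<lambda>c. scale c 1))"
  unfolding subalgebra_def
proof (intro conjI ballI)
  show "subspace (range (\<lambda>c. scale c 1))"
    by (rule subspaceI)
      (auto intro: range_eqI[of _ _ 0] simp flip: scale_left_distrib)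
qed (auto simp: scale_mult_scale intro: range_eqI[of _ _ 1])

lemma derivation_add:
  "derivation scale D \<Longrightarrow> derivation scale E \<Longrightarrow> derivation scale (\<lambda>x. D x + E x)"
  by (intro derivationI) (auto simp: derivationD algebra_simps scale_right_distrib)

lemma derivation_diff:
  "derivation scale D \<Longrightarrow> derivation scale E \<Longrightarrow> derivation scale (\<lambda>x. D x - E x)"
  by (intro derivationI) (auto simp: derivationD algebra_simps scale_right_diff_distrib)

lemma derivation_mult:
  "derivation scale D \<Longrightarrow> derivation scale (\<lambda>x. r * D x)"
  by (intro derivationI) (auto simp: derivationD algebra_simps scale_mult_right)

lemma derivation_scale:
  "derivation scale D \<Longrightarrow> derivation scale (\<lambda>x. scale c (D x))"
  using derivation_mult[of D "scale c 1"] by (simp add: scale_eq_const_mult[of c "D _"])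

lemma derivation_zero: "derivation scale (\<lambda>x. 0)"
  by (intro derivationI) auto

lemma derivation_sum:
  "(\<And>i. i \<in> S \<Longrightarrow> derivation scale (f i)) \<Longrightarrow> derivation scale (\<lambda>x. \<Sum>i\<in>S. f i x)"
  by (induction S rule: infinite_finite_induct) (auto intro: derivation_add derivation_zero)

definition bracket :: "('a \<Rightarrow> 'a) \<Rightarrow> ('a \<Rightarrow> 'a) \<Rightarrow> 'a \<Rightarrow> 'a" where
  "bracket D E = (\<lambda>a. D (E a) - E (D a))"

lemma derivation_bracket:
  "derivation scale D \<Longrightarrow> derivation scale E \<Longrightarrow> derivation scale (bracket D E)"
  by (intro derivationI)
    (auto simp: bracket_def derivationD algebra_simps scale_right_diff_distrib)

definition algebraic_over :: "'a set \<Rightarrow> 'a \<Rightarrow> bool" where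
  "algebraic_over R z \<longleftrightarrow> (\<exists>p. p \<noteq> 0 \<and> (\<forall>i. coeff p i \<in> R) \<and> poly p z = 0)"

text \<open>
  Apply the derivation to a polynomial relation of minimal degree with coefficients in the kernel:
  the derivative of the polynomial does not vanish at the element.
\<close>

lemma derivation_eq_0_if_algebraic:
  assumes D: "derivation scale D" and R: "\<And>a. a \<in> R \<Longrightarrow> D a = 0" and z: "algebraic_over R z"
  shows "D z = 0"
proof -
  define P where "P p \<longleftrightarrow> p \<noteq> 0 \<and> (\<forall>i. D (coeff p i) = 0) \<and> poly p z = 0" for p
  have "\<exists>p. P p" using z R unfolding algebraic_over_def P_def by blast
  then obtain p where p: "P p" and min: "\<And>q. P q \<Longrightarrow> degree p \<le> degree q"
    using exists_least_iff[of "\<lambda>n. \<exists>p. P p \<and> degree p = n"] by (metis not_le_imp_less)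
  have "p \<noteq> 0" using p unfolding P_def by blast
  have "degree p \<noteq> 0"
  proof
    assume "degree p = 0"
    then have pc: "p = [:coeff p 0:]" by (metis degree_eq_zeroE coeff_pCons_0)
    have "p \<noteq> 0" "poly p z = 0" using p unfolding P_def by blast+
    then show False using pc by (metis mult_zero_right add.right_neutral poly_0 poly_pCons pCons_eq_0_iff)
  qed
  then have n: "degree p = Suc (degree p - 1)" by linarith
  have "coeff (pderiv p) (degree p - 1) = of_nat (degree p) * lead_coeff p"
    unfolding coeff_pderiv using n by metis
  then have lead: "pderiv p \<noteq> 0"
    using of_nat_neq_0[of "degree p"] \<open>p \<noteq> 0\<close> \<open>degree p \<noteq> 0\<close>
    by (metis coeff_0 gr0I leading_coeff_0_iff mult_eq_0_iff)
  have "degree (pderiv p) < degree p"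
  proof -
    have "coeff (pderiv p) i = 0" if "i > degree p - 1" for i
      unfolding coeff_pderiv using that by (subst coeff_eq_0) simp_all
    then have "degree (pderiv p) \<le> degree p - 1" by (intro degree_le) blast
    with n show ?thesis by linarith
  qed
  moreover have "D (coeff (pderiv p) i) = 0" for i
  proof -
    have "D (coeff p (Suc i)) = 0" using p unfolding P_def by blast
    then show ?thesis unfolding coeff_pderiv of_nat_eq_scale by (simp only: derivationD(2)[OF D] scale_zero_right)
  qed
  ultimately have "poly (pderiv p) z \<noteq> 0"
    using min[of "pderiv p"] lead unfolding P_def by (meson leD)
  moreover have "poly (pderiv p) z * D z = 0"
    using derivation_poly[OF D, of p z] p derivationD(3)[OF D] unfolding P_def by metis
  ultimately show ?thesis by simp
qed

text \<open>
  The field of complex numbers is algebraically closed: split off one linear factor at a time.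
\<close>

lemma algebraic_over_constants:
  assumes "p \<noteq> 0" "poly (map_poly (\<lambda>c. scale c 1) p) z = 0"
  shows "z \<in> range (\<lambda>c. scale c 1)"
  using assms
proof (induction "degree p" arbitrary: p rule: less_induct)
  case less
  have hom: "map_poly (\<lambda>c. scale c 1) (q * r)
      = map_poly (\<lambda>c. scale c 1) q * map_poly (\<lambda>c. scale c (1::'a)) r" for q r
    by (intro poly_eqI)
      (simp add: coeff_map_poly coeff_mult scale_sum_left scale_mult_scale)
  have "degree p \<noteq> 0"
  proof
    assume "degree p = 0"
    then obtain c where "p = [:c:]" by (rule degree_eq_zeroE)
    with less.prems show False by (simp add: map_poly_pCons)
  qed
  then obtain c where "poly p c = 0"
    using fundamental_theorem_of_algebra[of p] constant_degree[of p] by auto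
  then have "[:- c, 1:] dvd p" using poly_eq_0_iff_dvd[of p c] by blast
  then obtain q where q: "p = [:- c, 1:] * q" by (rule dvdE)
  with less.prems have "q \<noteq> 0" by auto
  then have "degree q < degree p" unfolding q by (subst degree_mult_eq) auto
  have "(z - scale c 1) * poly (map_poly (\<lambda>c. scale c 1) q) z = 0"
    using less.prems(2) unfolding q hom poly_mult
    by (simp add: map_poly_pCons algebra_simps)
  then consider "z = scale c 1" | "poly (map_poly (\<lambda>c. scale c 1) q) z = 0" by auto
  then show ?case
    using less.hyps[OF \<open>degree q < degree p\<close> \<open>q \<noteq> 0\<close>] by cases auto
qed

lemma algebraic_over_constantsD:
  assumes "algebraic_over (range (\<lambda>c. scale c 1)) z"
  shows "z \<in> range (\<lambda>c. scale c 1)"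
proof -
  obtain p where p: "p \<noteq> 0" "\<And>i. coeff p i \<in> range (\<lambda>c. scale c 1)" "poly p z = 0"
    using assms unfolding algebraic_over_def by auto
  obtain g where g: "\<And>i. coeff p i = scale (g i) 1" 
  proof -
    have "\<forall>i. \<exists>c. coeff p i = scale c 1" using p(2) by auto
    then show ?thesis using that by (auto dest: choice)
  qed
  have g0: "g i = 0 \<longleftrightarrow> coeff p i = 0" for i using g[of i] by simp
  define q where "q = Abs_poly g"
  have "coeff q = g" unfolding q_def
    by (rule coeff_Abs_poly[of "degree p"]) (use g0 coeff_eq_0 in auto)
  then have "map_poly (\<lambda>c. scale c 1) q = p"
    by (intro poly_eqI) (simp add: coeff_map_poly g)
  moreover have "q \<noteq> 0" using calculation p(1) by auto
  ultimately show ?thesis using algebraic_over_constants[of q z] p(3) by simp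
qed

end

section \<open>Transcendence degree and chains of prime ideals\<close>

context complex_domain begin

definition ideal :: "'a set \<Rightarrow> bool" where
  "ideal J \<longleftrightarrow> 0 \<in> J \<and> (\<forall>x\<in>J. \<forall>y\<in>J. x + y \<in> J) \<and> (\<forall>x\<in>J. \<forall>a. a * x \<in> J)"

lemma idealD:
  assumes "ideal J"
  shows "0 \<in> J" "x \<in> J \<Longrightarrow> y \<in> J \<Longrightarrow> x + y \<in> J" "x \<in> J \<Longrightarrow> a * x \<in> J"
    "x \<in> J \<Longrightarrow> x * a \<in> J" "x \<in> J \<Longrightarrow> y \<in> J \<Longrightarrow> x - y \<in> J" "x \<in> J \<Longrightarrow> scale c x \<in> J"
proof -
  show s: "0 \<in> J" "x \<in> J \<Longrightarrow> y \<in> J \<Longrightarrow> x + y \<in> J" "x \<in> J \<Longrightarrow> a * x \<in> J" for x y a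
    using assms by (auto simp: ideal_def)
  show "x \<in> J \<Longrightarrow> x * a \<in> J" using s(3)[of x a] by (simp add: mult.commute)
  show "x \<in> J \<Longrightarrow> y \<in> J \<Longrightarrow> x - y \<in> J" using s(2)[of x "-1 * y"] s(3)[of y "-1"] by simp
  show "x \<in> J \<Longrightarrow> scale c x \<in> J"
    using s(3)[of x "scale c 1"] by (simp add: scale_eq_const_mult[of c x])
qed

lemma prime_ideal_iff:
  "prime_ideal P \<longleftrightarrow> ideal P \<and> 1 \<notin> P \<and> (\<forall>x y. x * y \<in> P \<longrightarrow> x \<in> P \<or> y \<in> P)"
proof -
  have m: "module ((*) :: 'a \<Rightarrow> 'a \<Rightarrow> 'a)"
    by unfold_locales (auto simp: algebra_simps)
  have "P \<noteq> UNIV \<longleftrightarrow> 1 \<notin> P" if "ideal P"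
    using idealD(3)[OF that, of 1] by auto
  then show ?thesis
    unfolding prime_ideal_def module.subspace_def[OF m] ideal_def by blast
qed

lemma ideal_sum:
  assumes "ideal J" "\<And>i. i \<in> S \<Longrightarrow> f i \<in> J"
  shows "sum f S \<in> J"
  using assms(2) by (induction S rule: infinite_finite_induct) (auto intro: idealD[OF assms(1)])

lemma ideal_add_multiples:
  assumes P: "ideal P"
  shows "ideal {q + a * x | q a. q \<in> P}"
  unfolding ideal_def
proof (intro conjI ballI allI)
  let ?J = "{q + a * x | q a. q \<in> P}"
  have I: "q + a * x \<in> ?J" if "q \<in> P" for q a using that by blast
  show "0 \<in> ?J" using I[OF idealD(1)[OF P], of 0] by simp
  show "y + z \<in> ?J" if yz: "y \<in> ?J" "z \<in> ?J" for y z
  proof -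
    obtain q a q' a' where "y = q + a * x" "z = q' + a' * x" "q \<in> P" "q' \<in> P" using yz by blast
    then show ?thesis using I[OF idealD(2)[OF P], of q q' "a + a'"] by (simp add: algebra_simps)
  qed
  show "b * y \<in> ?J" if y: "y \<in> ?J" for y b
  proof -
    obtain q a where "y = q + a * x" "q \<in> P" using y by blast
    then show ?thesis using I[OF idealD(3)[OF P], of q b "b * a"] by (simp add: algebra_simps)
  qed
qed

text \<open>
  A maximal ideal among those that avoid the nonzero elements of the subalgebra is prime, since these
  elements are closed under products.
\<close>

lemma exists_prime_avoiding_subalgebra:
  assumes J: "ideal J" and R: "subalgebra scale R" and JR: "J \<inter> R \<subseteq> {0}"
  obtains Q where "prime_ideal Q" "J \<subseteq> Q" "Q \<inter> R \<subseteq> {0}"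
proof -
  define F where "F = {Q. ideal Q \<and> J \<subseteq> Q \<and> Q \<inter> R \<subseteq> {0}}"
  have "\<exists>U\<in>F. \<forall>X\<in>C. X \<subseteq> U" if C: "C \<in> chains F" for C
  proof (cases "C = {}")
    case True
    then show ?thesis using J JR unfolding F_def by blast
  next
    case False
    have ch: "X \<subseteq> Y \<or> Y \<subseteq> X" if "X \<in> C" "Y \<in> C" for X Y
      using C that unfolding chains_def chain_subset_def by blast
    have CF: "C \<subseteq> F" using C unfolding chains_def by blast
    have "ideal (\<Union>C)"
      unfolding ideal_def
    proof (intro conjI ballI allI)
      show "0 \<in> \<Union>C" using False CF unfolding F_def ideal_def by blast
      show "a * x \<in> \<Union>C" if "x \<in> \<Union>C" for x a using that CF unfolding F_def ideal_def by blast
      fix x y assume "x \<in> \<Union>C" "y \<in> \<Union>C"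
      then obtain X Y where "x \<in> X" "X \<in> C" "y \<in> Y" "Y \<in> C" by blast
      with ch[of X Y] CF show "x + y \<in> \<Union>C" unfolding F_def ideal_def by blast
    qed
    moreover have "J \<subseteq> \<Union>C" "\<Union>C \<inter> R \<subseteq> {0}" using False CF unfolding F_def by blast+
    ultimately have "\<Union>C \<in> F" unfolding F_def by blast
    then show ?thesis by blast
  qed
  then have "\<exists>Q\<in>F. \<forall>X\<in>F. Q \<subseteq> X \<longrightarrow> X = Q" by (intro Zorn_Lemma2) (rule ballI)
  then obtain Q where Q: "Q \<in> F" and max: "\<And>X. X \<in> F \<Longrightarrow> Q \<subseteq> X \<Longrightarrow> X = Q"
    by metis
  have iQ: "ideal Q" "J \<subseteq> Q" "Q \<inter> R \<subseteq> {0}" using Q by (auto simp: F_def)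
  have meet: "\<exists>r\<in>R. r \<noteq> 0 \<and> (\<exists>q\<in>Q. \<exists>a. r = q + a * x)" if "x \<notin> Q" for x
  proof (rule ccontr)
    assume neg: "\<not> ?thesis"
    define Q' where "Q' = {q + a * x | q a. q \<in> Q}"
    have "ideal Q'" unfolding Q'_def by (rule ideal_add_multiples[OF iQ(1)])
    moreover have sub: "Q \<subseteq> Q'" unfolding Q'_def
    proof
      show "y \<in> {q + a * x | q a. q \<in> Q}" if "y \<in> Q" for y
        using that by (intro CollectI exI[of _ y] exI[of _ 0]) simp
    qed
    moreover have "Q' \<inter> R \<subseteq> {0}" using neg unfolding Q'_def by blast
    ultimately have "Q' \<in> F" using iQ unfolding F_def by blast
    with max sub have "Q' = Q" by blast
    moreover have "x \<in> Q'" unfolding Q'_def using idealD(1)[OF iQ(1)]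
      by (intro CollectI exI[of _ 0] exI[of _ 1]) simp
    ultimately show False using that by blast
  qed
  have "1 \<notin> Q" using iQ(3) subalgebraD(2)[OF R] by auto
  moreover have "x \<in> Q \<or> y \<in> Q" if xy: "x * y \<in> Q" for x y
  proof (rule ccontr)
    assume "\<not> ?thesis"
    then obtain r r' q q' a a' where r: "r \<in> R" "r \<noteq> 0" "q \<in> Q" "r = q + a * x"
      and r': "r' \<in> R" "r' \<noteq> 0" "q' \<in> Q" "r' = q' + a' * y"
      using meet[of x] meet[of y] by blast
    have "r * r' = q * (q' + a' * y) + (a * x) * q' + (a * a') * (x * y)"
      unfolding r r' by (simp add: algebra_simps)
    also have "\<dots> \<in> Q"
      using idealD(4)[OF iQ(1) r(3)] idealD(3)[OF iQ(1) r'(3)] idealD(3)[OF iQ(1) xy]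
      by (intro idealD(2)[OF iQ(1)])
    finally have "r * r' \<in> Q \<inter> R" using subalgebraD(5)[OF R r(1) r'(1)] by blast
    then show False using iQ(3) r r' by auto
  qed
  ultimately show thesis using that iQ unfolding prime_ideal_iff by blast
qed

end

lemma uncountable_complex: "\<not> countable (UNIV :: complex set)"
proof
  assume "countable (UNIV :: complex set)"
  then have "countable (Re ` UNIV)" by (rule countable_image)
  moreover have "Re ` UNIV = UNIV" by (metis Re_complex_of_real surjI)
  ultimately show False using uncountable_UNIV_real by simp
qed

locale affine_domain = complex_domain +
  assumes finitely_generated: "finitely_generated_algebra scale"
begin

text \<open>
  The monomials in finitely many generators span the algebra.
\<close>

lemma countable_spanning_set: "\<exists>M. countable M \<and> span M = UNIV"
proof -
  obtain S where S: "finite S" "\<And>B. subalgebra scale B \<Longrightarrow> S \<subseteq> B \<Longrightarrow> B = UNIV"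
    using finitely_generated unfolding finitely_generated_algebra_def by blast
  define M where "M = prod_list ` lists S"
  have mult: "x * y \<in> span M" if "x \<in> span M" "y \<in> span M" for x y
    using that(1)
  proof (induction rule: span_induct_alt)
    case (step c x z)
    have "x * y \<in> span M" using that(2)
    proof (induction rule: span_induct_alt)
      case (step d y w)
      obtain xs ys where "xs \<in> lists S" "ys \<in> lists S" "x = prod_list xs" "y = prod_list ys"
        using step \<open>x \<in> M\<close> unfolding M_def by blast
      then have "x * y \<in> M" unfolding M_def by (intro image_eqI[of _ _ "xs @ ys"]) auto
      then have "scale d (x * y) + x * w \<in> span M"
        using step by (intro span_add span_scale) (auto intro: span_base)
      then show ?case by (simp add: distrib_left scale_mult_right)
    qed (simp add: span_zero)
    then have "scale c (x * y) + z * y \<in> span M" using step by (intro span_add span_scale)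
    then show ?case by (simp add: distrib_right scale_mult_left)
  qed (simp add: span_zero)
  have "1 \<in> M" unfolding M_def by (intro image_eqI[of _ _ "[]"]) auto
  then have "subalgebra scale (span M)"
    unfolding subalgebra_def using mult by (auto intro: span_base)
  moreover have "S \<subseteq> M" unfolding M_def by (auto intro!: image_eqI[of _ _ "[_]"])
  then have "S \<subseteq> span M" using span_superset by blast
  ultimately have "span M = UNIV" using S by blast
  moreover have "countable M" unfolding M_def using S(1) by (simp add: countable_finite)
  ultimately show ?thesis by blast
qed

text \<open>
  Some finite part of the countable spanning set already spans infinitely many members of the family.
  The family need not be injective, so the dependence is stated for the indices.
\<close>

lemma uncountable_family_dependent:
  fixes a :: "complex \<Rightarrow> 'a"
  shows "\<exists>C \<mu>. finite C \<and> C \<noteq> {} \<and> (\<forall>c\<in>C. \<mu> c \<noteq> 0) \<and> (\<Sum>c\<in>C. scale (\<mu> c) (a c)) = 0"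
proof -
  obtain M where M: "countable M" "span M = UNIV" using countable_spanning_set by blast
  have "UNIV \<subseteq> (\<Union>F\<in>{F. F \<subseteq> M \<and> finite F}. {c. a c \<in> span F})"
  proof
    fix c
    have "a c \<in> span M" using M by simp
    then obtain t r where "finite t" "t \<subseteq> M" "a c = (\<Sum>v\<in>t. scale (r v) v)"
      unfolding span_explicit by blast
    moreover have "(\<Sum>v\<in>t. scale (r v) v) \<in> span t"
      by (intro span_sum span_scale span_base)
    ultimately show "c \<in> (\<Union>F\<in>{F. F \<subseteq> M \<and> finite F}. {c. a c \<in> span F})" by auto
  qed
  moreover have "countable {F. F \<subseteq> M \<and> finite F}"
    using countable_Collect_finite_subset[OF M(1)] by (simp add: conj_commute)
  ultimately obtain F where F: "finite F" "\<not> countable {c. a c \<in> span F}"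
    using uncountable_complex by (metis (no_types, lifting) countable_UN countable_subset mem_Collect_eq)
  then have "infinite {c. a c \<in> span F}" using countable_finite by blast
  then obtain C where C: "finite C" "card C = Suc (card F)" "C \<subseteq> {c. a c \<in> span F}"
    by (metis infinite_arbitrarily_large)
  have "\<exists>C'\<subseteq>C. C' \<noteq> {} \<and> (\<exists>\<mu>. (\<forall>c\<in>C'. \<mu> c \<noteq> 0) \<and> (\<Sum>c\<in>C'. scale (\<mu> c) (a c)) = 0)"
  proof (cases "inj_on a C")
    case False
    then obtain c d where cd: "c \<in> C" "d \<in> C" "c \<noteq> d" "a c = a d" unfolding inj_on_def by blast
    then show ?thesis
      by (intro exI[of _ "{c, d}"] conjI exI[of _ "\<lambda>e. if e = c then 1 else -1"]) auto
  next
    case True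
    have "dependent (a ` C)"
    proof (rule ccontr)
      assume "independent (a ` C)"
      then have "card (a ` C) \<le> card F"
        using independent_span_bound[OF F(1), of "a ` C"] C by auto
      with C True show False by (simp add: card_image)
    qed
    then obtain u v where u: "v \<in> a ` C" "u v \<noteq> 0" "(\<Sum>v\<in>a ` C. scale (u v) v) = 0"
      using C by (auto simp: dependent_finite)
    then have "(\<Sum>c\<in>C. scale (u (a c)) (a c)) = 0" using True by (simp add: sum.reindex)
    then have "(\<Sum>c\<in>{c\<in>C. u (a c) \<noteq> 0}. scale (u (a c)) (a c)) = 0"
      using C by (subst sum.mono_neutral_left[of C]) auto
    then show ?thesis using u
      by (intro exI[of _ "{c\<in>C. u (a c) \<noteq> 0}"] conjI exI[of _ "\<lambda>c. u (a c)"]) auto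
  qed
  then show ?thesis using C finite_subset by metis
qed

text \<open>
  For some complex number c the ideal generated by \<open>P\<close> and \<open>z - c\<close> avoids the nonzero elements of \<open>R\<close>.
  Otherwise, for each c there is a nonzero \<open>r c\<close> in \<open>R\<close> that is congruent to \<open>a c * (z - c)\<close> modulo \<open>P\<close>.
  Then \<open>a c\<close> represents \<open>r c / (z - c)\<close>, and a linear dependence among these uncountably many elements
  becomes, after clearing denominators, an algebraic equation for z over \<open>R\<close> modulo \<open>P\<close>. It is not
  trivial, as its value at one of the c in question shows. This is the argument by which the
  Nullstellensatz is proved over uncountable fields.
\<close>

lemma exists_larger_prime:
  assumes P: "prime_ideal P" and R: "subalgebra scale R" and PR: "P \<inter> R \<subseteq> {0}"
    and z: "\<And>p. (\<And>i. coeff p i \<in> R) \<Longrightarrow> poly p z \<in> P \<Longrightarrow> p = 0"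
  obtains Q where "prime_ideal Q" "P \<subset> Q" "Q \<inter> R \<subseteq> {0}"
proof -
  have iP: "ideal P" using P by (simp add: prime_ideal_iff)
  have co: "coeff [:scale c 1, 1:] i \<in> R" for c i
    using subalgebraD[OF R] by (auto simp: coeff_pCons split: nat.splits)
  have zP: "z - scale c 1 \<notin> P" for c
    using z[of "[:scale (- c) 1, 1:]"] co[of "-c"] by (auto simp: algebra_simps)
  define J where "J c = {q + a * (z - scale c 1) | q a. q \<in> P}" for c
  have iJ: "ideal (J c)" for c
    unfolding J_def by (rule ideal_add_multiples[OF iP])
  have "\<exists>c. J c \<inter> R \<subseteq> {0}"
  proof (rule ccontr)
    assume "\<not> ?thesis"
    then have "\<forall>c. \<exists>r. r \<in> R \<and> r \<noteq> 0 \<and> (\<exists>a q. q \<in> P \<and> r = q + a * (z - scale c 1))"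
      unfolding J_def by blast
    then obtain r a q where r: "\<And>c. r c \<in> R" "\<And>c. r c \<noteq> 0" "\<And>c. q c \<in> P"
      "\<And>c. r c = q c + a c * (z - scale c 1)" by metis
    obtain C \<mu> where C: "finite C" "C \<noteq> {}" "\<And>c. c \<in> C \<Longrightarrow> \<mu> c \<noteq> 0"
      and dep: "(\<Sum>c\<in>C. scale (\<mu> c) (a c)) = 0" using uncountable_family_dependent[of a] by blast
    define B where "B = {p :: 'a poly. \<forall>i. coeff p i \<in> R}"
    have B_mult: "p * p' \<in> B" if "p \<in> B" "p' \<in> B" for p p'
      using that subalgebraD[OF R] unfolding B_def
      by (auto simp: coeff_mult intro!: subspace_sum)
    have B_prod: "prod f S \<in> B" if "\<And>i. i \<in> S \<Longrightarrow> f i \<in> B" for f and S :: "complex set"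
      using that
    proof (induction S rule: infinite_finite_induct)
      case (insert x F)
      then show ?case by (auto intro: B_mult)
    qed (use subalgebraD[OF R] in \<open>auto simp: B_def of_bool_def\<close>)
    \<comment> \<open>the summands of the linear dependence between the fractions r c / (z - c) after clearing denominators\<close>
    define f where "f c = smult (scale (\<mu> c) (r c)) (\<Prod>d\<in>C - {c}. [:scale (- d) 1, 1:])" for c
    have fB: "f c \<in> B" for c
    proof -
      have "(\<Prod>d\<in>C - {c}. [:scale (- d) 1, 1:]) \<in> B"
        by (rule B_prod) (unfold B_def, blast intro: co)
      then show ?thesis unfolding f_def B_def using subalgebraD[OF R] r(1) by simp
    qed
    have ev: "poly (f c) y = scale (\<mu> c) (r c) * (\<Prod>d\<in>C - {c}. y - scale d 1)" for c y
      unfolding f_def by (simp add: poly_prod algebra_simps)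
    define p where "p = (\<Sum>c\<in>C. f c)"
    have "coeff p i \<in> R" for i
      using fB subalgebraD(1)[OF R] unfolding p_def B_def by (auto simp: coeff_sum intro: subspace_sum)
    moreover have "poly p z \<in> P"
    proof -
      have "(\<Sum>c\<in>C. scale (\<mu> c) (a c) * (\<Prod>d\<in>C. z - scale d 1)) = 0"
        using dep by (simp flip: sum_distrib_right)
      moreover have "scale (\<mu> c) (a c) * (\<Prod>d\<in>C. z - scale d 1)
          = poly (f c) z - scale (\<mu> c) (q c) * (\<Prod>d\<in>C - {c}. z - scale d 1)" if "c \<in> C" for c
      proof -
        have "scale (\<mu> c) (a c) * (\<Prod>d\<in>C. z - scale d 1)
            = scale (\<mu> c) (a c * (z - scale c 1)) * (\<Prod>d\<in>C - {c}. z - scale d 1)"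
          using prod.remove[OF C(1) that, of "\<lambda>d. z - scale d 1"]
          by (simp add: scale_mult_left mult.assoc)
        also have "a c * (z - scale c 1) = r c - q c" using r(4)[of c] by simp
        finally show ?thesis unfolding ev by (simp add: scale_right_diff_distrib algebra_simps)
      qed
      ultimately have "poly p z = (\<Sum>c\<in>C. scale (\<mu> c) (q c) * (\<Prod>d\<in>C - {c}. z - scale d 1))"
        unfolding p_def poly_sum by (simp add: sum_subtractf)
      also have "\<dots> \<in> P" by (intro ideal_sum idealD(4,6)[OF iP] r iP)
      finally show ?thesis .
    qed
    ultimately have "p = 0" by (rule z)
    obtain c where c: "c \<in> C" using C by blast
    \<comment> \<open>p is not zero, since at a value c in C only one summand survives\<close>
    have "poly p (scale c 1) = (\<Sum>d\<in>C. poly (f d) (scale c 1))" unfolding p_def by (simp add: poly_sum)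
    also have "\<dots> = (\<Sum>d\<in>C. if d = c then poly (f d) (scale c 1) else 0)"
    proof (intro sum.cong refl)
      fix d assume "d \<in> C"
      show "poly (f d) (scale c 1) = (if d = c then poly (f d) (scale c 1) else 0)"
        using C(1) c unfolding ev by (auto simp: prod_zero_iff)
    qed
    also have "\<dots> = poly (f c) (scale c 1)" using C c by simp
    also have "\<dots> \<noteq> 0" using C c r unfolding ev
      by (auto simp: prod_zero_iff)
    finally show False using \<open>p = 0\<close> by simp
  qed
  then obtain c where c: "J c \<inter> R \<subseteq> {0}" by blast
  obtain Q where Q: "prime_ideal Q" "J c \<subseteq> Q" "Q \<inter> R \<subseteq> {0}"
    using exists_prime_avoiding_subalgebra[OF iJ R c] by blast
  have "P \<subseteq> J c" unfolding J_def
  proof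
    show "y \<in> {q + a * (z - scale c 1) | q a. q \<in> P}" if "y \<in> P" for y
      using that by (intro CollectI exI[of _ y] exI[of _ 0]) simp
  qed
  moreover have "z - scale c 1 \<in> J c" unfolding J_def
    using idealD(1)[OF iP] by (intro CollectI exI[of _ 0] exI[of _ 1]) simp
  ultimately have "P \<subset> Q" using Q zP by blast
  with Q that show thesis by blast
qed

end

locale affine_surface = affine_domain +
  assumes dimension: "krull_dim TYPE('a) = 2"
begin

text \<open>
  The third element z, if transcendental over \<open>R2\<close>, yields a nonzero prime avoiding \<open>R2\<close>; then y
  yields a larger one avoiding \<open>R1\<close> and x a still larger one avoiding the constants. Together with the
  zero ideal they form a chain that is too long for a surface.
\<close>

lemma algebraic_over_third:
  assumes R1: "subalgebra scale R1" and R2: "subalgebra scale R2" and "R1 \<subseteq> R2"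
    and x: "x \<in> R1" "x \<notin> range (\<lambda>c. scale c 1)"
    and y: "y \<in> R2" "\<not> algebraic_over R1 y"
  shows "algebraic_over R2 z"
proof (rule ccontr)
  assume z: "\<not> algebraic_over R2 z"
  let ?C = "range (\<lambda>c. scale c 1)"
  have C: "?C \<subseteq> R1" using subalgebraD(4)[OF R1] by blast
  have 0: "prime_ideal {0::'a}" unfolding prime_ideal_iff ideal_def by auto
  obtain P1 where P1: "prime_ideal P1" "{0} \<subset> P1" "P1 \<inter> R2 \<subseteq> {0}"
  proof (rule exists_larger_prime[OF 0 R2])
    show "p = 0" if "\<And>i. coeff p i \<in> R2" "poly p z \<in> {0}" for p
      using z that unfolding algebraic_over_def by blast
  qed auto
  obtain P2 where P2: "prime_ideal P2" "P1 \<subset> P2" "P2 \<inter> R1 \<subseteq> {0}"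
  proof (rule exists_larger_prime[OF P1(1) R1])
    show "p = 0" if p: "\<And>i. coeff p i \<in> R1" "poly p y \<in> P1" for p
    proof -
      have "poly p y \<in> R2" using poly_in_subalgebra[OF R2] p \<open>R1 \<subseteq> R2\<close> y by blast
      then show ?thesis using p P1 y unfolding algebraic_over_def by blast
    qed
  qed (use P1 \<open>R1 \<subseteq> R2\<close> in auto)
  obtain P3 where P3: "prime_ideal P3" "P2 \<subset> P3"
  proof (rule exists_larger_prime[OF P2(1) constants_subalgebra])
    show "p = 0" if p: "\<And>i. coeff p i \<in> ?C" "poly p x \<in> P2" for p
    proof -
      have "poly p x \<in> R1" using poly_in_subalgebra[OF R1] p C x by blast
      then have "poly p x = 0" using p P2 by blast
      then show ?thesis using algebraic_over_constantsD[of x] p(1) x unfolding algebraic_over_def by blast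
    qed
  qed (use P2 C in auto)
  define P where "P = (\<lambda>n::nat. if n = 0 then {0} else if n = 1 then P1 else if n = 2 then P2 else P3)"
  have "prime_chain 3 P"
    unfolding prime_chain_def
  proof (intro conjI allI impI)
    fix i :: nat
    show "prime_ideal (P i)" unfolding P_def using 0 P1 P2 P3 by auto
    assume "i < 3"
    then consider "i = 0" | "i = 1" | "i = 2" by linarith
    then show "P i \<subset> P (Suc i)" unfolding P_def using P1 P2 P3 by cases auto
  qed
  then have "enat 3 \<le> krull_dim TYPE('a)"
    unfolding krull_dim_def by (intro Sup_upper) blast
  then show False unfolding dimension by (simp add: numeral_eq_enat)
qed

end

section \<open>Locally nilpotent derivations\<close>

context complex_domain begin

lemma LND_D:
  assumes "D \<in> LND scale"
  shows "derivation scale D" "\<exists>n. (D ^^ n) a = 0"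
  using assms by (auto simp: LND_def)

lemma funpow_eq_0_mono:
  assumes "Vector_Spaces.linear scale scale D" "(D ^^ n) a = 0" "n \<le> m"
  shows "(D ^^ m) a = 0"
proof -
  have "(D ^^ m) a = (D ^^ (m - n)) ((D ^^ n) a)"
    using assms(3) by (metis funpow_add o_apply le_add_diff_inverse2)
  then show ?thesis using linearD(3)[OF linear_funpow[OF assms(1)]] assms(2) by simp
qed

lemma LND_iff_nilpotent_on_spanning_set:
  assumes "derivation scale D" "span B = UNIV" "\<And>b. b \<in> B \<Longrightarrow> \<exists>n. (D ^^ n) b = 0"
  shows "D \<in> LND scale"
proof -
  note l = derivation_linear[OF assms(1)]
  have "subspace {a. \<exists>n. (D ^^ n) a = 0}"
  proof (rule subspaceI)
    show "0 \<in> {a. \<exists>n. (D ^^ n) a = 0}" by (auto intro: exI[of _ 0])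
    show "x + y \<in> {a. \<exists>n. (D ^^ n) a = 0}"
      if xy: "x \<in> {a. \<exists>n. (D ^^ n) a = 0}" "y \<in> {a. \<exists>n. (D ^^ n) a = 0}" for x y
    proof -
      obtain n m where "(D ^^ n) x = 0" "(D ^^ m) y = 0" using xy by blast
      then have "(D ^^ (max n m)) (x + y) = 0"
        using funpow_eq_0_mono[OF l] linearD(1)[OF linear_funpow[OF l]] by simp
      then show ?thesis by blast
    qed
    show "scale c x \<in> {a. \<exists>n. (D ^^ n) a = 0}" if x: "x \<in> {a. \<exists>n. (D ^^ n) a = 0}" for c x
      using x linearD(2)[OF linear_funpow[OF l]] by fastforce
  qed
  moreover have "B \<subseteq> {a. \<exists>n. (D ^^ n) a = 0}" using assms(3) by blast
  ultimately have "span B \<subseteq> {a. \<exists>n. (D ^^ n) a = 0}" by (intro span_minimal)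
  then show ?thesis using assms unfolding LND_def by blast
qed

lemma LND_last_nonzero:
  assumes "D \<in> LND scale" "a \<noteq> 0"
  obtains n where "(D ^^ n) a \<noteq> 0" "(D ^^ Suc n) a = 0"
proof -
  obtain m where "(D ^^ m) a = 0" using LND_D(2)[OF assms(1)] by blast
  moreover have "(D ^^ 0) a \<noteq> 0" using assms(2) by simp
  ultimately obtain k where "(D ^^ k) a \<noteq> 0" "(D ^^ Suc k) a = 0"
    using ex_least_nat_less[of "\<lambda>n. (D ^^ n) a = 0" m] by auto
  then show thesis by (rule that)
qed

lemma LND_local_slice:
  assumes "D \<in> LND scale" "D a \<noteq> 0"
  obtains s where "D s \<noteq> 0" "D (D s) = 0"
proof -
  obtain n where "(D ^^ n) (D a) \<noteq> 0" "(D ^^ Suc n) (D a) = 0"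
    using LND_last_nonzero[OF assms] by blast
  then show thesis using that[of "(D ^^ n) a"] by (metis funpow_simps_right(2) funpow_swap1 o_apply funpow.simps(2))
qed

lemma derivation_leibniz:
  assumes D: "derivation scale D"
  shows "(D ^^ n) (x * y) = (\<Sum>k\<le>n. of_nat (n choose k) * ((D ^^ k) x * (D ^^ (n - k)) y))"
proof (induction n)
  case (Suc n)
  let ?t = "\<lambda>k m. (D ^^ k) x * (D ^^ m) y"
  have Dn: "D (of_nat m * z) = of_nat m * D z" for m z
    using derivationD(2)[OF D] by (simp add: of_nat_eq_scale)
  have "(D ^^ Suc n) (x * y) = D (\<Sum>k\<le>n. of_nat (n choose k) * ?t k (n - k))"
    using Suc.IH by simp
  also have "\<dots> = (\<Sum>k\<le>n. of_nat (n choose k) * (?t (Suc k) (n - k) + ?t k (Suc (n - k))))"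
    unfolding derivationD(6)[OF D] Dn by (simp add: derivationD(7)[OF D])
  also have "\<dots> = (\<Sum>k\<le>n. of_nat (n choose k) * ?t (Suc k) (n - k))
      + (\<Sum>k\<le>n. of_nat (n choose k) * ?t k (Suc n - k))"
    by (simp add: distrib_left sum.distrib Suc_diff_le)
  also have "(\<Sum>k\<le>n. of_nat (n choose k) * ?t k (Suc n - k))
      = (\<Sum>k\<le>Suc n. of_nat (n choose k) * ?t k (Suc n - k))" by (simp add: binomial_eq_0)
  also have "\<dots> = ?t 0 (Suc n) + (\<Sum>k\<le>n. of_nat (n choose Suc k) * ?t (Suc k) (n - k))"
    by (subst sum.atMost_Suc_shift) simp
  also have "(\<Sum>k\<le>n. of_nat (n choose k) * ?t (Suc k) (n - k))
      + (?t 0 (Suc n) + (\<Sum>k\<le>n. of_nat (n choose Suc k) * ?t (Suc k) (n - k)))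
      = (\<Sum>k\<le>Suc n. of_nat (Suc n choose k) * ?t k (Suc n - k))"
    by (simp only: sum.atMost_Suc_shift) (simp add: algebra_simps sum.distrib)
  finally show ?case .
qed simp

text \<open>
  The index of nilpotency of a product is determined by those of the factors, because only one term of
  the Leibniz formula survives.
\<close>

lemma LND_top_mult:
  assumes D: "D \<in> LND scale"
    and a: "(D ^^ n) a \<noteq> 0" "(D ^^ Suc n) a = 0" and b: "(D ^^ m) b \<noteq> 0" "(D ^^ Suc m) b = 0"
  shows "(D ^^ (n + m)) (a * b) \<noteq> 0"
proof -
  note l = derivation_linear[OF LND_D(1)[OF D]]
  have "(D ^^ k) a * (D ^^ (n + m - k)) b = 0" if "k \<le> n + m" "k \<noteq> n" for k
  proof (cases "k < n")
    case True
    then have "(D ^^ (n + m - k)) b = 0" by (intro funpow_eq_0_mono[OF l b(2)]) auto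
    then show ?thesis by simp
  next
    case False
    then have "(D ^^ k) a = 0" using that by (intro funpow_eq_0_mono[OF l a(2)]) auto
    then show ?thesis by simp
  qed
  then have "(D ^^ (n + m)) (a * b)
      = (\<Sum>k\<le>n + m. if k = n then of_nat ((n + m) choose n) * ((D ^^ n) a * (D ^^ m) b) else 0)"
    unfolding derivation_leibniz[OF LND_D(1)[OF D]] by (intro sum.cong refl) auto
  also have "\<dots> = of_nat ((n + m) choose n) * ((D ^^ n) a * (D ^^ m) b)" by simp
  finally show ?thesis using a b of_nat_neq_0[of "(n + m) choose n"] by simp
qed

text \<open>
  A nonzero multiple \<open>a * b\<close> has at least the index of nilpotency of a, but D lowers this index.
\<close>

lemma LND_eq_0_if_dvd:
  assumes D: "D \<in> LND scale" and dvd: "D a = a * b"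
  shows "D a = 0"
proof (rule ccontr)
  assume "D a \<noteq> 0"
  then have "a \<noteq> 0" "b \<noteq> 0" using dvd by auto
  obtain n where n: "(D ^^ n) a \<noteq> 0" "(D ^^ Suc n) a = 0"
    by (rule LND_last_nonzero[OF D \<open>a \<noteq> 0\<close>])
  obtain m where m: "(D ^^ m) b \<noteq> 0" "(D ^^ Suc m) b = 0"
    by (rule LND_last_nonzero[OF D \<open>b \<noteq> 0\<close>])
  have "(D ^^ (n + m)) (D a) \<noteq> 0" unfolding dvd by (rule LND_top_mult[OF D n m])
  moreover have "(D ^^ (n + m)) (D a) = (D ^^ Suc (n + m)) a" by (simp only: funpow_Suc_right o_apply)
  moreover have "(D ^^ Suc (n + m)) a = 0"
    by (rule funpow_eq_0_mono[OF derivation_linear[OF LND_D(1)[OF D]] n(2)]) simp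
  ultimately show False by simp
qed

lemma funpow_mult_kernel:
  assumes D: "derivation scale D" and r: "D r = 0"
  shows "((\<lambda>x. r * D x) ^^ n) a = r ^ n * (D ^^ n) a"
proof (induction n)
  case (Suc n)
  have "D (r ^ n) = 0" using derivation_power[OF D, of r n] r by simp
  then show ?case using Suc.IH by (simp add: derivationD(7)[OF D] algebra_simps)
qed simp

lemma LND_mult_kernel:
  assumes "D \<in> LND scale" "D r = 0"
  shows "(\<lambda>x. r * D x) \<in> LND scale"
  using assms funpow_mult_kernel[of D r] unfolding LND_def
  by (auto simp: derivation_mult)

lemma LND_if_LND_mult:
  assumes "derivation scale D" "D r = 0" "r \<noteq> 0" "(\<lambda>x. r * D x) \<in> LND scale"
  shows "D \<in> LND scale"
  unfolding LND_def
proof (intro CollectI conjI allI)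
  fix a
  obtain n where "((\<lambda>x. r * D x) ^^ n) a = 0" using LND_D(2)[OF assms(4)] by blast
  then have "(D ^^ n) a = 0" using funpow_mult_kernel[OF assms(1,2)] assms(3) by simp
  then show "\<exists>n. (D ^^ n) a = 0" ..
qed fact

lemma zero_LND: "(\<lambda>x. 0) \<in> LND scale"
  unfolding LND_def by (auto simp: derivation_zero intro!: exI[of _ 1])

section \<open>Weight decompositions\<close>

lemma weight_spaceI: "T a = scale \<alpha> a \<Longrightarrow> a \<in> weight_space T \<alpha>"
  and weight_spaceD: "a \<in> weight_space T \<alpha> \<Longrightarrow> T a = scale \<alpha> a"
  by (auto simp: weight_space_def)

lemma subspace_weight_space:
  "Vector_Spaces.linear scale scale T \<Longrightarrow> subspace (weight_space T \<alpha>)"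
  by (rule subspaceI) (auto simp: weight_space_def linearD scale_right_distrib mult.commute)

text \<open>
  Applying \<open>T - \<beta>\<close> to the sum removes the summand of weight \<open>\<beta>\<close> and multiplies the others by nonzero
  scalars, so the claim follows by induction on the number of summands.
\<close>

lemma weight_components_mem:
  assumes T: "Vector_Spaces.linear scale scale T" and V: "subspace V" "\<And>v. v \<in> V \<Longrightarrow> T v \<in> V"
    and "finite F" "\<And>\<alpha>. \<alpha> \<in> F \<Longrightarrow> x \<alpha> \<in> weight_space T \<alpha>" "(\<Sum>\<alpha>\<in>F. x \<alpha>) \<in> V" "\<alpha> \<in> F"
  shows "x \<alpha> \<in> V"
  using assms(4-)
proof (induction F arbitrary: x \<alpha> rule: finite_induct)
  case (insert \<beta> F)
  have "T (\<Sum>\<alpha>\<in>insert \<beta> F. x \<alpha>) - scale \<beta> (\<Sum>\<alpha>\<in>insert \<beta> F. x \<alpha>)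
      = (\<Sum>\<alpha>\<in>insert \<beta> F. scale (\<alpha> - \<beta>) (x \<alpha>))"
    using insert.prems(1) unfolding linearD(6)[OF T] scale_sum_right sum_subtractf[symmetric]
    by (intro sum.cong refl) (auto simp: weight_space_def scale_left_diff_distrib)
  also have "\<dots> = (\<Sum>\<alpha>\<in>F. scale (\<alpha> - \<beta>) (x \<alpha>))" using insert.hyps by simp
  finally have "(\<Sum>\<alpha>\<in>F. scale (\<alpha> - \<beta>) (x \<alpha>)) \<in> V"
    using V insert.prems(2) by (metis subspace_diff subspace_scale)
  moreover have "scale (\<alpha> - \<beta>) (x \<alpha>) \<in> weight_space T \<alpha>" if "\<alpha> \<in> F" for \<alpha>
    using insert.prems(1)[of \<alpha>] that subspace_scale[OF subspace_weight_space[OF T]] by auto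
  ultimately have h: "scale (\<alpha> - \<beta>) (x \<alpha>) \<in> V" if "\<alpha> \<in> F" for \<alpha>
    using insert.IH[of "\<lambda>\<alpha>. scale (\<alpha> - \<beta>) (x \<alpha>)"] that by blast
  have sc: "scale (1 / (\<alpha> - \<beta>)) (scale (\<alpha> - \<beta>) (x \<alpha>)) \<in> V" if "\<alpha> \<in> F" for \<alpha>
    by (rule subspace_scale[OF V(1) h[OF that]])
  have F: "x \<alpha> \<in> V" if "\<alpha> \<in> F" for \<alpha>
  proof -
    have "\<alpha> - \<beta> \<noteq> 0" using that insert.hyps by auto
    then have "scale (1 / (\<alpha> - \<beta>)) (scale (\<alpha> - \<beta>) (x \<alpha>)) = x \<alpha>" by simp
    with sc[OF that] show ?thesis by argo
  qed
  have "x \<beta> = (\<Sum>\<alpha>\<in>insert \<beta> F. x \<alpha>) - (\<Sum>\<alpha>\<in>F. x \<alpha>)" using insert.hyps by simp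
  also have "\<dots> \<in> V" 
    by (rule subspace_diff[OF V(1) insert.prems(2) subspace_sum[OF V(1) F]])
  finally show ?case using F insert.prems(3) by auto
qed simp

lemma weight_components_zero:
  assumes T: "Vector_Spaces.linear scale scale T"
    and "finite F" "\<And>\<alpha>. \<alpha> \<in> F \<Longrightarrow> x \<alpha> \<in> weight_space T \<alpha>" "(\<Sum>\<alpha>\<in>F. x \<alpha>) = 0" "\<alpha> \<in> F"
  shows "x \<alpha> = 0"
  using weight_components_mem[OF T, of "{0}" F x \<alpha>] assms linearD(3)[OF T]
  by (auto simp: subspace_def)

text \<open>
  Semisimple derivations, described by a spanning set of eigenvectors instead of a basis.
\<close>

definition diagonal :: "('a \<Rightarrow> 'a) \<Rightarrow> bool" where
  "diagonal T \<longleftrightarrow> derivation scale T \<and> span (\<Union>\<alpha>. weight_space T \<alpha>) = UNIV"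

lemma diagonal_derivation: "diagonal T \<Longrightarrow> derivation scale T"
  and diagonal_linear: "diagonal T \<Longrightarrow> Vector_Spaces.linear scale scale T"
  by (auto simp: diagonal_def derivation_linear)

lemma span_weight_spaces_decomposition:
  assumes T: "Vector_Spaces.linear scale scale T" and "a \<in> span (\<Union>\<alpha>\<in>G. V \<inter> weight_space T \<alpha>)" "subspace V"
  obtains F x where "finite F" "F \<subseteq> G" "\<And>\<alpha>. x \<alpha> \<in> V \<inter> weight_space T \<alpha>" "a = (\<Sum>\<alpha>\<in>F. x \<alpha>)"
proof -
  have "\<exists>F x. finite F \<and> F \<subseteq> G \<and> (\<forall>\<alpha>. x \<alpha> \<in> V \<inter> weight_space T \<alpha>) \<and> a = (\<Sum>\<alpha>\<in>F. x \<alpha>)"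
    using assms(2)
  proof (induction rule: span_induct_alt)
    case base
    show ?case using subspace_weight_space[OF T] assms(3)
      by (intro exI[of _ "{}"] exI[of _ "\<lambda>_. 0"]) (auto simp: subspace_def)
  next
    case (step c b a)
    obtain \<beta> where \<beta>: "\<beta> \<in> G" "b \<in> V" "b \<in> weight_space T \<beta>" using step by blast
    obtain F x where F: "finite F" "F \<subseteq> G" "\<And>\<alpha>. x \<alpha> \<in> V \<inter> weight_space T \<alpha>" "a = (\<Sum>\<alpha>\<in>F. x \<alpha>)"
      using step.IH by blast
    define y where "y \<alpha> = (if \<alpha> = \<beta> then scale c b else 0) + (if \<alpha> \<in> F then x \<alpha> else 0)" for \<alpha>
    have "(\<Sum>\<alpha>\<in>insert \<beta> F. y \<alpha>) = scale c b + a"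
      unfolding y_def F(4) using F(1)
      by (simp add: sum.distrib sum.If_cases Int_absorb1 subset_insertI)
    moreover have "y \<alpha> \<in> V \<inter> weight_space T \<alpha>" for \<alpha>
      unfolding y_def using F(3) \<beta>(2,3) assms(3) subspace_weight_space[OF T]
      by (auto intro: subspace_add subspace_scale simp: subspace_0)
    ultimately show ?case using F(1,2) \<beta>(1)
      by (intro exI[of _ "insert \<beta> F"] exI[of _ y]) auto
  qed
  then show thesis using that by blast
qed

lemma diagonal_decomposition:
  assumes "diagonal T"
  obtains F x where "finite F" "\<And>\<alpha>. x \<alpha> \<in> weight_space T \<alpha>" "a = (\<Sum>\<alpha>\<in>F. x \<alpha>)"
  using span_weight_spaces_decomposition[OF diagonal_linear[OF assms], of a UNIV UNIV]
    assms unfolding diagonal_def by auto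

lemma semisimple_imp_diagonal:
  assumes "semisimple_derivation scale T"
  shows "diagonal T"
proof -
  obtain B where B: "span B = UNIV" "\<forall>b\<in>B. \<exists>c. T b = scale c b"
    using assms unfolding semisimple_derivation_def by blast
  then have "B \<subseteq> (\<Union>\<alpha>. weight_space T \<alpha>)" by (auto simp: weight_space_def)
  then have "span B \<subseteq> span (\<Union>\<alpha>. weight_space T \<alpha>)" by (rule span_mono)
  then show ?thesis using assms B unfolding diagonal_def semisimple_derivation_def by blast
qed

lemma weight_space_mult:
  assumes "derivation scale T" "a \<in> weight_space T \<alpha>" "b \<in> weight_space T \<beta>"
  shows "a * b \<in> weight_space T (\<alpha> + \<beta>)"
  using assms by (simp add: weight_space_def derivationD scale_left_distrib
      flip: scale_mult_left scale_mult_right)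

lemma weight_space_power:
  assumes "derivation scale T" "a \<in> weight_space T \<alpha>"
  shows "a ^ n \<in> weight_space T (of_nat n * \<alpha>)"
proof (induction n)
  case 0
  then show ?case by (simp add: weight_space_def derivationD[OF assms(1)])
next
  case (Suc n)
  then show ?case using weight_space_mult[OF assms(1) assms(2) Suc.IH] by (simp add: algebra_simps)
qed

lemma constant_weight_space: "derivation scale T \<Longrightarrow> scale c 1 \<in> weight_space T 0"
  by (simp add: weight_space_def derivationD)

text \<open>
  Evaluate at T the polynomial whose roots are the weights that occur in a.
\<close>

lemma diagonal_locally_finite:
  assumes T: "diagonal T"
  obtains N c where "(T ^^ N) a = (\<Sum>j<N. scale (c j) ((T ^^ j) a))"
proof -
  note l = diagonal_linear[OF T]
  obtain F x where F: "finite F" "\<And>\<alpha>. x \<alpha> \<in> weight_space T \<alpha>" "a = (\<Sum>\<alpha>\<in>F. x \<alpha>)"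
    using diagonal_decomposition[OF T] by blast
  have pw: "(T ^^ j) (x \<alpha>) = scale (\<alpha> ^ j) (x \<alpha>)" for j \<alpha>
    by (induction j) (use F(2)[of \<alpha>] in \<open>auto simp: linearD[OF l] weight_space_def mult.commute\<close>)
  \<comment> \<open>a monic polynomial that annihilates T on the span of the components of a\<close>
  define q where "q = (\<Prod>\<alpha>\<in>F. [:- \<alpha>, 1:])"
  define N where "N = degree q"
  have lead: "lead_coeff q = 1" unfolding q_def by (simp add: lead_coeff_prod)
  have q0: "poly q \<alpha> = 0" if "\<alpha> \<in> F" for \<alpha>
    using that F(1) unfolding q_def poly_prod by (auto simp: prod_zero_iff)
  have "(\<Sum>j\<le>N. scale (coeff q j) ((T ^^ j) a)) = (\<Sum>j\<le>N. \<Sum>\<alpha>\<in>F. scale (coeff q j * \<alpha> ^ j) (x \<alpha>))"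
    unfolding F(3) by (simp add: linearD(6)[OF linear_funpow[OF l]] pw scale_sum_right)
  also have "\<dots> = (\<Sum>\<alpha>\<in>F. scale (poly q \<alpha>) (x \<alpha>))"
    unfolding poly_altdef N_def by (subst sum.swap) (simp add: scale_sum_left)
  also have "\<dots> = 0" using q0 by simp
  finally have "(\<Sum>j<N. scale (coeff q j) ((T ^^ j) a)) + (T ^^ N) a = 0"
    using lead unfolding N_def by (simp add: lessThan_Suc_atMost[symmetric])
  then have "(T ^^ N) a = (\<Sum>j<N. scale (- coeff q j) ((T ^^ j) a))"
    by (simp add: sum_negf eq_neg_iff_add_eq_0 add.commute)
  then show thesis by (rule that)
qed

section \<open>Homogeneous components of derivations\<close>

text \<open>
  The complex numbers have no canonical order that is compatible with addition. An additive functional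
  that separates the finitely many weights in question singles out an extremal one.
\<close>

lemma exists_generic_functional:
  assumes "finite F"
  obtains \<phi> :: "complex \<Rightarrow> real" where "\<And>x y. \<phi> (x + y) = \<phi> x + \<phi> y" "inj_on \<phi> F"
proof -
  \<comment> \<open>the slopes for which two elements of F have the same value\<close>
  define B where "B = (\<lambda>(x, y). - (Re x - Re y) / (Im x - Im y)) ` (F \<times> F)"
  have "finite B" unfolding B_def using assms by auto
  then obtain \<theta> where \<theta>: "\<theta> \<notin> B" using ex_new_if_finite[OF infinite_UNIV_char_0] by blast
  define \<phi> where "\<phi> x = Re x + \<theta> * Im x" for x
  have "inj_on \<phi> F"
  proof (rule inj_onI)
    fix x y assume xy: "x \<in> F" "y \<in> F" "\<phi> x = \<phi> y"
    then have eq: "\<theta> * (Im x - Im y) = - (Re x - Re y)" unfolding \<phi>_def by (simp add: algebra_simps)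
    have "Im x = Im y"
    proof (rule ccontr)
      assume "Im x \<noteq> Im y"
      then have "\<theta> = - (Re x - Re y) / (Im x - Im y)" using eq by (simp add: field_simps)
      then show False using \<theta> xy unfolding B_def by auto
    qed
    then show "x = y" using eq by (simp add: complex_eq_iff)
  qed
  moreover have "\<phi> (x + y) = \<phi> x + \<phi> y" for x y unfolding \<phi>_def by (simp add: algebra_simps)
  ultimately show thesis using that by blast
qed

text \<open>
  Suppose that, as a map from V to V modulo U, the operator T is the sum of its component of weight r
  and of components that are smaller with respect to the functional \<open>\<phi>\<close>. For a vector a of weight \<open>\<beta>\<close>,
  the part of \<open>(T ^^ n) a\<close> of weight \<open>\<beta> + n r\<close> is \<open>(Tc r ^^ n) a\<close>, and the remaining parts are smaller
  or in U. If \<open>(T ^^ N) a\<close> is a combination of lower iterates, which only reach smaller weights, then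
  its part of largest weight is zero modulo U.
\<close>

lemma extremal_component_nilpotent:
  fixes \<phi> :: "complex \<Rightarrow> real"
  assumes d: "Vector_Spaces.linear scale scale d"
    and V: "subspace V" and U: "subspace U" "U \<subseteq> V" "\<And>u. u \<in> U \<Longrightarrow> d u \<in> U"
    and F: "finite F" "r \<in> F" and T: "\<And>a. T a = (\<Sum>\<alpha>\<in>F. Tc \<alpha> a)"
    and Tc: "\<And>\<alpha>. Vector_Spaces.linear scale scale (Tc \<alpha>)"
      "\<And>\<alpha> a. d (Tc \<alpha> a) = Tc \<alpha> (d a) + scale \<alpha> (Tc \<alpha> a)"
      "\<And>\<alpha> v. \<alpha> \<in> F \<Longrightarrow> v \<in> V \<Longrightarrow> Tc \<alpha> v \<in> V" "\<And>\<alpha> u. \<alpha> \<in> F \<Longrightarrow> u \<in> U \<Longrightarrow> Tc \<alpha> u \<in> U"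
    and \<phi>: "\<And>x y. \<phi> (x + y) = \<phi> x + \<phi> y"
    and r: "\<And>\<alpha>. \<alpha> \<in> F \<Longrightarrow> \<alpha> \<noteq> r \<Longrightarrow> \<phi> \<alpha> < \<phi> r \<or> (\<forall>v\<in>V. Tc \<alpha> v \<in> U)"
    and a: "a \<in> V" "a \<in> weight_space d \<beta>"
    and rec: "(T ^^ N) a = (\<Sum>j<N. scale (c j) ((T ^^ j) a))"
    and pos: "\<phi> r > 0 \<or> (\<forall>j<N. c j = 0)"
  shows "(Tc r ^^ N) a \<in> U"
proof -
  \<comment> \<open>the filtration of V modulo U by the values of the functional\<close>
  define L where "L t = span ((\<Union>\<gamma>\<in>{\<gamma>. \<phi> \<gamma> < t}. V \<inter> weight_space d \<gamma>) \<union> U)" for t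
  have Tc_weight: "Tc \<alpha> v \<in> weight_space d (\<gamma> + \<alpha>)" if "v \<in> weight_space d \<gamma>" for \<alpha> \<gamma> v
    using that Tc(2)[of \<alpha> v] linearD(2)[OF Tc(1)] by (simp add: weight_space_def scale_left_distrib)
  have \<phi>n: "\<phi> (\<beta> + of_nat n * r) = \<phi> \<beta> + of_nat n * \<phi> r" for n
  proof (induction n)
    case (Suc n)
    have "\<phi> (\<beta> + of_nat (Suc n) * r) = \<phi> ((\<beta> + of_nat n * r) + r)" by (simp add: algebra_simps)
    also have "\<dots> = \<phi> (\<beta> + of_nat n * r) + \<phi> r" by (rule \<phi>)
    finally show ?case using Suc by (simp add: algebra_simps)
  qed simp
  have U_L: "u \<in> L t" if "u \<in> U" for u t unfolding L_def using that by (intro span_base) auto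
  have V_L: "v \<in> L t" if "v \<in> V" "v \<in> weight_space d \<gamma>" "\<phi> \<gamma> < t" for v \<gamma> t
    unfolding L_def using that by (intro span_base) auto
  have L_mono: "L t \<subseteq> L t'" if "t \<le> t'" for t t' unfolding L_def using that by (intro span_mono) force
  have subL: "subspace (L t)" for t unfolding L_def by simp
  have T_lin: "Vector_Spaces.linear scale scale T"
    by (rule linearI) (simp_all add: T linearD[OF Tc(1)] sum.distrib scale_sum_right)
  have Tc_L: "Tc \<alpha> y \<in> L (t + \<phi> r)" if y: "y \<in> L t" and \<alpha>: "\<alpha> \<in> F" for y t \<alpha>
    using y[unfolded L_def]
  proof (induction rule: span_induct_alt)
    case base
    then show ?case using linearD(3)[OF Tc(1)] subspace_0[OF subL] by simp
  next
    case (step c x y)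
    have "Tc \<alpha> x \<in> L (t + \<phi> r)"
    proof (cases "x \<in> U")
      case True
      then show ?thesis using Tc(4)[OF \<alpha>] U_L by blast
    next
      case False
      with step(1) obtain \<gamma> where x: "\<phi> \<gamma> < t" "x \<in> V" "x \<in> weight_space d \<gamma>" by blast
      show ?thesis
      proof (cases "\<alpha> = r \<or> \<phi> \<alpha> < \<phi> r")
        case True
        then have "\<phi> (\<gamma> + \<alpha>) < t + \<phi> r" using x \<phi>[of \<gamma> \<alpha>] by auto
        then show ?thesis using V_L[OF Tc(3)[OF \<alpha> x(2)] Tc_weight[OF x(3)]] by simp
      next
        case False
        then show ?thesis using r[OF \<alpha>] x U_L by blast
      qed
    qed
    then show ?case using step by (simp add: linearD[OF Tc(1)] subspace_add subspace_scale subL)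
  qed
  have T_L: "T y \<in> L (t + \<phi> r)" if "y \<in> L t" for y t
    unfolding T using Tc_L[OF that] subL by (intro subspace_sum) auto
  have top: "(Tc r ^^ n) a \<in> V \<and> (Tc r ^^ n) a \<in> weight_space d (\<beta> + of_nat n * r)" for n
  proof (induction n)
    case (Suc n)
    then show ?case using Tc(3)[OF F(2)] Tc_weight[of "(Tc r ^^ n) a" "\<beta> + of_nat n * r" r]
      by (simp add: algebra_simps)
  qed (use a in simp)
  have main: "(T ^^ n) a - (Tc r ^^ n) a \<in> L (\<phi> \<beta> + of_nat n * \<phi> r)" for n
  proof (induction n)
    case (Suc n)
    let ?v = "(Tc r ^^ n) a" and ?t = "\<phi> \<beta> + of_nat n * \<phi> r"
    have "T ((T ^^ n) a - ?v) \<in> L (?t + \<phi> r)" using T_L[OF Suc] .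
    moreover have "T ?v - Tc r ?v \<in> L (?t + \<phi> r)"
    proof -
      have "T ?v - Tc r ?v = (\<Sum>\<alpha>\<in>F - {r}. Tc \<alpha> ?v)"
        unfolding T using F by (simp add: sum.remove)
      also have "\<dots> \<in> L (?t + \<phi> r)"
      proof (intro subspace_sum subL)
        fix \<alpha> assume \<alpha>: "\<alpha> \<in> F - {r}"
        then consider "\<phi> \<alpha> < \<phi> r" | "Tc \<alpha> ?v \<in> U" using r[of \<alpha>] top[of n] by blast
        then show "Tc \<alpha> ?v \<in> L (?t + \<phi> r)"
        proof cases
          case 1
          then have "\<phi> (\<beta> + of_nat n * r + \<alpha>) < ?t + \<phi> r" using \<phi>[of _ \<alpha>] \<phi>n[of n] by simp
          then show ?thesis using V_L[OF Tc(3) Tc_weight] top[of n] \<alpha> by blast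
        qed (rule U_L)
      qed
      finally show ?thesis .
    qed
    ultimately have "T ((T ^^ n) a - ?v) + (T ?v - Tc r ?v) \<in> L (?t + \<phi> r)"
      by (rule subspace_add[OF subL])
    then show ?case by (simp add: linearD[OF T_lin] algebra_simps)
  qed (use subspace_0[OF subL] in simp)
  let ?t = "\<phi> \<beta> + of_nat N * \<phi> r" and ?x = "(Tc r ^^ N) a"
  have "(T ^^ N) a \<in> L ?t"
  proof (cases "\<forall>j<N. c j = 0")
    case True
    then show ?thesis using rec subspace_0[OF subL] by simp
  next
    case False
    with pos have r0: "\<phi> r > 0" by blast
    have "(T ^^ j) a \<in> L ?t" if j: "j < N" for j
    proof -
      have lt: "\<phi> \<beta> + of_nat j * \<phi> r < ?t" using j r0 by simp
      have "(Tc r ^^ j) a \<in> L ?t" using V_L[of _ "\<beta> + of_nat j * r"] top[of j] lt \<phi>n by auto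
      moreover have "(T ^^ j) a - (Tc r ^^ j) a \<in> L ?t" 
        using main[of j] L_mono[OF less_imp_le[OF lt]] by blast
      ultimately show ?thesis using subspace_add[OF subL] by fastforce
    qed
    then show ?thesis unfolding rec by (intro subspace_sum subspace_scale subL) auto
  qed
  then have "(T ^^ N) a - ((T ^^ N) a - ?x) \<in> L ?t" using main[of N] by (rule subspace_diff[OF subL])
  then have "?x \<in> span ((\<Union>\<gamma>\<in>{\<gamma>. \<phi> \<gamma> < ?t}. V \<inter> weight_space d \<gamma>) \<union> U)" unfolding L_def by simp
  then obtain y u where yu: "?x = y + u" "u \<in> span U"
    "y \<in> span (\<Union>\<gamma>\<in>{\<gamma>. \<phi> \<gamma> < ?t}. V \<inter> weight_space d \<gamma>)" unfolding span_Un by blast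
  have u: "u \<in> U" using yu(2) U(1) span_eq_iff[of U] by blast
  obtain G x where G: "finite G" "G \<subseteq> {\<gamma>. \<phi> \<gamma> < ?t}" "\<And>\<gamma>. x \<gamma> \<in> V \<inter> weight_space d \<gamma>" "y = (\<Sum>\<gamma>\<in>G. x \<gamma>)"
    using span_weight_spaces_decomposition[OF d yu(3) V] by blast
  let ?\<gamma> = "\<beta> + of_nat N * r"
  have nG: "?\<gamma> \<notin> G" using G(2) \<phi>n[of N] by auto
  \<comment> \<open>a sum of vectors of distinct weights that is in U, so that its component of largest weight is in U\<close>
  define x' where "x' \<gamma> = (if \<gamma> = ?\<gamma> then ?x else - x \<gamma>)" for \<gamma>
  have "(\<Sum>\<gamma>\<in>insert ?\<gamma> G. x' \<gamma>) = ?x - y"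
  proof -
    have "(\<Sum>\<gamma>\<in>G. x' \<gamma>) = (\<Sum>\<gamma>\<in>G. - x \<gamma>)" unfolding x'_def using nG by (intro sum.cong) auto
    then show ?thesis using G(1) nG by (simp add: x'_def G(4) sum_negf)
  qed
  then have "(\<Sum>\<gamma>\<in>insert ?\<gamma> G. x' \<gamma>) \<in> U" using yu(1) u by simp
  moreover have "x' \<gamma> \<in> weight_space d \<gamma>" for \<gamma>
    unfolding x'_def using top[of N] G(3) subspace_neg[OF subspace_weight_space[OF d]] by auto
  ultimately have "x' ?\<gamma> \<in> U"
    using weight_components_mem[OF d U(1) U(3), of "insert ?\<gamma> G" x' ?\<gamma>] G(1) by blast
  then show ?thesis unfolding x'_def by simp
qed

definition homogeneous :: "('a \<Rightarrow> 'a) \<Rightarrow> complex \<Rightarrow> ('a \<Rightarrow> 'a) \<Rightarrow> bool" where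
  "homogeneous d \<alpha> D \<longleftrightarrow> derivation scale D \<and> (\<forall>a. d (D a) = D (d a) + scale \<alpha> (D a))"

lemma homogeneous_weight_space:
  "homogeneous d \<alpha> D \<Longrightarrow> a \<in> weight_space d \<beta> \<Longrightarrow> D a \<in> weight_space d (\<beta> + \<alpha>)"
  unfolding homogeneous_def weight_space_def by (auto simp: derivationD scale_left_distrib)

lemma homogeneous_scale:
  "derivation scale d \<Longrightarrow> homogeneous d \<alpha> D \<Longrightarrow> homogeneous d \<alpha> (\<lambda>a. scale c (D a))"
  unfolding homogeneous_def
  by (auto simp: derivation_scale derivationD scale_right_distrib mult.commute)

end

context affine_domain begin

text \<open>
  Each of finitely many generators is a combination of finitely many elements of B.
\<close>

lemma generators_in_spanning_set:
  assumes B: "span B = UNIV"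
  shows "\<exists>S. finite S \<and> S \<subseteq> B \<and> (\<forall>R. subalgebra scale R \<longrightarrow> S \<subseteq> R \<longrightarrow> R = UNIV)"
proof -
  obtain S where S: "finite S" "\<And>R. subalgebra scale R \<Longrightarrow> S \<subseteq> R \<Longrightarrow> R = UNIV"
    using finitely_generated unfolding finitely_generated_algebra_def by blast
  have "\<forall>a. \<exists>t. finite t \<and> t \<subseteq> B \<and> a \<in> span t"
  proof
    fix a
    have "a \<in> span B" using B by simp
    then obtain t r where t: "finite t" "t \<subseteq> B" "a = (\<Sum>v\<in>t. scale (r v) v)"
      unfolding span_explicit by blast
    have "(\<Sum>v\<in>t. scale (r v) v) \<in> span t" by (intro span_sum span_scale span_base)
    then show "\<exists>t. finite t \<and> t \<subseteq> B \<and> a \<in> span t" using t by blast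
  qed
  then obtain t where t: "\<And>a. finite (t a)" "\<And>a. t a \<subseteq> B" "\<And>a. a \<in> span (t a)" by metis
  show ?thesis
  proof (intro exI[of _ "\<Union>a\<in>S. t a"] conjI allI impI)
    show "R = UNIV" if R: "subalgebra scale R" "(\<Union>a\<in>S. t a) \<subseteq> R" for R
    proof (rule S(2)[OF R(1)], rule subsetI)
      fix a assume "a \<in> S"
      then have "span (t a) \<subseteq> R" using R subalgebraD(1)[OF R(1)] by (intro span_minimal) auto
      then show "a \<in> R" using t(3) by blast
    qed
  qed (use S(1) t in auto)
qed

text \<open>
  Let \<open>d\<close> have eigenvectors as generators. A derivation D that maps each generator s into the span of
  the vectors whose weight exceeds that of s by an element of F is a sum of components with weights
  in F. For the induction on F replace D by \<open>[d, D] - \<beta> D\<close>, which removes \<open>\<beta>\<close>, and divide its components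
  by \<open>\<alpha> - \<beta>\<close>.
\<close>

lemma derivation_components:
  assumes d: "diagonal d" and D: "derivation scale D"
  shows "\<exists>F Dc. finite F \<and> (\<forall>\<alpha>. homogeneous d \<alpha> (Dc \<alpha>)) \<and> (\<forall>a. D a = (\<Sum>\<alpha>\<in>F. Dc \<alpha> a))
    \<and> (\<forall>\<alpha>. \<alpha> \<notin> F \<longrightarrow> Dc \<alpha> = (\<lambda>a. 0))"
proof -
  note dd = diagonal_derivation[OF d]
  have "span (\<Union>\<alpha>. weight_space d \<alpha>) = UNIV" using d by (simp add: diagonal_def)
  from generators_in_spanning_set[OF this]
  obtain S where S: "finite S" "S \<subseteq> (\<Union>\<alpha>. weight_space d \<alpha>)"
    "\<forall>R. subalgebra scale R \<longrightarrow> S \<subseteq> R \<longrightarrow> R = UNIV" by (elim exE conjE) (rule that)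
  have "\<forall>s\<in>S. \<exists>\<alpha>. s \<in> weight_space d \<alpha>" using S(2) by blast
  then obtain w where w: "\<And>s. s \<in> S \<Longrightarrow> s \<in> weight_space d (w s)" by metis
  have hz: "homogeneous d \<alpha> (\<lambda>a. 0)" for \<alpha>
    by (simp add: homogeneous_def derivation_zero derivationD[OF dd])
  have *: "\<exists>Dc. (\<forall>\<alpha>. homogeneous d \<alpha> (Dc \<alpha>)) \<and> (\<forall>a. D a = (\<Sum>\<alpha>\<in>F. Dc \<alpha> a)) \<and> (\<forall>\<alpha>. \<alpha> \<notin> F \<longrightarrow> Dc \<alpha> = (\<lambda>a. 0))"
    if "finite F" "derivation scale D"
      "\<And>s. s \<in> S \<Longrightarrow> D s \<in> span (\<Union>\<alpha>\<in>F. weight_space d (w s + \<alpha>))" for F D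
    using that
  proof (induction F arbitrary: D rule: finite_induct)
    case empty
    then have "S \<subseteq> {a. D a = 0}" by auto
    then have "{a. D a = 0} = UNIV" using S(3) kernel_subalgebra[OF empty(1)] by blast
    then show ?case using hz by (intro exI[of _ "\<lambda>_ _. 0"]) auto
  next
    case (insert \<beta> F)
    define D' where "D' a = bracket d D a - scale \<beta> (D a)" for a
    have D': "derivation scale D'" unfolding D'_def
      by (intro derivation_diff derivation_bracket derivation_scale dd insert.prems)
    have "D' s \<in> span (\<Union>\<alpha>\<in>F. weight_space d (w s + \<alpha>))" if s: "s \<in> S" for s
    proof -
      have "D' s = d (D s) - scale (w s + \<beta>) (D s)"
        using w[OF s] by (simp add: D'_def bracket_def weight_space_def scale_left_distrib
            derivationD[OF insert.prems(1)])
      moreover have "d y - scale (w s + \<beta>) y \<in> span (\<Union>\<alpha>\<in>F. weight_space d (w s + \<alpha>))"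
        if "y \<in> span (\<Union>\<alpha>\<in>insert \<beta> F. weight_space d (w s + \<alpha>))" for y
        using that
      proof (induction rule: span_induct_alt)
        case base
        show ?case by (simp add: derivationD[OF dd] span_zero)
      next
        case (step c x y)
        then obtain \<alpha> where \<alpha>: "\<alpha> \<in> insert \<beta> F" "x \<in> weight_space d (w s + \<alpha>)" by blast
        then have eq: "d x - scale (w s + \<beta>) x = scale (\<alpha> - \<beta>) x"
          by (simp add: weight_space_def flip: scale_left_diff_distrib)
        have sx: "scale (\<alpha> - \<beta>) x \<in> span (\<Union>\<alpha>\<in>F. weight_space d (w s + \<alpha>))"
          using \<alpha> by (cases "\<alpha> = \<beta>") (auto simp: span_zero intro!: span_scale intro: span_base)
        have "scale c (d x - scale (w s + \<beta>) x) + (d y - scale (w s + \<beta>) y)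
            \<in> span (\<Union>\<alpha>\<in>F. weight_space d (w s + \<alpha>))"
          unfolding eq by (rule span_add[OF span_scale[OF sx] step.IH])
        then show ?case
          by (simp add: derivationD[OF dd] scale_right_distrib scale_right_diff_distrib mult.commute algebra_simps)
      qed
      ultimately show ?thesis using insert.prems(2)[OF s] by simp
    qed
    from insert.IH[OF D' this] obtain E where E: "\<And>\<alpha>. homogeneous d \<alpha> (E \<alpha>)"
      "\<And>a. D' a = (\<Sum>\<alpha>\<in>F. E \<alpha> a)" "\<And>\<alpha>. \<alpha> \<notin> F \<Longrightarrow> E \<alpha> = (\<lambda>a. 0)" by blast
    define Ec where "Ec \<alpha> a = scale (1 / (\<alpha> - \<beta>)) (E \<alpha> a)" for \<alpha> a
    have Ec: "homogeneous d \<alpha> (Ec \<alpha>)" for \<alpha> unfolding Ec_def by (intro homogeneous_scale dd E)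
    define Eb where "Eb a = D a - (\<Sum>\<alpha>\<in>F. Ec \<alpha> a)" for a
    have "homogeneous d \<beta> Eb"
      unfolding homogeneous_def
    proof (intro conjI allI)
      show "derivation scale Eb" unfolding Eb_def
        using Ec by (intro derivation_diff derivation_sum insert.prems) (auto simp: homogeneous_def)
      fix a
      have "d (Ec \<alpha> a) - Ec \<alpha> (d a) - scale \<beta> (Ec \<alpha> a) = E \<alpha> a" if "\<alpha> \<in> F" for \<alpha>
      proof -
        have "d (Ec \<alpha> a) - Ec \<alpha> (d a) - scale \<beta> (Ec \<alpha> a) = scale (\<alpha> - \<beta>) (Ec \<alpha> a)"
          using Ec[of \<alpha>] by (simp add: homogeneous_def scale_left_diff_distrib)
        also have "\<dots> = E \<alpha> a" unfolding Ec_def using that insert.hyps by auto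
        finally show ?thesis .
      qed
      then have "(\<Sum>\<alpha>\<in>F. d (Ec \<alpha> a)) - (\<Sum>\<alpha>\<in>F. Ec \<alpha> (d a)) - scale \<beta> (\<Sum>\<alpha>\<in>F. Ec \<alpha> a) = D' a"
        unfolding E(2) scale_sum_right by (simp flip: sum_subtractf)
      then show "d (Eb a) = Eb (d a) + scale \<beta> (Eb a)"
        by (simp add: Eb_def D'_def bracket_def derivationD[OF dd] scale_right_diff_distrib algebra_simps)
    qed
    moreover have "D a = (\<Sum>\<alpha>\<in>insert \<beta> F. (if \<alpha> = \<beta> then Eb else Ec \<alpha>) a)" for a
    proof -
      have "(\<Sum>\<alpha>\<in>F. (if \<alpha> = \<beta> then Eb else Ec \<alpha>) a) = (\<Sum>\<alpha>\<in>F. Ec \<alpha> a)"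
        using insert.hyps by (intro sum.cong) auto
      then show ?thesis using insert.hyps by (simp add: Eb_def)
    qed
    ultimately show ?case using Ec E(3)
      by (intro exI[of _ "\<lambda>\<alpha>. if \<alpha> = \<beta> then Eb else Ec \<alpha>"]) (auto simp: Ec_def fun_eq_iff)
  qed
  have "\<forall>a. \<exists>F x. finite F \<and> (\<forall>\<alpha>. x \<alpha> \<in> weight_space d \<alpha>) \<and> a = (\<Sum>\<alpha>\<in>F. x \<alpha>)"
    using diagonal_decomposition[OF d] by metis
  then obtain G x where G: "\<And>a. finite (G a)" "\<And>a \<alpha>. x a \<alpha> \<in> weight_space d \<alpha>"
    "\<And>a. a = (\<Sum>\<alpha>\<in>G a. x a \<alpha>)" by metis
  define F where "F = (\<Union>s\<in>S. (\<lambda>\<gamma>. \<gamma> - w s) ` G (D s))"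
  have "D s \<in> span (\<Union>\<alpha>\<in>F. weight_space d (w s + \<alpha>))" if "s \<in> S" for s
  proof -
    have "x (D s) \<gamma> \<in> span (\<Union>\<alpha>\<in>F. weight_space d (w s + \<alpha>))" if "\<gamma> \<in> G (D s)" for \<gamma>
    proof (rule span_base, rule UN_I)
      show "\<gamma> - w s \<in> F" unfolding F_def using that \<open>s \<in> S\<close> by blast
      show "x (D s) \<gamma> \<in> weight_space d (w s + (\<gamma> - w s))" using G(2)[of "D s" \<gamma>] by simp
    qed
    then have "(\<Sum>\<gamma>\<in>G (D s). x (D s) \<gamma>) \<in> span (\<Union>\<alpha>\<in>F. weight_space d (w s + \<alpha>))"
      by (rule span_sum)
    then show ?thesis using G(3)[of "D s"] by simp
  qed
  moreover have "finite F" unfolding F_def using S G by auto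
  ultimately show ?thesis using *[of F D] D by blast
qed

text \<open>
  This is nilpotency of the extremal component with U zero and V everything. A semisimple derivation
  is locally finite, so the conclusion also holds for its extremal component of positive weight.
\<close>

lemma extremal_component_LND:
  fixes \<phi> :: "complex \<Rightarrow> real"
  assumes d: "diagonal d" and T: "\<And>a. T a = (\<Sum>\<alpha>\<in>F. Tc \<alpha> a)"
    and F: "finite F" "r \<in> F" and Tc: "\<And>\<alpha>. homogeneous d \<alpha> (Tc \<alpha>)"
    and \<phi>: "\<And>x y. \<phi> (x + y) = \<phi> x + \<phi> y" and r: "\<And>\<alpha>. \<alpha> \<in> F \<Longrightarrow> \<alpha> \<noteq> r \<Longrightarrow> \<phi> \<alpha> < \<phi> r"
    and "T \<in> LND scale \<or> (diagonal T \<and> \<phi> r > 0)"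
  shows "Tc r \<in> LND scale"
proof (rule LND_iff_nilpotent_on_spanning_set)
  show "derivation scale (Tc r)" using Tc[of r] by (simp add: homogeneous_def)
  show "span (\<Union>\<alpha>. weight_space d \<alpha>) = UNIV" using d by (simp add: diagonal_def)
  fix a assume "a \<in> (\<Union>\<alpha>. weight_space d \<alpha>)"
  then obtain \<beta> where a: "a \<in> weight_space d \<beta>" by blast
  obtain N c where rec: "(T ^^ N) a = (\<Sum>j<N. scale (c j) ((T ^^ j) a))"
    and pos: "\<phi> r > 0 \<or> (\<forall>j<N. c j = (0::complex))"
  proof (cases "T \<in> LND scale")
    case True
    then obtain n where "(T ^^ n) a = 0" using LND_D(2) by blast
    then show ?thesis using that[of n "\<lambda>_. 0"] by simp
  next
    case False
    then show ?thesis using assms(8) diagonal_locally_finite[of T a] that by metis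
  qed
  have "(Tc r ^^ N) a \<in> {0}"
  proof (rule extremal_component_nilpotent[OF diagonal_linear[OF d] subspace_UNIV, where T = T and F = F and \<phi> = \<phi>])
    show "Vector_Spaces.linear scale scale (Tc \<alpha>)" for \<alpha>
      using Tc[of \<alpha>] by (simp add: homogeneous_def derivation_linear)
    show "d (Tc \<alpha> a) = Tc \<alpha> (d a) + scale \<alpha> (Tc \<alpha> a)" for \<alpha> a
      using Tc[of \<alpha>] by (simp add: homogeneous_def)
    show "Tc \<alpha> u \<in> {0}" if "u \<in> {0}" for \<alpha> u
      using Tc[of \<alpha>] that by (simp add: homogeneous_def derivationD)
    show "d u \<in> {0}" if "u \<in> {0}" for u using that derivationD(3)[OF diagonal_derivation[OF d]] by simp
  qed (use F T \<phi> r a rec pos in auto)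
  then show "\<exists>n. (Tc r ^^ n) a = 0" by blast
qed

end

context complex_domain begin

section \<open>Algebraic dependence of weight vectors\<close>

lemma weight_vectors_zero:
  assumes T: "Vector_Spaces.linear scale scale T" and I: "finite I" "inj_on w I"
    and x: "\<And>i. i \<in> I \<Longrightarrow> x i \<in> weight_space T (w i)" "(\<Sum>i\<in>I. x i) = 0" "i \<in> I"
  shows "x i = 0"
proof -
  define g where "g = the_inv_into I w"
  have g: "g (w i) = i" if "i \<in> I" for i unfolding g_def using I(2) that by (rule the_inv_into_f_f)
  have s0: "(\<Sum>\<alpha>\<in>w ` I. x (g \<alpha>)) = 0" using x(2) I(2) g by (simp add: sum.reindex)
  have "x (g (w i)) = 0"
  proof (rule weight_components_zero[OF T, where F = "w ` I"])
    show "x (g \<alpha>) \<in> weight_space T \<alpha>" if "\<alpha> \<in> w ` I" for \<alpha>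
      using that g x(1) by (elim imageE) metis
  qed (use I(1) x(3) s0 in auto)
  then show ?thesis using g x(3) by simp
qed

definition weights_in :: "('a \<Rightarrow> 'a) \<Rightarrow> complex set \<Rightarrow> 'a set" where
  "weights_in T G = span (\<Union>\<gamma>\<in>G. weight_space T \<gamma>)"

lemma weights_in_subalgebra:
  assumes T: "derivation scale T" and G: "0 \<in> G" "\<And>x y. x \<in> G \<Longrightarrow> y \<in> G \<Longrightarrow> x + y \<in> G"
  shows "subalgebra scale (weights_in T G)"
  unfolding subalgebra_def
proof (intro conjI ballI)
  show "subspace (weights_in T G)" by (simp add: weights_in_def)
  show "1 \<in> weights_in T G" unfolding weights_in_def
    using G(1) constant_weight_space[OF T, of 1] by (auto intro!: span_base)
  fix x y assume x: "x \<in> weights_in T G" and y: "y \<in> weights_in T G"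
  show "x * y \<in> weights_in T G" using x[unfolded weights_in_def]
  proof (induction rule: span_induct_alt)
    case (step c a x)
    obtain \<gamma> where \<gamma>: "\<gamma> \<in> G" "a \<in> weight_space T \<gamma>" using step(1) by (elim UN_E)
    note IH = step(2)
    have "a * y \<in> weights_in T G" using y[unfolded weights_in_def]
    proof (induction rule: span_induct_alt)
      case (step c' b y)
      obtain \<gamma>' where \<gamma>': "\<gamma>' \<in> G" "b \<in> weight_space T \<gamma>'" using step(1) by (elim UN_E)
      have "a * b \<in> weights_in T G" unfolding weights_in_def
        using G(2)[OF \<gamma>(1) \<gamma>'(1)] weight_space_mult[OF T \<gamma>(2) \<gamma>'(2)]
        by (intro span_base UN_I)
      then have "scale c' (a * b) + a * y \<in> weights_in T G"
        using step(2) unfolding weights_in_def by (intro span_add span_scale)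
      then show ?case by (simp add: distrib_left scale_mult_right)
    qed (simp add: weights_in_def span_zero)
    then have "scale c (a * y) + x * y \<in> weights_in T G"
      using IH unfolding weights_in_def by (intro span_add span_scale)
    then show ?case by (simp add: distrib_right scale_mult_left)
  qed (simp add: weights_in_def span_zero)
qed

lemma weights_in_base: "\<gamma> \<in> G \<Longrightarrow> a \<in> weight_space T \<gamma> \<Longrightarrow> a \<in> weights_in T G"
  unfolding weights_in_def by (intro span_base) auto

lemma weights_in_decomposition:
  assumes T: "Vector_Spaces.linear scale scale T" and a: "a \<in> weights_in T G"
  shows "\<exists>F x. finite F \<and> F \<subseteq> G \<and> (\<forall>\<alpha>. x \<alpha> \<in> weight_space T \<alpha>) \<and> a = (\<Sum>\<alpha>\<in>F. x \<alpha>)"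
proof -
  have "a \<in> span (\<Union>\<gamma>\<in>G. UNIV \<inter> weight_space T \<gamma>)" using a by (simp add: weights_in_def)
  then show ?thesis
  proof (rule span_weight_spaces_decomposition[OF T])
    fix F x assume "finite F" "F \<subseteq> G" "\<And>\<alpha>. x \<alpha> \<in> UNIV \<inter> weight_space T \<alpha>" "a = (\<Sum>\<alpha>\<in>F. x \<alpha>)"
    then show ?thesis by (intro exI[of _ F] exI[of _ x]) simp
  qed simp
qed

text \<open>
  If no multiple of the weight of y is in G, then the homogeneous terms of the coefficients, multiplied
  by the respective powers of y, have pairwise distinct weights. So each term of a polynomial relation
  vanishes.
\<close>

lemma algebraic_over_weights_in:
  fixes G :: "complex set"
  assumes T: "derivation scale T" and G: "\<And>x y. x \<in> G \<Longrightarrow> y \<in> G \<Longrightarrow> x - y \<in> G"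
    and y: "y \<in> weight_space T \<nu>" "y \<noteq> 0" and alg: "algebraic_over (weights_in T G) y"
  shows "\<exists>k::nat. k > 0 \<and> of_nat k * \<nu> \<in> G"
proof (rule ccontr)
  assume "\<not> ?thesis"
  then have nG: "of_nat k * \<nu> \<notin> G" if "k > 0" for k :: nat using that by blast
  note l = derivation_linear[OF T]
  obtain p where p: "p \<noteq> 0" "\<And>i. coeff p i \<in> weights_in T G" "poly p y = 0"
    using alg unfolding algebraic_over_def by blast
  have "\<exists>F x. finite F \<and> F \<subseteq> G \<and> (\<forall>\<alpha>. x \<alpha> \<in> weight_space T \<alpha>) \<and> coeff p i = (\<Sum>\<alpha>\<in>F. x \<alpha>)" for i
    by (rule weights_in_decomposition[OF l p(2)])
  then obtain F x where F: "\<And>i. finite (F i)" "\<And>i. F i \<subseteq> G" "\<And>i \<alpha>. x i \<alpha> \<in> weight_space T \<alpha>"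
    "\<And>i. coeff p i = (\<Sum>\<alpha>\<in>F i. x i \<alpha>)" by metis
  define I where "I = Sigma {..degree p} F"
  define w where "w = (\<lambda>(i::nat, \<alpha>). \<alpha> + of_nat i * \<nu>)"
  define m where "m = (\<lambda>(i, \<alpha>). x i \<alpha> * y ^ i)"
  have inj: "inj_on w I"
  proof (rule inj_onI)
    have *: "i = j" if "\<alpha> \<in> G" "\<beta> \<in> G" "\<alpha> + of_nat i * \<nu> = \<beta> + of_nat j * \<nu>" "i \<le> j" for \<alpha> \<beta> and i j :: nat
    proof (rule ccontr)
      assume "i \<noteq> j"
      moreover have "of_nat (j - i) * \<nu> = \<alpha> - \<beta>" using that by (simp add: of_nat_diff algebra_simps)
      ultimately show False using nG[of "j - i"] G[OF that(1,2)] that(4) by simp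
    qed
    fix u v assume uv: "u \<in> I" "v \<in> I" "w u = w v"
    obtain i \<alpha> j \<beta> where [simp]: "u = (i, \<alpha>)" "v = (j, \<beta>)" by fastforce
    have "\<alpha> \<in> G" "\<beta> \<in> G" using uv F(2) unfolding I_def by auto
    then have "i = j" using *[of \<alpha> \<beta> i j] *[of \<beta> \<alpha> j i] uv(3) unfolding w_def by (cases "i \<le> j") auto
    then show "u = v" using uv(3) unfolding w_def by auto
  qed
  have "(\<Sum>u\<in>I. m u) = (\<Sum>i\<le>degree p. coeff p i * y ^ i)"
    unfolding I_def m_def F(4) using F(1) by (subst sum.Sigma[symmetric]) (auto simp: sum_distrib_right)
  also have "\<dots> = 0" using p(3) by (simp add: poly_altdef)
  finally have sum0: "(\<Sum>u\<in>I. m u) = 0" .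
  have mw: "m u \<in> weight_space T (w u)" for u
    unfolding m_def w_def using weight_space_mult[OF T F(3) weight_space_power[OF T y(1)]]
    by (simp add: case_prod_unfold)
  have finI: "finite I" unfolding I_def using F(1) by auto
  have "m u = 0" if "u \<in> I" for u
    by (rule weight_vectors_zero[OF l finI inj mw sum0 that])
  then have "x i \<alpha> = 0" if "i \<le> degree p" "\<alpha> \<in> F i" for i \<alpha>
    using y(2) that unfolding I_def m_def by fastforce
  then have "coeff p (degree p) = 0" using F(4)[of "degree p"] by simp
  with p(1) show False by simp
qed

definition complex_poly_values :: "'a \<Rightarrow> 'a set" where
  "complex_poly_values x = range (\<lambda>q. poly (map_poly (\<lambda>c. scale c 1) q) x)"

lemma map_poly_const_hom:
  "map_poly (\<lambda>c. scale c (1::'a)) (q + r) = map_poly (\<lambda>c. scale c 1) q + map_poly (\<lambda>c. scale c 1) r"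
  "map_poly (\<lambda>c. scale c (1::'a)) (q * r) = map_poly (\<lambda>c. scale c 1) q * map_poly (\<lambda>c. scale c 1) r"
  by (intro poly_eqI; simp add: coeff_map_poly scale_left_distrib coeff_mult scale_sum_left scale_mult_scale)+

lemma complex_poly_values_subalgebra: "subalgebra scale (complex_poly_values x)"
  unfolding subalgebra_def
proof (intro conjI ballI)
  have I: "poly (map_poly (\<lambda>c. scale c 1) q) x \<in> complex_poly_values x" for q
    unfolding complex_poly_values_def by blast
  have E: "\<exists>q. u = poly (map_poly (\<lambda>c. scale c 1) q) x" if "u \<in> complex_poly_values x" for u
    using that unfolding complex_poly_values_def by blast
  show "1 \<in> complex_poly_values x" using I[of 1] by simp
  show mult: "u * v \<in> complex_poly_values x" if "u \<in> complex_poly_values x" "v \<in> complex_poly_values x" for u v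
    using E[OF that(1)] E[OF that(2)] I by (metis map_poly_const_hom(2) poly_mult)
  show "subspace (complex_poly_values x)"
  proof (rule subspaceI)
    show "0 \<in> complex_poly_values x" using I[of 0] by simp
    show "u + v \<in> complex_poly_values x" if "u \<in> complex_poly_values x" "v \<in> complex_poly_values x" for u v
      using E[OF that(1)] E[OF that(2)] I by (metis map_poly_const_hom(1) poly_add)
    show "scale c u \<in> complex_poly_values x" if "u \<in> complex_poly_values x" for c u
      using mult[OF I[of "[:c:]"] that] by (simp add: map_poly_pCons scale_eq_const_mult[of c u])
  qed
qed

text \<open>
  A binary form over the complex numbers is a product of linear forms.
\<close>

lemma homogeneous_relation_imp_proportional:
  assumes "x \<noteq> 0" "q \<noteq> 0" "degree q \<le> n" "(\<Sum>j\<le>n. scale (coeff q j) (x ^ (n - j) * y ^ j)) = 0"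
  shows "\<exists>c. y = scale c x"
  using assms(2-)
proof (induction n arbitrary: q)
  case 0
  then obtain c where "q = [:c:]" using degree_eq_zeroE by blast
  with 0 show ?case by simp
next
  case (Suc n)
  show ?case
  proof (cases "degree q = 0")
    case True
    then obtain c where c: "q = [:c:]" using degree_eq_zeroE by blast
    have "(\<Sum>j\<le>Suc n. scale (coeff q j) (x ^ (Suc n - j) * y ^ j)) = scale c (x ^ Suc n)"
      unfolding c by (subst sum.atMost_Suc_shift) simp
    then have "c = 0" using Suc.prems(3) assms(1) by simp
    then show ?thesis using Suc.prems(1) c by simp
  next
    case False
    then obtain c where "poly q c = 0"
      using fundamental_theorem_of_algebra[of q] constant_degree[of q] by auto
    then have "[:- c, 1:] dvd q" using poly_eq_0_iff_dvd[of q c] by blast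
    then obtain r where r: "q = [:- c, 1:] * r" by (rule dvdE)
    have "r \<noteq> 0" using r Suc.prems(1) by auto
    then have "degree q = Suc (degree r)" unfolding r by (subst degree_mult_eq) auto
    then have deg: "degree r \<le> n" using Suc.prems(2) by simp
    define H where "H = (\<Sum>j\<le>n. scale (coeff r j) (x ^ (n - j) * y ^ j))"
    have q: "coeff q j = coeff (pCons 0 r) j - c * coeff r j" for j unfolding r by simp
    have "(\<Sum>j\<le>Suc n. scale (coeff (pCons 0 r) j) (x ^ (Suc n - j) * y ^ j)) = y * H"
      unfolding H_def sum.atMost_Suc_shift
      by (simp add: sum_distrib_left scale_mult_right[symmetric] mult_ac)
    moreover have "(\<Sum>j\<le>Suc n. scale (c * coeff r j) (x ^ (Suc n - j) * y ^ j)) = scale c x * H"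
    proof -
      have "coeff r (Suc n) = 0" using deg by (intro coeff_eq_0) simp
      then have "(\<Sum>j\<le>Suc n. scale (c * coeff r j) (x ^ (Suc n - j) * y ^ j))
          = (\<Sum>j\<le>n. scale (c * coeff r j) (x ^ (Suc n - j) * y ^ j))" by simp
      also have "\<dots> = (\<Sum>j\<le>n. scale c x * scale (coeff r j) (x ^ (n - j) * y ^ j))"
        by (intro sum.cong refl) (simp add: Suc_diff_le scale_mult_scale mult.assoc)
      finally show ?thesis unfolding H_def by (simp add: sum_distrib_left)
    qed
    ultimately have "(y - scale c x) * H = (\<Sum>j\<le>Suc n. scale (coeff q j) (x ^ (Suc n - j) * y ^ j))"
      unfolding q scale_left_diff_distrib sum_subtractf by (simp add: left_diff_distrib)
    then have "(y - scale c x) * H = 0" using Suc.prems(3) by simp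
    then consider "y = scale c x" | "H = 0" by auto
    then show ?thesis
      using Suc.IH[OF \<open>r \<noteq> 0\<close> deg] unfolding H_def by cases auto
  qed
qed

text \<open>
  In a relation between x and y, the monomials with a fixed total degree in x and y form the part of a
  fixed weight, and this part is a binary form that vanishes at x and y.
\<close>

lemma same_weight_proportional:
  assumes T: "derivation scale T" and x: "x \<in> weight_space T \<nu>" "x \<noteq> 0" and y: "y \<in> weight_space T \<nu>"
    and "\<nu> \<noteq> 0" and alg: "algebraic_over (complex_poly_values x) y"
  shows "\<exists>c. y = scale c x"
proof -
  note l = derivation_linear[OF T]
  obtain p where p: "p \<noteq> 0" "\<And>i. coeff p i \<in> complex_poly_values x" "poly p y = 0"
    using alg unfolding algebraic_over_def by blast
  have "\<exists>q. coeff p j = poly (map_poly (\<lambda>c. scale c 1) q) x \<and> (coeff p j = 0 \<longrightarrow> q = 0)" for j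
    using p(2)[of j] unfolding complex_poly_values_def by (cases "coeff p j = 0") auto
  then obtain q where q: "\<And>j. coeff p j = poly (map_poly (\<lambda>c. scale c 1) (q j)) x"
    "\<And>j. coeff p j = 0 \<Longrightarrow> q j = 0" by metis
  define J where "J = degree p"
  define M where "M = Max ((\<lambda>j. degree (q j)) ` {..J})"
  have M: "degree (q j) \<le> M" if "j \<le> J" for j unfolding M_def using that by (intro Max_ge) auto
  define f where "f j n = scale (coeff (q j) n) (x ^ n * y ^ j)" for j n
  have fM: "f j n = 0" if "j \<le> J" "n > M" for j n
    unfolding f_def using M[OF that(1)] that(2) by (simp add: coeff_eq_0)
  have pj: "coeff p j * y ^ j = (\<Sum>n\<le>M. f j n)" if "j \<le> J" for j
  proof -
    have "coeff p j = (\<Sum>n\<le>M. coeff (map_poly (\<lambda>c. scale c 1) (q j)) n * x ^ n)"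
    proof -
      have "degree (map_poly (\<lambda>c. scale c (1::'a)) (q j)) \<le> M"
        using M[OF that] by (intro degree_le) (simp add: coeff_map_poly coeff_eq_0)
      then show ?thesis unfolding q(1)[of j] poly_altdef
        by (intro sum.mono_neutral_left) (auto simp: coeff_eq_0)
    qed
    also have "\<dots> = (\<Sum>n\<le>M. scale (coeff (q j) n) (x ^ n))"
      by (simp add: coeff_map_poly scale_mult_left[symmetric])
    finally show ?thesis unfolding f_def by (simp add: sum_distrib_right scale_mult_left)
  qed
  \<comment> \<open>the part of the relation of total degree N\<close>
  define z where "z N = (\<Sum>j\<le>J. if j \<le> N then f j (N - j) else 0)" for N
  have "(\<Sum>N\<le>J + M. z N) = (\<Sum>j\<le>J. \<Sum>N\<le>J + M. if j \<le> N then f j (N - j) else 0)"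
    unfolding z_def by (rule sum.swap)
  also have "\<dots> = (\<Sum>j\<le>J. \<Sum>n\<le>M. f j n)"
  proof (rule sum.cong[OF refl])
    fix j assume j: "j \<in> {..J}"
    have "(\<Sum>N\<le>J + M. if j \<le> N then f j (N - j) else 0) = (\<Sum>N\<in>{j..J + M}. f j (N - j))"
      by (intro sum.mono_neutral_cong_right) auto
    also have "\<dots> = (\<Sum>n\<in>{..J + M - j}. f j n)"
      using j by (intro sum.reindex_bij_witness[of _ "\<lambda>n. n + j" "\<lambda>N. N - j"]) auto
    also have "\<dots> = (\<Sum>n\<le>M. f j n)"
      using j fM by (intro sum.mono_neutral_right) auto
    finally show "(\<Sum>N\<le>J + M. if j \<le> N then f j (N - j) else 0) = (\<Sum>n\<le>M. f j n)" .
  qed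
  also have "\<dots> = (\<Sum>j\<le>J. coeff p j * y ^ j)" using pj by simp
  also have "\<dots> = 0" using p(3) unfolding J_def by (simp add: poly_altdef)
  finally have sum0: "(\<Sum>N\<le>J + M. z N) = 0" .
  have fw: "f j n \<in> weight_space T (of_nat (n + j) * \<nu>)" for j n
    using weight_space_mult[OF T weight_space_power[OF T x(1), of n] weight_space_power[OF T y, of j]]
      subspace_scale[OF subspace_weight_space[OF l]]
    unfolding f_def by (simp add: algebra_simps)
  have zw: "z N \<in> weight_space T (of_nat N * \<nu>)" for N
    unfolding z_def
  proof (intro subspace_sum[OF subspace_weight_space[OF l]])
    fix j
    show "(if j \<le> N then f j (N - j) else 0) \<in> weight_space T (of_nat N * \<nu>)"
      using fw[of j "N - j"] subspace_0[OF subspace_weight_space[OF l]] by auto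
  qed
  have "inj_on (\<lambda>N::nat. of_nat N * \<nu>) {..J + M}" using \<open>\<nu> \<noteq> 0\<close> by (auto intro: inj_onI)
  then have z0: "z N = 0" if "N \<le> J + M" for N
    using weight_vectors_zero[OF l _ _ zw sum0] that by auto
  have "q J \<noteq> 0" using p(1) q(1)[of J] unfolding J_def by auto
  define N where "N = degree (q J) + J"
  define Q where "Q = (\<Sum>j\<le>J. if j \<le> N then monom (coeff (q j) (N - j)) j else 0)"
  have cQ: "coeff Q j = (if j \<le> J \<and> j \<le> N then coeff (q j) (N - j) else 0)" for j
  proof -
    have "coeff Q j = (\<Sum>i\<le>J. if i = j then (if j \<le> N then coeff (q j) (N - j) else 0) else 0)"
      unfolding Q_def coeff_sum by (intro sum.cong) (auto simp: coeff_monom)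
    then show ?thesis by simp
  qed
  have "J \<le> N" unfolding N_def by simp
  have "coeff Q J \<noteq> 0" unfolding cQ N_def using \<open>q J \<noteq> 0\<close> by simp
  then have "Q \<noteq> 0" by auto
  moreover have "degree Q \<le> N" by (intro degree_le) (auto simp: cQ)
  moreover have "(\<Sum>j\<le>N. scale (coeff Q j) (x ^ (N - j) * y ^ j)) = 0"
  proof -
    have "(\<Sum>j\<le>N. scale (coeff Q j) (x ^ (N - j) * y ^ j)) = (\<Sum>j\<le>J. if j \<le> N then f j (N - j) else 0)"
      unfolding f_def using \<open>J \<le> N\<close> by (intro sum.mono_neutral_cong_right) (auto simp: cQ)
    also have "\<dots> = 0" using z0[of N] M[of J] unfolding z_def N_def by simp
    finally show ?thesis .
  qed
  ultimately show ?thesis by (rule homogeneous_relation_imp_proportional[OF x(2)])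
qed

end

section \<open>Surfaces with nontrivial Makar-Limanov invariant\<close>

locale nontrivial_makar_limanov = affine_surface +
  assumes makar_limanov_nontrivial: "makar_limanov scale \<noteq> range (\<lambda>c. scale c 1)"
begin

definition K :: "'a set" where "K = makar_limanov scale"

lemma K_iff: "a \<in> K \<longleftrightarrow> (\<forall>D\<in>LND scale. D a = 0)"
  by (simp add: K_def makar_limanov_def)

lemma LND_K: "D \<in> LND scale \<Longrightarrow> k \<in> K \<Longrightarrow> D k = 0"
  by (simp add: K_iff)

lemma K_subalgebra: "subalgebra scale K"
proof -
  have K: "K = \<Inter>((\<lambda>D. {a. D a = 0}) ` LND scale)" unfolding K_iff set_eq_iff by simp
  have *: "subalgebra scale {a. D a = 0}" if "D \<in> LND scale" for D
    using kernel_subalgebra[OF LND_D(1)[OF that]] .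
  show ?thesis unfolding K subalgebra_def
    using * unfolding subalgebra_def by (intro conjI subspace_Inter) blast+
qed

lemma K_nonconstant: "\<exists>x\<in>K. x \<notin> range (\<lambda>c. scale c 1)"
  using makar_limanov_nontrivial subalgebraD(4)[OF K_subalgebra] unfolding K_def by blast

lemma LND_eq_0_if_algebraic_over_K:
  assumes "D \<in> LND scale" "algebraic_over K a"
  shows "D a = 0"
  by (rule derivation_eq_0_if_algebraic[where R = K])
    (use assms LND_D(1) LND_K in auto)

text \<open>
  The invariant has transcendence degree at least one and the kernel at most one, hence the kernel is
  algebraic over the invariant, and every locally nilpotent derivation kills it.
\<close>

lemma kernel_LND:
  assumes D: "D \<in> LND scale" "D b \<noteq> 0" and a: "D a = 0"
  shows "a \<in> K"
proof -
  note R2 = kernel_subalgebra[OF LND_D(1)[OF D(1)]]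
  have KD: "K \<subseteq> {a. D a = 0}" using LND_K[OF D(1)] by blast
  obtain x where x: "x \<in> K" "x \<notin> range (\<lambda>c. scale c 1)" using K_nonconstant by blast
  have "algebraic_over K a"
  proof (rule ccontr)
    assume na: "\<not> algebraic_over K a"
    have "algebraic_over {a. D a = 0} b"
      by (rule algebraic_over_third[OF K_subalgebra R2 KD x _ na]) (simp add: a)
    then have "D b = 0" by (rule derivation_eq_0_if_algebraic[OF LND_D(1)[OF D(1)], rotated]) simp
    then show False using D(2) by simp
  qed
  then have "E a = 0" if "E \<in> LND scale" for E
    by (rule LND_eq_0_if_algebraic_over_K[OF that])
  then show ?thesis unfolding K_iff by blast
qed

lemma algebraic_over_in_K:
  assumes D: "D \<in> LND scale" "D b \<noteq> 0" and R: "subalgebra scale R" "R \<subseteq> K"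
    and x: "x \<in> R" "x \<notin> range (\<lambda>c. scale c 1)" and y: "y \<in> K"
  shows "algebraic_over R y"
proof (rule ccontr)
  assume "\<not> algebraic_over R y"
  then have "algebraic_over K b" by (rule algebraic_over_third[OF R(1) K_subalgebra R(2) x y])
  then have "D b = 0" by (rule LND_eq_0_if_algebraic_over_K[OF D(1)])
  then show False using D(2) by simp
qed

text \<open>
  The element s is transcendental over K, hence the algebra is algebraic over the kernel of W.
\<close>

lemma derivation_eq_0_if_kills_K:
  assumes D: "D \<in> LND scale" "D s \<noteq> 0"
    and W: "derivation scale W" "\<And>k. k \<in> K \<Longrightarrow> W k = 0" "W s = 0"
  shows "W a = 0"
proof -
  obtain x where x: "x \<in> K" "x \<notin> range (\<lambda>c. scale c 1)" using K_nonconstant by blast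
  have ns: "\<not> algebraic_over K s"
  proof
    assume "algebraic_over K s"
    then have "D s = 0" by (rule LND_eq_0_if_algebraic_over_K[OF D(1)])
    then show False using D(2) by simp
  qed
  have "K \<subseteq> {a. W a = 0}" using W(2) by blast
  then have "algebraic_over {a. W a = 0} a"
    by (rule algebraic_over_third[OF K_subalgebra kernel_subalgebra[OF W(1)] _ x _ ns])
      (simp add: W(3))
  then show ?thesis by (rule derivation_eq_0_if_algebraic[OF W(1), rotated]) simp
qed

lemma slice_derivative_K:
  assumes "D \<in> LND scale" "D s \<noteq> 0" "D (D s) = 0"
  shows "D s \<in> K"
  using kernel_LND[OF assms] .

lemma derivation_proportional:
  assumes D: "D \<in> LND scale" "D s \<noteq> 0" "D (D s) = 0"
    and E: "derivation scale E" "\<And>k. k \<in> K \<Longrightarrow> E k = 0" "E s \<in> K"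
  shows "D s * E a = E s * D a"
proof -
  have "derivation scale (\<lambda>a. D s * E a - E s * D a)"
    by (intro derivation_diff derivation_mult E LND_D(1)[OF D(1)])
  then have "D s * E a - E s * D a = 0"
    by (rule derivation_eq_0_if_kills_K[OF D(1,2)]) (auto simp: E LND_K[OF D(1)] mult.commute)
  then show ?thesis by simp
qed

text \<open>
  Put \<open>t = D s\<close> and \<open>r = E s\<close>. The derivations \<open>t E\<close> and \<open>r D\<close> agree on K and at s, so they are equal. If E
  is locally nilpotent, then so is \<open>t E\<close>, and it maps r to the multiple \<open>r * D r\<close> of r. Therefore
  \<open>r * D r\<close> is zero and r is in K. Conversely, \<open>r D\<close> is locally nilpotent for r in K, hence so is E.
\<close>

lemma LND_iff_slice:
  assumes D: "D \<in> LND scale" "D s \<noteq> 0" "D (D s) = 0"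
  shows "E \<in> LND scale \<longleftrightarrow> derivation scale E \<and> (\<forall>k\<in>K. E k = 0) \<and> E s \<in> K"
proof
  assume E: "E \<in> LND scale"
  define t r where "t = D s" and "r = E s"
  note tK = slice_derivative_K[OF D, folded t_def]
  have W: "derivation scale (\<lambda>a. t * E a - r * D a)"
    by (intro derivation_diff derivation_mult LND_D(1)[OF E] LND_D(1)[OF D(1)])
  have "t * E a - r * D a = 0" for a
    by (rule derivation_eq_0_if_kills_K[OF D(1,2) W])
      (auto simp: LND_K[OF E] LND_K[OF D(1)] t_def r_def mult.commute)
  then have eq: "t * E a = r * D a" for a by simp
  have "(\<lambda>a. t * E a) \<in> LND scale" using LND_mult_kernel[OF E LND_K[OF E tK]] .
  then have "t * E r = 0" by (rule LND_eq_0_if_dvd) (rule eq)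
  then have "D r = 0" using eq[of r] derivationD(3)[OF LND_D(1)[OF D(1)]] by (cases "r = 0") auto
  then have "r \<in> K" by (rule kernel_LND[OF D(1,2)])
  then show "derivation scale E \<and> (\<forall>k\<in>K. E k = 0) \<and> E s \<in> K"
    using LND_D(1)[OF E] LND_K[OF E] unfolding r_def by blast
next
  assume E: "derivation scale E \<and> (\<forall>k\<in>K. E k = 0) \<and> E s \<in> K"
  note tK = slice_derivative_K[OF D]
  have "(\<lambda>a. D s * E a) = (\<lambda>a. E s * D a)"
    using derivation_proportional[OF D] E by blast
  moreover have "(\<lambda>a. E s * D a) \<in> LND scale"
    using LND_mult_kernel[OF D(1)] LND_K[OF D(1)] E by blast
  ultimately have "(\<lambda>a. D s * E a) \<in> LND scale" by simp
  then show "E \<in> LND scale" using LND_if_LND_mult[of E "D s"] E tK D(2) by blast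
qed

lemma LND_cases:
  obtains "\<And>D. D \<in> LND scale \<Longrightarrow> D = (\<lambda>a. 0)"
  | D s where "D \<in> LND scale" "D s \<noteq> 0" "D (D s) = 0"
proof (cases "\<forall>D\<in>LND scale. D = (\<lambda>a. 0)")
  case False
  then obtain D b where D: "D \<in> LND scale" "D b \<noteq> 0" by (auto simp: fun_eq_iff)
  then show ?thesis using LND_local_slice[OF D] that(2) by blast
qed (use that(1) in blast)

lemma LND_add:
  assumes "D \<in> LND scale" "E \<in> LND scale"
  shows "(\<lambda>a. D a + E a) \<in> LND scale"
proof (cases rule: LND_cases)
  case 1
  have "D = (\<lambda>a. 0)" "E = (\<lambda>a. 0)" by (rule 1; fact)+
  then show ?thesis using zero_LND by simp
next
  case (2 D0 s)
  note iff = LND_iff_slice[OF 2]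
  show ?thesis using assms unfolding iff
    by (auto intro: derivation_add subalgebraD(6)[OF K_subalgebra])
qed

lemma LND_scale:
  assumes "D \<in> LND scale"
  shows "(\<lambda>a. scale c (D a)) \<in> LND scale"
  using LND_mult_kernel[OF assms, of "scale c 1"] derivationD(9)[OF LND_D(1)[OF assms], of c]
  by (simp add: scale_eq_const_mult[of c "D _"])

lemma LND_diff:
  assumes "D \<in> LND scale" "E \<in> LND scale"
  shows "(\<lambda>a. D a - E a) \<in> LND scale"
  using LND_add[OF assms(1) LND_scale[OF assms(2), of "-1"]] by simp

lemma LND_sum:
  "(\<And>i. i \<in> S \<Longrightarrow> f i \<in> LND scale) \<Longrightarrow> (\<lambda>a. \<Sum>i\<in>S. f i a) \<in> LND scale"
  by (induction S rule: infinite_finite_induct) (auto intro: LND_add zero_LND)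

lemma LND_commute:
  assumes D: "D \<in> LND scale" and E: "E \<in> LND scale"
  shows "D (E a) = E (D a)"
proof (cases rule: LND_cases)
  case 1
  have "D = (\<lambda>a. 0)" "E = (\<lambda>a. 0)" by (rule 1; fact)+
  then show ?thesis by simp
next
  case (2 D0 s)
  have "D s \<in> K" "E s \<in> K" using LND_iff_slice[OF 2] D E by blast+
  then have "bracket D E s = 0" by (simp add: bracket_def LND_K D E)
  moreover have "bracket D E k = 0" if "k \<in> K" for k
    using LND_K[OF D that] LND_K[OF E that] derivationD(3)[OF LND_D(1)[OF D]]
      derivationD(3)[OF LND_D(1)[OF E]] by (simp add: bracket_def)
  ultimately have "bracket D E a = 0"
    using derivation_eq_0_if_kills_K[OF 2(1,2) derivation_bracket[OF LND_D(1)[OF D] LND_D(1)[OF E]]] by blast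
  then show ?thesis by (simp add: bracket_def)
qed

text \<open>
  Split off the component that is extremal for a generic functional; the rest is again locally
  nilpotent, since the locally nilpotent derivations form a vector space.
\<close>

lemma LND_components:
  assumes d: "diagonal d" and Dc: "\<And>\<alpha>. homogeneous d \<alpha> (Dc \<alpha>)"
  shows "finite F \<Longrightarrow> (\<lambda>a. \<Sum>\<alpha>\<in>F. Dc \<alpha> a) \<in> LND scale \<Longrightarrow> \<alpha> \<in> F \<Longrightarrow> Dc \<alpha> \<in> LND scale"
proof (induction F rule: finite_psubset_induct)
  case (psubset F)
  obtain \<phi> :: "complex \<Rightarrow> real" where \<phi>: "\<And>x y. \<phi> (x + y) = \<phi> x + \<phi> y" "inj_on \<phi> F"
    using exists_generic_functional[OF psubset.hyps] by blast
  have "F \<noteq> {}" using psubset.prems by auto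
  then have "Max (\<phi> ` F) \<in> \<phi> ` F" using psubset.hyps by simp
  then obtain r where r: "r \<in> F" "\<phi> r = Max (\<phi> ` F)" by auto
  have lt: "\<phi> \<beta> < \<phi> r" if "\<beta> \<in> F" "\<beta> \<noteq> r" for \<beta>
  proof -
    have "\<phi> \<beta> \<le> \<phi> r" unfolding r(2) using that psubset.hyps by simp
    moreover have "\<phi> \<beta> \<noteq> \<phi> r" using \<phi>(2) that r(1) by (auto dest: inj_onD)
    ultimately show ?thesis by simp
  qed
  have rL: "Dc r \<in> LND scale"
    by (rule extremal_component_LND[OF d, where \<phi> = \<phi> and F = F and T = "\<lambda>a. \<Sum>\<alpha>\<in>F. Dc \<alpha> a"])
      (use psubset r(1) Dc \<phi> lt in auto)
  have "(\<lambda>a. (\<Sum>\<alpha>\<in>F. Dc \<alpha> a) - Dc r a) = (\<lambda>a. \<Sum>\<alpha>\<in>F - {r}. Dc \<alpha> a)"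
    using psubset.hyps r(1) by (simp add: sum.remove)
  then have "(\<lambda>a. \<Sum>\<alpha>\<in>F - {r}. Dc \<alpha> a) \<in> LND scale"
    using LND_diff[OF psubset.prems(1) rL] by simp
  then have "\<alpha> \<noteq> r \<Longrightarrow> Dc \<alpha> \<in> LND scale"
    using psubset.IH[of "F - {r}"] r(1) psubset.prems(2) by blast
  then show ?case using rL by blast
qed

lemma LND_decomposition:
  assumes d: "diagonal d" and D: "D \<in> LND scale"
  shows "\<exists>F Dc. finite F \<and> (\<forall>\<alpha>. homogeneous d \<alpha> (Dc \<alpha>)) \<and> (\<forall>a. D a = (\<Sum>\<alpha>\<in>F. Dc \<alpha> a))
    \<and> (\<forall>\<alpha>. Dc \<alpha> \<in> LND scale)"
proof -
  obtain F Dc where F': "finite F" "\<forall>\<alpha>. homogeneous d \<alpha> (Dc \<alpha>)" "\<forall>a. D a = (\<Sum>\<alpha>\<in>F. Dc \<alpha> a)"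
    "\<forall>\<alpha>. \<alpha> \<notin> F \<longrightarrow> Dc \<alpha> = (\<lambda>a. 0)"
    using derivation_components[OF d LND_D(1)[OF D]] by (elim exE conjE) (rule that)
  note F = F'[rule_format]
  have "D = (\<lambda>a. \<Sum>\<alpha>\<in>F. Dc \<alpha> a)" by (rule ext) (rule F(3))
  then have D': "(\<lambda>a. \<Sum>\<alpha>\<in>F. Dc \<alpha> a) \<in> LND scale" using D by simp
  have "Dc \<alpha> \<in> LND scale" for \<alpha>
  proof (cases "\<alpha> \<in> F")
    case True
    show ?thesis by (rule LND_components[OF d F(2) F(1) D' True])
  next
    case False
    then show ?thesis using F(4) zero_LND by simp
  qed
  then show ?thesis using F'(1-3) by (intro exI[of _ F] exI[of _ Dc] conjI allI) simp_all
qed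

lemma homogeneous_LND_exists:
  assumes d: "diagonal d" and D: "D \<in> LND scale" "D b \<noteq> 0"
  obtains \<alpha> E c where "E \<in> LND scale" "homogeneous d \<alpha> E" "E c \<noteq> 0"
proof -
  obtain F Dc where F': "finite F" "\<forall>\<alpha>. homogeneous d \<alpha> (Dc \<alpha>)" "\<forall>a. D a = (\<Sum>\<alpha>\<in>F. Dc \<alpha> a)"
    "\<forall>\<alpha>. Dc \<alpha> \<in> LND scale" using LND_decomposition[OF d D(1)] by (elim exE conjE) (rule that)
  note F = F'[rule_format]
  have "\<exists>\<alpha>\<in>F. Dc \<alpha> b \<noteq> 0" using D(2) F(3)[of b] by (metis sum.neutral)
  then show thesis using that F(2,4) by blast
qed

text \<open>
  K is the kernel of a nonzero homogeneous locally nilpotent derivation.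
\<close>

lemma diagonal_K:
  assumes d: "diagonal d" and k: "k \<in> K"
  shows "d k \<in> K"
proof (cases rule: LND_cases)
  case 1
  then show ?thesis unfolding K_iff by (intro ballI) (rule fun_cong)
next
  case (2 D s)
  obtain \<alpha> E c where E: "E \<in> LND scale" "homogeneous d \<alpha> E" "E c \<noteq> 0"
    using homogeneous_LND_exists[OF d 2(1,2)] by blast
  have "d (E k) = E (d k) + scale \<alpha> (E k)" using E(2) by (simp add: homogeneous_def)
  then have "E (d k) = 0" using LND_K[OF E(1) k] derivationD(3)[OF diagonal_derivation[OF d]] by simp
  then show ?thesis by (rule kernel_LND[OF E(1,3)])
qed

lemma bracket_diagonal_LND:
  assumes d: "diagonal d" and D: "D \<in> LND scale"
  shows "bracket d D \<in> LND scale"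
proof -
  obtain F Dc where F': "finite F" "\<forall>\<alpha>. homogeneous d \<alpha> (Dc \<alpha>)" "\<forall>a. D a = (\<Sum>\<alpha>\<in>F. Dc \<alpha> a)"
    "\<forall>\<alpha>. Dc \<alpha> \<in> LND scale" using LND_decomposition[OF d D] by (elim exE conjE) (rule that)
  note F = F'[rule_format]
  have "bracket d D a = (\<Sum>\<alpha>\<in>F. scale \<alpha> (Dc \<alpha> a))" for a
  proof -
    have "d (Dc \<alpha> a) = Dc \<alpha> (d a) + scale \<alpha> (Dc \<alpha> a)" for \<alpha>
      using F(2)[of \<alpha>] unfolding homogeneous_def by blast
    then show ?thesis unfolding bracket_def F(3)
      by (simp only: derivationD(6)[OF diagonal_derivation[OF d]] sum.distrib add_diff_cancel_left')
  qed
  then have "bracket d D = (\<lambda>a. \<Sum>\<alpha>\<in>F. scale \<alpha> (Dc \<alpha> a))" by (rule ext)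
  then show ?thesis using LND_sum[of F "\<lambda>\<alpha> a. scale \<alpha> (Dc \<alpha> a)", OF LND_scale[OF F(4)]] by (simp only:)
qed

end

section \<open>Algebras of saturated monoids in the plane\<close>

definition zscale :: "int \<Rightarrow> int \<times> int \<Rightarrow> int \<times> int" where
  "zscale k m = (k * fst m, k * snd m)"

definition det2 :: "int \<times> int \<Rightarrow> int \<times> int \<Rightarrow> int" where
  "det2 a b = fst a * snd b - snd a * fst b"

lemma zscale_simps [simp]:
  "zscale 0 m = 0" "zscale 1 m = m" "zscale k 0 = 0" "zscale k (zscale l m) = zscale (k * l) m"
  "fst (zscale k m) = k * fst m" "snd (zscale k m) = k * snd m"
  by (simp_all add: zscale_def prod_eq_iff)

lemma zscale_add: "zscale k (m + m') = zscale k m + zscale k m'"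
  and zscale_add_left: "zscale (k + l) m = zscale k m + zscale l m"
  by (simp_all add: zscale_def prod_eq_iff algebra_simps)

lemma det2_add: "det2 a (b + c) = det2 a b + det2 a c"
  and det2_zscale: "det2 a (zscale k b) = k * det2 a b" "det2 (zscale k a) b = k * det2 a b"
  and det2_swap: "det2 a b = - det2 b a"
  by (simp_all add: det2_def algebra_simps)

text \<open>
  The form p defines a facet of the cone generated by S, and v spans the facet. The last condition
  says that p is primitive.
\<close>

definition facet :: "(int \<times> int) set \<Rightarrow> (int \<times> int \<Rightarrow> int) \<Rightarrow> int \<times> int \<Rightarrow> bool" where
  "facet S p v \<longleftrightarrow> v \<in> S \<and> v \<noteq> 0 \<and> (\<forall>m m'. p (m + m') = p m + p m') \<and> (\<forall>m. p m = 0 \<longleftrightarrow> (\<exists>c. m = zscale c v))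
     \<and> (\<forall>m\<in>S. p m \<ge> 0) \<and> (\<exists>b. p b = 1)"

text \<open>
  The last condition says, in the form of an induction rule, that the finite set \<open>Gs\<close> generates S.
\<close>

locale saturated_monoid =
  fixes S :: "(int \<times> int) set" and Gs :: "(int \<times> int) set"
  assumes zero: "0 \<in> S" and plus: "m \<in> S \<Longrightarrow> m' \<in> S \<Longrightarrow> m + m' \<in> S"
    and saturated: "k > 0 \<Longrightarrow> zscale k m \<in> S \<Longrightarrow> m \<in> S"
    and full: "\<exists>s\<in>S. \<exists>s'\<in>S. m = s - s'"
    and generators: "finite Gs" "Gs \<subseteq> S"
      "P 0 \<Longrightarrow> (\<And>m m'. P m \<Longrightarrow> P m' \<Longrightarrow> P (m + m')) \<Longrightarrow> (\<And>g. g \<in> Gs \<Longrightarrow> P g) \<Longrightarrow> m \<in> S \<Longrightarrow> P m"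
begin

lemma zscale_mem: "k \<ge> 0 \<Longrightarrow> m \<in> S \<Longrightarrow> zscale k m \<in> S"
proof (induction k rule: int_ge_induct)
  case (step k)
  then show ?case using plus by (simp add: zscale_add_left)
qed (simp add: zero)

lemma eq_0_if_additive:
  assumes "\<And>m m'. (p::_ \<Rightarrow> int) (m + m') = p m + p m'" "\<And>g. g \<in> Gs \<Longrightarrow> p g = 0"
  shows "p m = 0"
proof -
  have p0: "p 0 = 0" using assms(1)[of 0 0] by simp
  have *: "p s = 0" if "s \<in> S" for s
    by (rule generators(3)[of "\<lambda>s. p s = 0"]) (use assms p0 that in auto)
  obtain s s' where s: "s \<in> S" "s' \<in> S" "m = s - s'" using full by blast
  have "p (s - s' + s') = p (s - s') + p s'" by (rule assms(1))
  then show ?thesis using * s by simp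
qed

lemma facet_additive:
  assumes "facet S p v"
  shows "p (m + m') = p m + p m'" "p 0 = 0" "p (m - m') = p m - p m'" "p (zscale k m) = k * p m"
proof -
  show add: "p (m + m') = p m + p m'" for m m' using assms unfolding facet_def by blast
  show "p 0 = 0" using add[of 0 0] by simp
  show diff: "p (m - m') = p m - p m'" for m m' using add[of "m - m'" m'] by simp
  have nn: "p (zscale k m) = k * p m" if "k \<ge> 0" for k
    using that by (induction k rule: int_ge_induct) (use \<open>p 0 = 0\<close> in \<open>auto simp: add zscale_add_left algebra_simps\<close>)
  show "p (zscale k m) = k * p m"
  proof (cases "k \<ge> 0")
    case False
    have "zscale k m = 0 - zscale (- k) m" by (simp add: prod_eq_iff)
    then have "p (zscale k m) = p 0 - p (zscale (- k) m)" by (simp only: diff)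
    then show ?thesis using nn[of "- k"] False \<open>p 0 = 0\<close> by simp
  qed (rule nn)
qed

text \<open>
  Among the generators on one side of the line through w, choose the one, v, that makes the smallest
  angle with w. No generator g lies on the same side as w of the line through v: on the side of v with
  respect to w this is the choice of v, and on the other side w would be in the cone spanned by v and
  g, hence in S by saturation.
\<close>

lemma facet_separating:
  assumes w: "w \<notin> S"
  obtains p v where "facet S p v" "p w < 0"
proof -
  have "w \<noteq> 0" using w zero by blast
  have "\<exists>g\<in>Gs. det2 w g \<noteq> 0"
  proof (rule ccontr)
    assume "\<not> ?thesis"
    then have "det2 w m = 0" for m using eq_0_if_additive[of "det2 w" m] det2_add by blast
    from this[of "(1, 0)"] this[of "(0, 1)"] show False using \<open>w \<noteq> 0\<close> by (simp add: det2_def prod_eq_iff)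
  qed
  then obtain g0 where g0: "g0 \<in> Gs" "det2 w g0 \<noteq> 0" by blast
  \<comment> \<open>the sign chooses the side of the line through w on which v is sought\<close>
  define \<epsilon> where "\<epsilon> = sgn (det2 w g0)"
  define D where "D a b = \<epsilon> * det2 a b" for a b
  define I where "I a b = fst a * fst b + snd a * snd b" for a b :: "int \<times> int"
  define L where "L = {g\<in>Gs. D w g > 0}"
  have "g0 \<in> L" unfolding L_def D_def \<epsilon>_def using g0 by (simp add: sgn_if)
  then have "L \<noteq> {}" by blast
  have "finite L" unfolding L_def using generators(1) by simp
  \<comment> \<open>the cotangent of the angle between w and g\<close>
  define f :: "int \<times> int \<Rightarrow> real" where "f g = of_int (I w g) / of_int (D w g)" for g
  have "Max (f ` L) \<in> f ` L" using \<open>finite L\<close> \<open>L \<noteq> {}\<close> by simp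
  then obtain v where v: "v \<in> L" "f v = Max (f ` L)" by auto
  have vD: "D w v > 0" "v \<in> Gs" using v(1) unfolding L_def by auto
  have vS: "v \<in> S" using vD generators(2) by blast
  have nonneg_gen: "D v g \<ge> 0" if g: "g \<in> Gs" for g
  proof (cases "D w g > 0")
    case True
    then have "f g \<le> f v" unfolding v(2) using \<open>finite L\<close> g by (intro Max_ge) (auto simp: L_def)
    then have "real_of_int (I w g) * real_of_int (D w v) \<le> real_of_int (I w v) * real_of_int (D w g)"
      unfolding f_def using True vD by (simp add: field_simps)
    then have "I w g * D w v \<le> I w v * D w g" by (metis of_int_le_iff of_int_mult)
    moreover have "D v g * I w w = I w v * D w g - D w v * I w g"
      unfolding D_def I_def det2_def by (simp add: algebra_simps)
    ultimately have "D v g * I w w \<ge> 0" by (simp add: mult.commute)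
    moreover have "I w w > 0" unfolding I_def using \<open>w \<noteq> 0\<close>
      by (auto simp: prod_eq_iff sum_squares_gt_zero_iff)
    ultimately show ?thesis by (simp add: zero_le_mult_iff)
  next
    case False
    show ?thesis
    proof (rule ccontr)
      assume "\<not> ?thesis"
      then have neg: "D v g < 0" by simp
      have "zscale (- D v g) w = zscale (- D w g) v + zscale (D w v) g"
        unfolding D_def det2_def by (simp add: prod_eq_iff algebra_simps)
      also have "\<dots> \<in> S" using False vD vS g generators(2) by (intro plus zscale_mem) auto
      finally show False using saturated[of "- D v g" w] neg w by simp
    qed
  qed
  have D_add: "D a (b + c) = D a b + D a c" for a b c unfolding D_def by (simp add: det2_add algebra_simps)
  have D0: "D a 0 = 0" for a unfolding D_def by (simp add: det2_def)
  have nonneg: "D v m \<ge> 0" if "m \<in> S" for m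
    by (rule generators(3)[of "\<lambda>m. D v m \<ge> 0"]) (use nonneg_gen that D_add D0 in auto)
  define h where "h = gcd (fst v) (snd v)"
  have "v \<noteq> 0" using vD by (auto simp: D_def det2_def)
  then have h: "h > 0" unfolding h_def by (auto simp: prod_eq_iff gcd_pos_int)
  define u where "u = (fst v div h, snd v div h)"
  have vu: "v = zscale h u" unfolding u_def h_def by (simp add: prod_eq_iff)
  have cop: "coprime (fst u) (snd u)" unfolding u_def h_def fst_conv snd_conv
    using h by (intro div_gcd_coprime) (auto simp: h_def)
  define p where "p = D u"
  have Dv: "D v m = h * p m" for m unfolding p_def D_def vu by (simp add: det2_zscale)
  have \<epsilon>: "\<epsilon> = 1 \<or> \<epsilon> = -1" unfolding \<epsilon>_def using g0 by (auto simp: sgn_if)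
  have "facet S p u"
    unfolding facet_def
  proof (intro conjI allI ballI)
    show "u \<in> S" using saturated[OF h] vS vu by simp
    show "u \<noteq> 0" using \<open>v \<noteq> 0\<close> vu by auto
    show "p (m + m') = p m + p m'" for m m' unfolding p_def by (rule D_add)
    show "p m \<ge> 0" if "m \<in> S" for m using nonneg[OF that] Dv[of m] h by (simp add: zero_le_mult_iff)
    show "p m = 0 \<longleftrightarrow> (\<exists>c. m = zscale c u)" for m
    proof
      assume "p m = 0"
      then have eq: "fst u * snd m = snd u * fst m" unfolding p_def D_def det2_def using \<epsilon> by auto
      have "fst u dvd fst m"
      proof -
        have "fst u dvd snd u * fst m" using eq by (metis dvd_triv_left)
        then show ?thesis using cop coprime_dvd_mult_right_iff by blast
      qed
      have "snd u dvd snd m"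
      proof -
        have "snd u dvd fst u * snd m" using eq by (metis dvd_triv_left)
        then show ?thesis using cop coprime_dvd_mult_right_iff coprime_commute by blast
      qed
      obtain c where c: "fst m = fst u * c" using \<open>fst u dvd fst m\<close> by (elim dvdE)
      obtain c' where c': "snd m = snd u * c'" using \<open>snd u dvd snd m\<close> by (elim dvdE)
      consider "fst u = 0" | "snd u = 0" | "fst u \<noteq> 0" "snd u \<noteq> 0" by blast
      then show "\<exists>c. m = zscale c u"
      proof cases
        case 1
        then show ?thesis using c c' by (intro exI[of _ c']) (simp add: prod_eq_iff)
      next
        case 2
        then show ?thesis using c c' by (intro exI[of _ c]) (simp add: prod_eq_iff)
      next
        case 3
        then have "c = c'" using eq c c' by auto
        then show ?thesis using c c' by (intro exI[of _ c]) (simp add: prod_eq_iff)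
      qed
    qed (auto simp: p_def D_def det2_def)
    obtain x y where "fst u * x + snd u * y = 1"
      using cop bezout_int[of "fst u" "snd u"] by (metis coprime_imp_gcd_eq_1 mult.commute)
    then have "p (\<epsilon> * (- y), \<epsilon> * x) = 1" unfolding p_def D_def det2_def using \<epsilon> by (auto simp: algebra_simps)
    then show "\<exists>b. p b = 1" ..
  qed
  moreover have "p w < 0"
  proof -
    have "D v w = - D w v" unfolding D_def using det2_swap[of v w] by simp
    then have "h * p w < 0" using vD Dv[of w] by simp
    then show ?thesis using h by (simp add: mult_less_0_iff)
  qed
  ultimately show thesis by (rule that)
qed

text \<open>
  Modulo v, a multiple of w is a nonnegative multiple of any u in S off the facet. Adding v often
  enough makes the coefficient of v nonnegative, and saturation removes the multiple.
\<close>

lemma facet_absorbs: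
  assumes f: "facet S p v" and w: "p w \<ge> 0"
  shows "\<exists>N. \<forall>n\<ge>N. w + zscale n v \<in> S"
proof (cases "p w = 0")
  case True
  then obtain c where c: "w = zscale c v" using f unfolding facet_def by blast
  have "w + zscale n v \<in> S" if "n \<ge> - c" for n
    using zscale_mem[of "c + n" v] that f unfolding facet_def c by (simp add: zscale_add_left)
  then show ?thesis by (intro exI[of _ "- c"] allI impI) simp
next
  case False
  have "\<exists>u\<in>S. p u > 0"
  proof (rule ccontr)
    assume "\<not> ?thesis"
    then have le: "p u \<le> 0" if "u \<in> S" for u using that by (meson not_le)
    have "p u \<ge> 0" if "u \<in> S" for u using f that unfolding facet_def by blast
    with le have "p g = 0" if "g \<in> Gs" for g using that generators(2) by (meson order_antisym subsetD)
    then have "p m = 0" for m using eq_0_if_additive[of p m] facet_additive(1)[OF f] by blast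
    then show False using False by blast
  qed
  then obtain u where u: "u \<in> S" "p u > 0" by blast
  have "p (zscale (p u) w - zscale (p w) u) = 0"
    by (simp add: facet_additive[OF f])
  then obtain c where c: "zscale (p u) w - zscale (p w) u = zscale c v" using f unfolding facet_def by blast
  have "w + zscale n v \<in> S" if n: "n \<ge> max 0 (- c)" for n
  proof (rule saturated[OF u(2)])
    have pos: "c + p u * n \<ge> 0"
    proof -
      have "n \<le> p u * n" using n u(2) mult_right_mono[of 1 "p u" n] by simp
      then show ?thesis using n by simp
    qed
    have "zscale (p u) (w + zscale n v) = zscale (p w) u + zscale (c + p u * n) v"
      using c by (simp add: zscale_add zscale_add_left algebra_simps)
    also have "\<dots> \<in> S" using pos w u f unfolding facet_def by (intro plus zscale_mem) auto
    finally show "zscale (p u) (w + zscale n v) \<in> S" .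
  qed
  then show ?thesis by (intro exI[of _ "max 0 (- c)"] allI impI) blast
qed

text \<open>
  Start with any vector on which p is -1 and add a multiple of v that is large enough for all of the
  finitely many generators off the facet. An element off the facet has such a generator as a summand.
\<close>

lemma facet_root:
  assumes f: "facet S p v"
  shows "\<exists>e. p e = -1 \<and> (\<forall>m\<in>S. p m > 0 \<longrightarrow> m + e \<in> S)"
proof -
  obtain b where b: "p b = 1" using f unfolding facet_def by blast
  have pv: "p v = 0" using f unfolding facet_def by (metis zscale_simps(2))
  have nonneg: "p m \<ge> 0" if "m \<in> S" for m using f that unfolding facet_def by blast
  define G where "G = {g\<in>Gs. p g > 0}"
  have "\<forall>g\<in>G. \<exists>N. \<forall>n\<ge>N. (g - b) + zscale n v \<in> S"
    unfolding G_def using facet_absorbs[OF f] b by (auto simp: facet_additive[OF f])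
  then obtain N where N: "\<And>g n. g \<in> G \<Longrightarrow> n \<ge> N g \<Longrightarrow> (g - b) + zscale n v \<in> S" by metis
  define n where "n = (\<Sum>g\<in>G. \<bar>N g\<bar>)"
  have "finite G" unfolding G_def using generators(1) by simp
  then have nG: "n \<ge> N g" if "g \<in> G" for g
    unfolding n_def using member_le_sum[of g G "\<lambda>g. \<bar>N g\<bar>"] that by fastforce
  define e where "e = zscale n v - b"
  have pe: "p e = -1" unfolding e_def by (simp add: facet_additive[OF f] b pv)
  have main: "m \<in> S \<and> (p m > 0 \<longrightarrow> m + e \<in> S)" if "m \<in> S" for m
  proof (rule generators(3)[of "\<lambda>m. m \<in> S \<and> (p m > 0 \<longrightarrow> m + e \<in> S)"])
    fix m m' assume m: "m \<in> S \<and> (p m > 0 \<longrightarrow> m + e \<in> S)" and m': "m' \<in> S \<and> (p m' > 0 \<longrightarrow> m' + e \<in> S)"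
    show "m + m' \<in> S \<and> (p (m + m') > 0 \<longrightarrow> m + m' + e \<in> S)"
    proof (intro conjI impI)
      show "m + m' \<in> S" using plus m m' by blast
      assume "p (m + m') > 0"
      then consider "p m > 0" | "p m' > 0" using nonneg m m' by (auto simp: facet_additive[OF f]) force
      then show "m + m' + e \<in> S"
      proof cases
        case 1
        then have "(m + e) + m' \<in> S" using plus m m' by blast
        then show ?thesis by (simp add: algebra_simps)
      next
        case 2
        then have "m + (m' + e) \<in> S" using plus m m' by blast
        then show ?thesis by (simp add: algebra_simps)
      qed
    qed
  next
    show "g \<in> S \<and> (p g > 0 \<longrightarrow> g + e \<in> S)" if "g \<in> Gs" for g
      using N[of g n] nG[of g] that generators(2) unfolding e_def G_def by (auto simp: algebra_simps)
  qed (use that zero facet_additive(2)[OF f] in auto)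
  show ?thesis using pe main by (intro exI[of _ e] conjI ballI) simp_all
qed

text \<open>
  If m is not zero, then p and q have the same kernel, and so they agree up to sign. The opposite sign
  would make p vanish on the generators.
\<close>

lemma facets_meet_in_0:
  assumes p: "facet S p v" and q: "facet S q u" and "p \<noteq> q" and m: "p m = 0" "q m = 0"
  shows "m = 0"
proof (rule ccontr)
  assume "m \<noteq> 0"
  obtain c where c: "m = zscale c v" using p m unfolding facet_def by blast
  obtain c' where c': "m = zscale c' u" using q m unfolding facet_def by blast
  have "c \<noteq> 0" "c' \<noteq> 0" using c c' \<open>m \<noteq> 0\<close> by auto
  have "q v = 0" using facet_additive(4)[OF q, of c v] m c \<open>c \<noteq> 0\<close> by simp
  obtain b where b: "p b = 1" using p unfolding facet_def by blast
  have qp: "q w = p w * q b" for w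
  proof -
    have "p (w - zscale (p w) b) = 0" by (simp add: facet_additive[OF p] b)
    then obtain k where "w - zscale (p w) b = zscale k v" using p unfolding facet_def by blast
    then have "q (w - zscale (p w) b) = 0" using \<open>q v = 0\<close> by (simp add: facet_additive[OF q])
    then show ?thesis by (simp add: facet_additive[OF q])
  qed
  obtain b' where "q b' = 1" using q unfolding facet_def by blast
  then have "q b = 1 \<or> q b = -1" using qp[of b'] by (metis mult.commute zmult_eq_1_iff)
  moreover have "q b \<noteq> -1"
  proof
    assume "q b = -1"
    then have neg: "q g = - p g" for g using qp[of g] by simp
    have "p g = 0" if "g \<in> Gs" for g
    proof -
      have "p g \<ge> 0" "q g \<ge> 0" using p q that generators(2) unfolding facet_def by blast+
      then show ?thesis using neg[of g] by linarith
    qed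
    then have "p b = 0" using eq_0_if_additive[of p b] facet_additive(1)[OF p] by blast
    then show False using b by simp
  qed
  ultimately have "q b = 1" by blast
  then have "q = p" using qp by (intro ext) (metis mult.right_neutral)
  then show False using \<open>p \<noteq> q\<close> by blast
qed

end

text \<open>
  The algebra has a basis of monomials \<open>E m\<close> with exponents m in S; they are eigenvectors of d with
  pairwise distinct weights.
\<close>

locale toric_algebra = complex_domain scale + saturated_monoid S Gs
  for scale :: "complex \<Rightarrow> 'a::idom \<Rightarrow> 'a" and S Gs +
  fixes d :: "'a \<Rightarrow> 'a" and \<omega> :: "int \<times> int \<Rightarrow> complex" and E :: "int \<times> int \<Rightarrow> 'a"
  assumes derivation_d: "derivation scale d" and inj_\<omega>: "inj \<omega>"
    and E_weight: "m \<in> S \<Longrightarrow> E m \<in> weight_space d (\<omega> m)" and E_nonzero: "m \<in> S \<Longrightarrow> E m \<noteq> 0"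
    and E_zero: "E 0 = 1" and E_plus: "m \<in> S \<Longrightarrow> m' \<in> S \<Longrightarrow> E (m + m') = E m * E m'"
    and E_span: "span (E ` S) = UNIV"
begin

lemma E_independent:
  assumes "finite F" "F \<subseteq> S" "(\<Sum>m\<in>F. scale (c m) (E m)) = 0" "m \<in> F"
  shows "c m = 0"
proof -
  note l = derivation_linear[OF derivation_d]
  have "scale (c m) (E m) = 0"
  proof (rule weight_vectors_zero[OF l assms(1) _ _ assms(3,4), where w = \<omega>])
    show "inj_on \<omega> F" using inj_\<omega> inj_on_subset by blast
    show "scale (c m) (E m) \<in> weight_space d (\<omega> m)" if "m \<in> F" for m
      by (rule subspace_scale[OF subspace_weight_space[OF l] E_weight]) (use assms(2) that in blast)
  qed
  then show ?thesis using E_nonzero[of m] subsetD[OF assms(2,4)] by simp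
qed

lemma E_inj: "inj_on E S"
proof (rule inj_onI, rule ccontr)
  fix m m' assume m: "m \<in> S" "m' \<in> S" "E m = E m'" "m \<noteq> m'"
  have "(\<Sum>k\<in>{m, m'}. scale (if k = m then 1 else -1) (E k)) = 0" using m by simp
  then have "(if m = m then 1 else - 1) = (0::complex)" by (rule E_independent[rotated 2]) (use m in auto)
  then show False by simp
qed

lemma E_expansion:
  obtains F c where "finite F" "F \<subseteq> S" "a = (\<Sum>m\<in>F. scale (c m) (E m))"
proof -
  have "a \<in> span (E ` S)" using E_span by simp
  then obtain t r where t: "finite t" "t \<subseteq> E ` S" "a = (\<Sum>v\<in>t. scale (r v) v)"
    unfolding span_explicit by blast
  obtain F where F: "F \<subseteq> S" "finite F" "t = E ` F" using finite_subset_image[OF t(1,2)] by blast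
  have "a = (\<Sum>m\<in>F. scale (r (E m)) (E m))"
    unfolding t(3) F(3) using inj_on_subset[OF E_inj F(1)] by (simp add: sum.reindex)
  then show thesis by (rule that[OF F(2,1)])
qed

text \<open>
  With e from \<open>facet_root\<close>, let D map \<open>E m\<close> to \<open>p m\<close> times \<open>E (m + e)\<close>, where the coefficient vanishes if
  \<open>m + e\<close> is outside S. Each application lowers p by one, so D is locally nilpotent, and its kernel is
  spanned by the monomials on the facet.
\<close>

lemma facet_derivation:
  assumes f: "facet S p v"
  shows "\<exists>D\<in>LND scale. \<forall>F c. finite F \<longrightarrow> F \<subseteq> S \<longrightarrow> D (\<Sum>m\<in>F. scale (c m) (E m)) = 0 \<longrightarrow>
    (\<forall>m\<in>F. c m \<noteq> 0 \<longrightarrow> p m = 0)"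
proof -
  obtain e where e': "p e = -1" "\<forall>m\<in>S. p m > 0 \<longrightarrow> m + e \<in> S"
    using facet_root[OF f] by (elim exE conjE) (rule that)
  note e = e'[rule_format]
  have nonneg: "p m \<ge> 0" if "m \<in> S" for m using f that unfolding facet_def by blast
  interpret vp: vector_space_pair scale scale ..
  have ind: "independent (E ` S)"
  proof
    assume "dependent (E ` S)"
    then obtain t u where t: "finite t" "t \<subseteq> E ` S" "(\<Sum>v\<in>t. scale (u v) v) = 0" "\<exists>v\<in>t. u v \<noteq> 0"
      unfolding dependent_explicit by blast
    obtain F where F: "F \<subseteq> S" "finite F" "t = E ` F" using finite_subset_image[OF t(1,2)] by blast
    have "(\<Sum>m\<in>F. scale (u (E m)) (E m)) = 0"
      using t(3) inj_on_subset[OF E_inj F(1)] unfolding F(3) by (simp add: sum.reindex)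
    from E_independent[OF F(2,1) this] show False using t(4) unfolding F(3) by blast
  qed
  define D where "D = vp.construct (E ` S) (\<lambda>b. scale (of_int (p (the_inv_into S E b))) (E (the_inv_into S E b + e)))"
  have Dlin: "Vector_Spaces.linear scale scale D" unfolding D_def by (rule vp.linear_construct[OF ind])
  have DE: "D (E m) = scale (of_int (p m)) (E (m + e))" if "m \<in> S" for m
    unfolding D_def using vp.construct_basis[OF ind] that E_inj by (simp add: the_inv_into_f_f)
  note l = linearD[OF Dlin]
  have DEE: "D (E m * E m') = D (E m) * E m' + E m * D (E m')" if m: "m \<in> S" "m' \<in> S" for m m'
  proof -
    have shift: "scale (of_int (p m)) (E (m + e)) * E m' = scale (of_int (p m)) (E (m + m' + e))"
      if "m \<in> S" "m' \<in> S" for m m'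
    proof (cases "p m = 0")
      case False
      then have "m + e \<in> S" using e(2) nonneg[of m] that by simp
      then have "E (m + e) * E m' = E ((m + e) + m')" using E_plus that by simp
      also have "(m + e) + m' = m + m' + e" by (simp add: algebra_simps)
      finally show ?thesis by (metis scale_mult_left)
    qed simp
    have "D (E m * E m') = scale (of_int (p (m + m'))) (E (m + m' + e))"
      using m plus DE E_plus by metis
    also have "\<dots> = scale (of_int (p m)) (E (m + m' + e)) + scale (of_int (p m')) (E (m' + m + e))"
      by (simp add: facet_additive(1)[OF f] scale_left_distrib add.commute)
    also have "\<dots> = D (E m) * E m' + D (E m') * E m"
      using shift[OF m] shift[OF m(2,1)] DE m by simp
    finally show ?thesis by (simp add: mult.commute)
  qed
  have "D (x * y) = D x * y + x * D y" for x y
  proof -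
    obtain F c where x: "finite F" "F \<subseteq> S" "x = (\<Sum>m\<in>F. scale (c m) (E m))" by (rule E_expansion)
    obtain G c' where y: "finite G" "G \<subseteq> S" "y = (\<Sum>m\<in>G. scale (c' m) (E m))" by (rule E_expansion)
    have "x * y = (\<Sum>m\<in>F. \<Sum>m'\<in>G. scale (c m * c' m') (E m * E m'))"
      unfolding x y sum_product by (simp add: scale_mult_scale)
    then have "D (x * y) = (\<Sum>m\<in>F. \<Sum>m'\<in>G. scale (c m * c' m') (D (E m * E m')))" by (simp add: l)
    also have "\<dots> = (\<Sum>m\<in>F. \<Sum>m'\<in>G. scale (c m * c' m') (D (E m) * E m' + E m * D (E m')))"
      using x(2) y(2) DEE by (intro sum.cong refl) (metis subsetD)
    also have "\<dots> = (\<Sum>m\<in>F. \<Sum>m'\<in>G. scale (c m) (D (E m)) * scale (c' m') (E m'))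
        + (\<Sum>m\<in>F. \<Sum>m'\<in>G. scale (c m) (E m) * scale (c' m') (D (E m')))"
      by (simp add: scale_mult_scale scale_right_distrib sum.distrib)
    also have "\<dots> = D x * y + x * D y" unfolding x y sum_product[symmetric] by (simp add: l)
    finally show ?thesis .
  qed
  then have Dder: "derivation scale D" by (intro derivationI) (simp_all add: l)
  have nil: "m \<in> S \<Longrightarrow> nat (p m) \<le> n \<Longrightarrow> (D ^^ Suc n) (E m) = 0" for n m
  proof (induction n arbitrary: m)
    case 0
    then have "p m = 0" using nonneg[of m] by simp
    then show ?case using DE 0 by simp
  next
    case (Suc n)
    show ?case
    proof (cases "p m = 0")
      case True
      have "(D ^^ 1) (E m) = 0" using DE Suc True by simp
      then show ?thesis by (rule funpow_eq_0_mono[OF Dlin]) simp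
    next
      case False
      then have me: "m + e \<in> S" using e(2) nonneg[of m] Suc.prems by simp
      have "nat (p (m + e)) \<le> n" using Suc.prems(2) e(1) by (simp add: facet_additive(1)[OF f])
      then have "(D ^^ Suc n) (E (m + e)) = 0" using Suc.IH[OF me] by blast
      then have "(D ^^ Suc n) (D (E m)) = 0"
        using DE[OF Suc.prems(1)] linearD(2)[OF linear_funpow[OF Dlin]] by (simp del: funpow.simps)
      then show ?thesis by (simp only: funpow_Suc_right o_apply)
    qed
  qed
  have "D \<in> LND scale"
    by (rule LND_iff_nilpotent_on_spanning_set[OF Dder E_span]) (use nil in blast)
  moreover have "p m = 0" if asm: "finite F" "F \<subseteq> S" "D (\<Sum>m\<in>F. scale (c m) (E m)) = 0" "m \<in> F" "c m \<noteq> 0" for F c m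
  proof (rule ccontr)
    assume pm: "p m \<noteq> 0"
    define F' where "F' = {m\<in>F. p m \<noteq> 0}"
    have "0 = (\<Sum>m\<in>F. scale (c m * of_int (p m)) (E (m + e)))"
      unfolding asm(3)[symmetric] using asm(2) DE by (auto simp: l intro!: sum.cong)
    also have "\<dots> = (\<Sum>m\<in>F'. scale (c m * of_int (p m)) (E (m + e)))"
      unfolding F'_def using asm(1) by (intro sum.mono_neutral_right) auto
    also have "\<dots> = (\<Sum>k\<in>(\<lambda>m. m + e) ` F'. scale (c (k - e) * of_int (p (k - e))) (E k))"
      by (subst sum.reindex) (auto simp: inj_on_def)
    finally have z: "(\<Sum>k\<in>(\<lambda>m. m + e) ` F'. scale (c (k - e) * of_int (p (k - e))) (E k)) = 0" by simp
    have sub: "(\<lambda>m. m + e) ` F' \<subseteq> S"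
    proof
      fix k assume "k \<in> (\<lambda>m. m + e) ` F'"
      then obtain m where "k = m + e" "m \<in> S" "p m \<noteq> 0" unfolding F'_def using asm(2) by blast
      then show "k \<in> S" using e(2)[of m] nonneg[of m] by simp
    qed
    have "finite ((\<lambda>m. m + e) ` F')" unfolding F'_def using asm(1) by simp
    from E_independent[OF this sub z, of "m + e"]
    show False using asm(4,5) pm unfolding F'_def by auto
  qed
  ultimately show ?thesis by (intro bexI[of _ D] allI impI ballI)
qed

lemma makar_limanov_two_facets:
  assumes p: "facet S p v" and q: "facet S q u" and "p \<noteq> q"
  shows "makar_limanov scale = range (\<lambda>c. scale c 1)"
proof
  show "range (\<lambda>c. scale c 1) \<subseteq> makar_limanov scale"
    using derivationD(9)[OF LND_D(1)] unfolding makar_limanov_def by blast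
  obtain D where D: "D \<in> LND scale" "\<forall>F c. finite F \<longrightarrow> F \<subseteq> S \<longrightarrow>
      D (\<Sum>m\<in>F. scale (c m) (E m)) = 0 \<longrightarrow> (\<forall>m\<in>F. c m \<noteq> 0 \<longrightarrow> p m = 0)"
    using facet_derivation[OF p] by (elim bexE) (rule that)
  obtain D' where D': "D' \<in> LND scale" "\<forall>F c. finite F \<longrightarrow> F \<subseteq> S \<longrightarrow>
      D' (\<Sum>m\<in>F. scale (c m) (E m)) = 0 \<longrightarrow> (\<forall>m\<in>F. c m \<noteq> 0 \<longrightarrow> q m = 0)"
    using facet_derivation[OF q] by (elim bexE) (rule that)
  show "makar_limanov scale \<subseteq> range (\<lambda>c. scale c 1)"
  proof
    fix a assume a: "a \<in> makar_limanov scale"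
    obtain F c where F: "finite F" "F \<subseteq> S" "a = (\<Sum>m\<in>F. scale (c m) (E m))" by (rule E_expansion)
    have "D a = 0" "D' a = 0" using a D(1) D'(1) unfolding makar_limanov_def by auto
    then have "D (\<Sum>m\<in>F. scale (c m) (E m)) = 0" "D' (\<Sum>m\<in>F. scale (c m) (E m)) = 0"
      unfolding F(3) .
    with D(2)[rule_format, OF F(1,2)] D'(2)[rule_format, OF F(1,2)]
    have m0: "m = 0" if "m \<in> F" "c m \<noteq> 0" for m
      by (intro facets_meet_in_0[OF p q \<open>p \<noteq> q\<close>]) (use that in simp_all)
    have "(if m = 0 then scale (c 0) 1 else 0) = scale (c m) (E m)" if "m \<in> F" for m
      using m0[OF that] E_zero by (cases "m = 0") auto
    then have "a = (\<Sum>m\<in>F. if m = 0 then scale (c 0) 1 else 0)"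
      unfolding F(3) by (intro sum.cong) simp_all
    also have "\<dots> = scale (if 0 \<in> F then c 0 else 0) 1" using F(1) by simp
    finally show "a \<in> range (\<lambda>c. scale c 1)" by blast
  qed
qed

lemma isomorphic_monoid_algebra:
  fixes \<phi> :: "'m::comm_monoid_add \<Rightarrow> int \<times> int"
  assumes \<phi>: "\<phi> 0 = 0" "\<And>k l. \<phi> (k + l) = \<phi> k + \<phi> l" "inj \<phi>" "range \<phi> = S"
  shows "algebra_isomorphic scale (monoid_algebra_scale :: complex \<Rightarrow> ('m \<Rightarrow>\<^sub>0 complex) \<Rightarrow> _)"
proof -
  let ?s2 = "monoid_algebra_scale :: complex \<Rightarrow> ('m \<Rightarrow>\<^sub>0 complex) \<Rightarrow> _"
  define \<Psi> where "\<Psi> p = (\<Sum>k\<in>Poly_Mapping.keys p. scale (Poly_Mapping.lookup p k) (E (\<phi> k)))" for p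
  have \<Psi>_eq: "\<Psi> p = (\<Sum>k\<in>F. scale (Poly_Mapping.lookup p k) (E (\<phi> k)))"
    if "finite F" "Poly_Mapping.keys p \<subseteq> F" for p F
    unfolding \<Psi>_def using that by (intro sum.mono_neutral_left) (auto simp: in_keys_iff)
  have \<Psi>_single: "\<Psi> (Poly_Mapping.single k c) = scale c (E (\<phi> k))" for k c
    using \<Psi>_eq[of "{k}" "Poly_Mapping.single k c"] by (simp add: keys_single)
  have \<Psi>_add: "\<Psi> (p + q) = \<Psi> p + \<Psi> q" for p q
  proof -
    let ?F = "Poly_Mapping.keys p \<union> Poly_Mapping.keys q"
    have "\<Psi> (p + q) = (\<Sum>k\<in>?F. scale (Poly_Mapping.lookup (p + q) k) (E (\<phi> k)))"
      by (intro \<Psi>_eq keys_add) simp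
    also have "\<dots> = (\<Sum>k\<in>?F. scale (Poly_Mapping.lookup p k) (E (\<phi> k))) + (\<Sum>k\<in>?F. scale (Poly_Mapping.lookup q k) (E (\<phi> k)))"
      by (simp add: lookup_add scale_left_distrib sum.distrib)
    also have "\<dots> = \<Psi> p + \<Psi> q" using \<Psi>_eq[of ?F p] \<Psi>_eq[of ?F q] by simp
    finally show ?thesis .
  qed
  have \<Psi>_0: "\<Psi> 0 = 0" unfolding \<Psi>_def by simp
  have \<Psi>_sum: "\<Psi> (sum f F) = (\<Sum>i\<in>F. \<Psi> (f i))" for f :: "'m \<Rightarrow> _" and F
    by (induction F rule: infinite_finite_induct) (auto simp: \<Psi>_0 \<Psi>_add)
  have singles: "p = (\<Sum>k\<in>Poly_Mapping.keys p. Poly_Mapping.single k (Poly_Mapping.lookup p k))" for p :: "'m \<Rightarrow>\<^sub>0 complex"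
  proof (rule poly_mapping_eqI)
    fix k
    have "(\<Sum>j\<in>Poly_Mapping.keys p. Poly_Mapping.lookup (Poly_Mapping.single j (Poly_Mapping.lookup p j)) k)
        = (\<Sum>j\<in>Poly_Mapping.keys p. if j = k then Poly_Mapping.lookup p k else 0)"
      by (intro sum.cong) (auto simp: lookup_single when_def)
    also have "\<dots> = Poly_Mapping.lookup p k" by (auto simp: in_keys_iff)
    finally show "Poly_Mapping.lookup p k
        = Poly_Mapping.lookup (\<Sum>k\<in>Poly_Mapping.keys p. Poly_Mapping.single k (Poly_Mapping.lookup p k)) k"
      by (simp add: lookup_sum)
  qed
  have \<phi>S: "\<phi> k \<in> S" for k using \<phi>(4) by blast
  have \<Psi>_mult: "\<Psi> (p * q) = \<Psi> p * \<Psi> q" for p q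
  proof -
    let ?s = "\<lambda>p k. Poly_Mapping.single k (Poly_Mapping.lookup p k)"
    have ss: "\<Psi> (?s p k * ?s q l) = \<Psi> (?s p k) * \<Psi> (?s q l)" for k l
      by (simp add: mult_single \<Psi>_single \<phi>(2) E_plus[OF \<phi>S \<phi>S] scale_mult_scale)
    have "\<Psi> (p * q) = \<Psi> ((\<Sum>k\<in>Poly_Mapping.keys p. ?s p k) * (\<Sum>l\<in>Poly_Mapping.keys q. ?s q l))"
      using singles[of p] singles[of q] by simp
    also have "\<dots> = (\<Sum>k\<in>Poly_Mapping.keys p. \<Psi> (?s p k)) * (\<Sum>l\<in>Poly_Mapping.keys q. \<Psi> (?s q l))"
      unfolding sum_product \<Psi>_sum ss ..
    also have "\<dots> = \<Psi> p * \<Psi> q" using singles[of p] singles[of q] \<Psi>_sum by metis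
    finally show ?thesis .
  qed
  have \<Psi>_scale: "\<Psi> (?s2 c p) = scale c (\<Psi> p)" for c p
    unfolding monoid_algebra_scale_def \<Psi>_mult \<Psi>_single \<phi>(1) E_zero
    using scale_eq_const_mult by metis
  have \<Psi>_one: "\<Psi> 1 = 1" using \<Psi>_single[of 0 1] \<phi>(1) E_zero by simp
  have "inj \<Psi>"
  proof (rule injI)
    fix p q assume eq: "\<Psi> p = \<Psi> q"
    let ?F = "Poly_Mapping.keys p \<union> Poly_Mapping.keys q"
    have inj: "inj_on \<phi> ?F" using \<phi>(3) inj_on_subset by blast
    define g where "g = inv \<phi>"
    have g: "g (\<phi> k) = k" for k unfolding g_def using \<phi>(3) by simp
    have "(\<Sum>k\<in>?F. scale (Poly_Mapping.lookup p k - Poly_Mapping.lookup q k) (E (\<phi> k))) = 0"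
      using eq \<Psi>_eq[of ?F p] \<Psi>_eq[of ?F q] by (simp add: scale_left_diff_distrib sum_subtractf)
    then have "(\<Sum>m\<in>\<phi> ` ?F. scale (Poly_Mapping.lookup p (g m) - Poly_Mapping.lookup q (g m)) (E m)) = 0"
      using inj g by (simp add: sum.reindex)
    then have z: "Poly_Mapping.lookup p (g m) - Poly_Mapping.lookup q (g m) = 0" if "m \<in> \<phi> ` ?F" for m
      by (rule E_independent[rotated 2]) (use that \<phi>S in auto)
    have "Poly_Mapping.lookup p k = Poly_Mapping.lookup q k" for k
    proof (cases "k \<in> ?F")
      case True
      then show ?thesis using z[OF imageI, of k] g[of k] by simp
    next
      case False
      then have "k \<notin> Poly_Mapping.keys p" "k \<notin> Poly_Mapping.keys q" by blast+
      then show ?thesis by (simp only: in_keys_iff not_not)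
    qed
    then show "p = q" by (intro poly_mapping_eqI)
  qed
  moreover have "surj \<Psi>"
    unfolding surj_def
  proof
    fix a
    obtain F c where F: "finite F" "F \<subseteq> S" "a = (\<Sum>m\<in>F. scale (c m) (E m))" by (rule E_expansion)
    obtain G where G: "finite G" "F = \<phi> ` G" using F \<phi>(4) finite_subset_image[of F \<phi> UNIV] by auto
    have "\<Psi> (\<Sum>k\<in>G. Poly_Mapping.single k (c (\<phi> k))) = (\<Sum>k\<in>G. scale (c (\<phi> k)) (E (\<phi> k)))"
      unfolding \<Psi>_sum \<Psi>_single ..
    also have "\<dots> = a" unfolding F(3) G(2) using \<phi>(3) inj_on_subset by (subst sum.reindex) auto
    finally show "\<exists>p. a = \<Psi> p" by (intro exI) (rule sym)
  qed
  ultimately have bij: "bij \<Psi>" by (simp add: bij_def)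
  have inv: "\<Psi> (inv \<Psi> a) = a" "inv \<Psi> (\<Psi> p) = p" for a p
    using bij by (simp_all add: bij_is_surj surj_f_inv_f bij_is_inj)
  have inv_eqI: "inv \<Psi> a = p" if "\<Psi> p = a" for a p using inv(2) that by blast
  have "vector_space ?s2"
    by unfold_locales
      (auto simp: monoid_algebra_scale_def algebra_simps single_add mult_single simp flip: mult.assoc)
  then have "Vector_Spaces.linear scale ?s2 (inv \<Psi>)"
    unfolding module_hom_iff_linear[symmetric] module_hom_def module_hom_axioms_def
    using module_axioms by (auto simp: module_iff_vector_space \<Psi>_add \<Psi>_scale inv intro!: inv_eqI)
  moreover have "inv \<Psi> 1 = 1" by (rule inv_eqI[OF \<Psi>_one])
  moreover have "inv \<Psi> (x * y) = inv \<Psi> x * inv \<Psi> y" for x y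
    by (rule inv_eqI) (simp add: \<Psi>_mult inv)
  ultimately have "algebra_hom scale ?s2 (inv \<Psi>)" unfolding algebra_hom_def by blast
  moreover have "bij (inv \<Psi>)" using bij by (rule bij_imp_bij_inv)
  ultimately show ?thesis unfolding algebra_isomorphic_def by blast
qed

text \<open>
  By \<open>facet_separating\<close> the monoid S is cut out by its facets.
\<close>

theorem toric_trichotomy:
  "algebra_isomorphic scale torus_algebra \<or> algebra_isomorphic scale line_times_Cstar_algebra
   \<or> makar_limanov scale = range (\<lambda>c. scale c 1)"
proof (cases "S = UNIV")
  case True
  have "algebra_isomorphic scale torus_algebra"
    unfolding torus_algebra_def by (rule isomorphic_monoid_algebra[of id]) (auto simp: True)
  then show ?thesis by blast
next
  case False
  then obtain p v where p: "facet S p v" using facet_separating by blast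
  show ?thesis
  proof (cases "\<exists>q u. facet S q u \<and> p \<noteq> q")
    case True
    then show ?thesis using makar_limanov_two_facets[OF p] by blast
  next
    case False
    have S: "m \<in> S \<longleftrightarrow> p m \<ge> 0" for m
    proof
      show "m \<in> S \<Longrightarrow> p m \<ge> 0" using p unfolding facet_def by blast
      assume m: "p m \<ge> 0"
      show "m \<in> S"
      proof (rule ccontr)
        assume "m \<notin> S"
        then obtain q u where "facet S q u" "q m < 0" using facet_separating by blast
        then show False using False m by (metis not_less)
      qed
    qed
    obtain b where b: "p b = 1" using p unfolding facet_def by blast
    have v: "v \<noteq> 0" "p v = 0" using p unfolding facet_def by (blast, metis zscale_simps(2))
    define \<phi> :: "nat \<times> int \<Rightarrow> int \<times> int" where "\<phi> x = zscale (int (fst x)) b + zscale (snd x) v" for x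
    have p\<phi>: "p (\<phi> x) = int (fst x)" for x unfolding \<phi>_def by (simp add: facet_additive[OF p] b v)
    have "algebra_isomorphic scale line_times_Cstar_algebra"
      unfolding line_times_Cstar_algebra_def
    proof (rule isomorphic_monoid_algebra[of \<phi>])
      show "\<phi> 0 = 0" unfolding \<phi>_def by simp
      show "\<phi> (k + l) = \<phi> k + \<phi> l" for k l unfolding \<phi>_def by (simp add: zscale_add_left algebra_simps)
      show "inj \<phi>"
      proof (rule injI)
        fix x y assume eq: "\<phi> x = \<phi> y"
        then have f: "fst x = fst y" using p\<phi>[of x] p\<phi>[of y] by simp
        then have "zscale (snd x) v = zscale (snd y) v" using eq unfolding \<phi>_def by simp
        then have "snd x = snd y" using v(1) by (auto simp: prod_eq_iff)
        with f show "x = y" by (simp add: prod_eq_iff)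
      qed
      show "range \<phi> = S"
      proof
        show "range \<phi> \<subseteq> S"
        proof (rule image_subsetI)
          show "\<phi> x \<in> S" for x unfolding S p\<phi> by simp
        qed
        show "S \<subseteq> range \<phi>"
        proof
          fix m assume "m \<in> S"
          then have "p m \<ge> 0" using S by blast
          have "p (m - zscale (p m) b) = 0" by (simp add: facet_additive[OF p] b)
          then obtain c where "m - zscale (p m) b = zscale c v" using p unfolding facet_def by blast
          then have "m = \<phi> (nat (p m), c)" unfolding \<phi>_def using \<open>p m \<ge> 0\<close> by (simp add: algebra_simps)
          then show "m \<in> range \<phi>" by blast
        qed
      qed
    qed
    then show ?thesis by blast
  qed
qed

end

section \<open>Surfaces with two independent weights\<close>

lemma int_subgroup_principal:
  fixes H :: "int set"
  assumes H: "\<And>x y. x \<in> H \<Longrightarrow> y \<in> H \<Longrightarrow> x - y \<in> H" and n: "n \<in> H" "n > 0"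
  obtains m where "m > 0" "m \<in> H" "\<And>x. x \<in> H \<Longrightarrow> m dvd x"
proof -
  define P where "P k \<longleftrightarrow> k > 0 \<and> int k \<in> H" for k
  define m where "m = (LEAST k. P k)"
  have "P (nat n)" using n by (simp add: P_def)
  then have m: "P m" and least: "\<And>k. P k \<Longrightarrow> m \<le> k" unfolding m_def by (auto intro: LeastI Least_le)
  have 0: "0 \<in> H" using H[OF n(1) n(1)] by simp
  have neg: "- x \<in> H" if "x \<in> H" for x using H[OF 0 that] by simp
  have mult: "k * x \<in> H" if x: "x \<in> H" for k x
  proof -
    have nn: "int j * x \<in> H" for j
    proof (induction j)
      case (Suc j)
      have "int j * x - (- x) \<in> H" using H[OF Suc neg[OF x]] .
      then show ?case by (simp add: algebra_simps)
    qed (simp add: 0)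
    show ?thesis
    proof (cases "k \<ge> 0")
      case True
      then show ?thesis using nn[of "nat k"] by simp
    next
      case False
      then show ?thesis using neg[OF nn[of "nat (- k)"]] by simp
    qed
  qed
  have "int m dvd x" if x: "x \<in> H" for x
  proof (rule ccontr)
    assume "\<not> int m dvd x"
    then have "x mod int m \<noteq> 0" by (simp add: dvd_eq_mod_eq_0)
    moreover have m0: "int m > 0" using m by (simp add: P_def)
    ultimately have pos: "x mod int m > 0" using pos_mod_sign[of "int m" x] by linarith
    have "x - (x div int m) * int m \<in> H" using H[OF x mult] m by (simp add: P_def)
    then have "x mod int m \<in> H" by (simp add: minus_div_mult_eq_mod)
    then have "P (nat (x mod int m))" using pos by (simp add: P_def)
    then have "m \<le> nat (x mod int m)" by (rule least)
    then show False using pos_mod_bound[OF m0, of x] pos by linarith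
  qed
  then show thesis using that[of "int m"] m by (auto simp: P_def)
qed

text \<open>
  One basis vector has the least positive first coordinate, the other is the shortest on the second
  axis.
\<close>

lemma sublattice_basis:
  fixes L :: "(int \<times> int) set"
  assumes L: "\<And>x y. x \<in> L \<Longrightarrow> y \<in> L \<Longrightarrow> x - y \<in> L" and n: "(n, 0) \<in> L" "(0, n) \<in> L" "n > 0"
  shows "\<exists>h1 h2. det2 h1 h2 \<noteq> 0 \<and> (\<forall>x. x \<in> L \<longleftrightarrow> (\<exists>i j. x = zscale i h1 + zscale j h2))"
proof -
  have 0: "0 \<in> L" using L[OF n(1) n(1)] by (simp add: zero_prod_def)
  have neg: "- x \<in> L" if "x \<in> L" for x using L[OF 0 that] by simp
  have add: "x + y \<in> L" if "x \<in> L" "y \<in> L" for x y using L[OF that(1) neg[OF that(2)]] by simp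
  have mult: "zscale k x \<in> L" if x: "x \<in> L" for k x
  proof -
    have nn: "zscale (int j) x \<in> L" for j
      by (induction j) (auto simp: 0 zscale_add_left intro: add x)
    show ?thesis
    proof (cases "k \<ge> 0")
      case True
      then show ?thesis using nn[of "nat k"] by simp
    next
      case False
      have eq: "zscale k x = - zscale (int (nat (- k))) x" using False by (simp add: prod_eq_iff)
      show ?thesis unfolding eq by (rule neg[OF nn])
    qed
  qed
  obtain m where m: "m > 0" "m \<in> fst ` L" "\<And>x. x \<in> fst ` L \<Longrightarrow> m dvd x"
  proof (rule int_subgroup_principal[of "fst ` L" n])
    show "x - y \<in> fst ` L" if "x \<in> fst ` L" "y \<in> fst ` L" for x y
      using that L by (metis (no_types, lifting) fst_diff image_iff)
    show "n \<in> fst ` L" using n(1) by force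
  qed (use n in auto)
  obtain k where k: "k > 0" "k \<in> {j. (0, j) \<in> L}" "\<And>x. x \<in> {j. (0, j) \<in> L} \<Longrightarrow> k dvd x"
  proof (rule int_subgroup_principal[of "{j. (0, j) \<in> L}" n])
    show "x - y \<in> {j. (0, j) \<in> L}" if "x \<in> {j. (0, j) \<in> L}" "y \<in> {j. (0, j) \<in> L}" for x y
      using L[of "(0, x)" "(0, y)"] that by simp
  qed (use n in auto)
  obtain h1 where h1: "h1 \<in> L" "fst h1 = m" using m(2) by blast
  define h2 where "h2 = (0::int, k)"
  have h2: "h2 \<in> L" unfolding h2_def using k(2) by simp
  have "det2 h1 h2 \<noteq> 0" using m(1) k(1) h1(2) by (simp add: det2_def h2_def)
  moreover have "x \<in> L \<longleftrightarrow> (\<exists>i j. x = zscale i h1 + zscale j h2)" for x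
  proof
    assume x: "x \<in> L"
    obtain i where i: "fst x = m * i" using m(3)[of "fst x"] x by (auto elim: dvdE)
    have "x - zscale i h1 \<in> L" using L[OF x mult[OF h1(1)]] .
    moreover have eq: "x - zscale i h1 = (0, snd x - i * snd h1)" using i h1(2) by (simp add: prod_eq_iff)
    ultimately obtain j where "snd x - i * snd h1 = k * j" using k(3) by (metis dvdE mem_Collect_eq)
    then have "x = zscale i h1 + zscale j h2" using i h1(2) by (simp add: prod_eq_iff h2_def mult.commute)
    then show "\<exists>i j. x = zscale i h1 + zscale j h2" by blast
  qed (use add mult h1 h2 in blast)
  ultimately show ?thesis by blast
qed

text \<open>
  The span of w and w' over the rational numbers, in terms of integers.
\<close>

definition rational_plane :: "complex \<Rightarrow> complex \<Rightarrow> complex set" where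
  "rational_plane w w' = {\<alpha>. \<exists>k i j::int. k > 0 \<and> of_int k * \<alpha> = of_int i * w + of_int j * w'}"

lemma rational_planeI:
  "k > 0 \<Longrightarrow> of_int k * \<alpha> = of_int i * w + of_int j * w' \<Longrightarrow> \<alpha> \<in> rational_plane w w'"
  unfolding rational_plane_def by blast

lemma rational_plane_closed:
  shows "0 \<in> rational_plane w w'"
    and "x \<in> rational_plane w w' \<Longrightarrow> y \<in> rational_plane w w' \<Longrightarrow> x + y \<in> rational_plane w w'"
    and "x \<in> rational_plane w w' \<Longrightarrow> y \<in> rational_plane w w' \<Longrightarrow> x - y \<in> rational_plane w w'"
    and "k > 0 \<Longrightarrow> of_nat k * x \<in> rational_plane w w' \<Longrightarrow> x \<in> rational_plane w w'"
proof -
  show "0 \<in> rational_plane w w'" by (rule rational_planeI[of 1 _ 0 _ 0]) auto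
  {
    assume "x \<in> rational_plane w w'" "y \<in> rational_plane w w'"
    then obtain k i j k' i' j' where x: "k > 0" "of_int k * x = of_int i * w + of_int j * w'"
      and y: "k' > 0" "of_int k' * y = of_int i' * w + of_int j' * w'"
      unfolding rational_plane_def by blast
    have "of_int (k * k') * (x + y) = of_int k' * (of_int k * x) + of_int k * (of_int k' * y)"
      by (simp add: algebra_simps)
    also have "\<dots> = of_int (k' * i + k * i') * w + of_int (k' * j + k * j') * w'"
      unfolding x y by (simp add: algebra_simps)
    finally show "x + y \<in> rational_plane w w'" using x(1) y(1)
      by (intro rational_planeI[of "k * k'" _ "k' * i + k * i'" _ "k' * j + k * j'"]) auto
    have "of_int (k * k') * (x - y) = of_int k' * (of_int k * x) - of_int k * (of_int k' * y)"
      by (simp add: algebra_simps)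
    also have "\<dots> = of_int (k' * i - k * i') * w + of_int (k' * j - k * j') * w'"
      unfolding x y by (simp add: algebra_simps)
    finally show "x - y \<in> rational_plane w w'" using x(1) y(1)
      by (intro rational_planeI[of "k * k'" _ "k' * i - k * i'" _ "k' * j - k * j'"]) auto
  }
  assume k: "k > 0" "of_nat k * x \<in> rational_plane w w'"
  then obtain l i j where l: "l > 0" "of_int l * (of_nat k * x) = of_int i * w + of_int j * w'"
    unfolding rational_plane_def by blast
  then have "of_int (l * int k) * x = of_int i * w + of_int j * w'" by (simp add: algebra_simps)
  then show "x \<in> rational_plane w w'" using k(1) l(1) by (intro rational_planeI[of "l * int k" _ i _ j]) auto
qed

context complex_domain begin

definition weights :: "('a \<Rightarrow> 'a) \<Rightarrow> complex set" where
  "weights T = {\<alpha>. \<exists>a\<in>weight_space T \<alpha>. a \<noteq> 0}"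

lemma weights_closed:
  assumes "derivation scale T"
  shows "0 \<in> weights T" "\<alpha> \<in> weights T \<Longrightarrow> \<beta> \<in> weights T \<Longrightarrow> \<alpha> + \<beta> \<in> weights T"
proof -
  show "0 \<in> weights T" unfolding weights_def using constant_weight_space[OF assms, of 1]
    by (intro CollectI bexI[of _ 1]) simp_all
  assume "\<alpha> \<in> weights T" "\<beta> \<in> weights T"
  then obtain a b where "a \<in> weight_space T \<alpha>" "a \<noteq> 0" "b \<in> weight_space T \<beta>" "b \<noteq> 0"
    unfolding weights_def by blast
  then show "\<alpha> + \<beta> \<in> weights T" unfolding weights_def
    using weight_space_mult[OF assms] by (intro CollectI bexI[of _ "a * b"]) simp_all
qed

lemma weight_in_weights_in:
  assumes T: "derivation scale T" and a: "a \<in> weights_in T M" "a \<in> weight_space T \<alpha>" "a \<noteq> 0"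
  shows "\<alpha> \<in> M"
proof (rule ccontr)
  assume n: "\<alpha> \<notin> M"
  note l = derivation_linear[OF T]
  obtain F x where F: "finite F" "F \<subseteq> M" "\<forall>\<alpha>. x \<alpha> \<in> weight_space T \<alpha>" "a = (\<Sum>\<alpha>\<in>F. x \<alpha>)"
    using weights_in_decomposition[OF l a(1)] by (elim exE conjE) (rule that)
  define y where "y \<gamma> = (if \<gamma> = \<alpha> then - a else x \<gamma>)" for \<gamma>
  have nF: "\<alpha> \<notin> F" using n F(2) by blast
  have "(\<Sum>\<gamma>\<in>F. y \<gamma>) = (\<Sum>\<gamma>\<in>F. x \<gamma>)" unfolding y_def using nF by (intro sum.cong) auto
  then have s: "(\<Sum>\<gamma>\<in>insert \<alpha> F. y \<gamma>) = 0" using F(1,4) nF by (simp add: y_def)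
  have "y \<alpha> = 0"
  proof (rule weight_components_zero[OF l _ _ s])
    show "y \<gamma> \<in> weight_space T \<gamma>" for \<gamma>
      unfolding y_def using F(3) subspace_neg[OF subspace_weight_space[OF l] a(2)] by auto
  qed (use F(1) in auto)
  then show False using a(3) by (simp add: y_def)
qed

text \<open>
  The homogeneous elements of degree \<open>\<alpha>\<close> in the localization at the nonzero weight vectors.
\<close>

definition weight_fraction :: "('a \<Rightarrow> 'a) \<Rightarrow> complex \<Rightarrow> 'a fract \<Rightarrow> bool" where
  "weight_fraction T \<alpha> z \<longleftrightarrow> (\<exists>P Q p q. P \<in> weight_space T p \<and> Q \<in> weight_space T q \<and> P \<noteq> 0 \<and> Q \<noteq> 0
     \<and> z = Fract P Q \<and> \<alpha> = p - q)"

lemma weight_fractionI: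
  "P \<in> weight_space T p \<Longrightarrow> Q \<in> weight_space T q \<Longrightarrow> P \<noteq> 0 \<Longrightarrow> Q \<noteq> 0 \<Longrightarrow> weight_fraction T (p - q) (Fract P Q)"
  unfolding weight_fraction_def by blast

lemma weight_fraction_mult:
  assumes T: "derivation scale T" and "weight_fraction T \<alpha> z" "weight_fraction T \<beta> y"
  shows "weight_fraction T (\<alpha> + \<beta>) (z * y)"
proof -
  obtain P Q p q where 1: "P \<in> weight_space T p" "Q \<in> weight_space T q" "P \<noteq> 0" "Q \<noteq> 0" "z = Fract P Q" "\<alpha> = p - q"
    using assms(2) unfolding weight_fraction_def by blast
  obtain P' Q' p' q' where 2: "P' \<in> weight_space T p'" "Q' \<in> weight_space T q'" "P' \<noteq> 0" "Q' \<noteq> 0"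
    "y = Fract P' Q'" "\<beta> = p' - q'"
    using assms(3) unfolding weight_fraction_def by blast
  have "weight_fraction T ((p + p') - (q + q')) (Fract (P * P') (Q * Q'))"
    using weight_space_mult[OF T] 1 2 by (intro weight_fractionI) auto
  moreover have "(p + p') - (q + q') = \<alpha> + \<beta>" "Fract (P * P') (Q * Q') = z * y" using 1 2 by simp_all
  ultimately show ?thesis by (simp only:)
qed

lemma weight_fraction_inverse:
  assumes "weight_fraction T \<alpha> z"
  shows "weight_fraction T (- \<alpha>) (inverse z)"
proof -
  obtain P Q p q where 1: "P \<in> weight_space T p" "Q \<in> weight_space T q" "P \<noteq> 0" "Q \<noteq> 0" "z = Fract P Q" "\<alpha> = p - q"
    using assms unfolding weight_fraction_def by blast
  show ?thesis using weight_fractionI[OF 1(2,1,4,3)] 1 by simp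
qed

lemma weight_fraction_power_int:
  assumes T: "derivation scale T" and z: "weight_fraction T \<alpha> z"
  shows "weight_fraction T (of_int k * \<alpha>) (z powi k)"
proof -
  have one: "weight_fraction T 0 1"
    using weight_fractionI[OF constant_weight_space[OF T, of 1] constant_weight_space[OF T, of 1]]
    by (simp add: One_fract_def)
  have pow: "weight_fraction T (of_nat n * \<beta>) (y ^ n)" if "weight_fraction T \<beta> y" for n \<beta> y
  proof (induction n)
    case (Suc n)
    then show ?case using weight_fraction_mult[OF T that Suc] by (simp add: algebra_simps)
  qed (simp add: one)
  show ?thesis
  proof (cases "k \<ge> 0")
    case True
    then show ?thesis using pow[OF z, of "nat k"] by (simp add: power_int_def)
  next
    case False
    then show ?thesis using pow[OF weight_fraction_inverse[OF z], of "nat (- k)"] by (simp add: power_int_def)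
  qed
qed

lemma weight_fraction_neq_0: "weight_fraction T \<alpha> z \<Longrightarrow> z \<noteq> 0"
  unfolding weight_fraction_def by (auto simp: Zero_fract_def eq_fract)

lemma weight_fraction_integral:
  assumes T: "derivation scale T" and z: "weight_fraction T \<alpha> (Fract b 1)"
  shows "b \<in> weight_space T \<alpha>" "b \<noteq> 0"
proof -
  obtain P Q p q where 1: "P \<in> weight_space T p" "Q \<in> weight_space T q" "P \<noteq> 0" "Q \<noteq> 0"
    "Fract b 1 = Fract P Q" "\<alpha> = p - q"
    using z unfolding weight_fraction_def by blast
  then have eq: "b * Q = P" by (simp add: eq_fract)
  then show "b \<noteq> 0" using 1 by auto
  have "T b * Q + b * scale q Q = scale p (b * Q)"
    using 1(1,2) unfolding eq[symmetric] by (simp add: weight_space_def derivationD(7)[OF T])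
  then have "(T b - scale \<alpha> b) * Q = 0"
    by (simp add: 1(6) scale_left_diff_distrib left_diff_distrib scale_mult_left[symmetric] scale_mult_right[symmetric] algebra_simps)
  then show "b \<in> weight_space T \<alpha>" using 1(4) by (simp add: weight_space_def)
qed

end

context affine_surface begin

context
  fixes d w1 w2 y1 y2
  assumes d: "diagonal d" and y1: "y1 \<in> weight_space d w1" "y1 \<noteq> 0"
    and y2: "y2 \<in> weight_space d w2" "y2 \<noteq> 0"
    and indep: "\<And>i j::int. of_int i * w1 + of_int j * w2 = 0 \<Longrightarrow> i = 0 \<and> j = 0"
begin

lemma weights_in_plane_subalgebra: "subalgebra scale (weights_in d (rational_plane w w'))"
  by (rule weights_in_subalgebra[OF diagonal_derivation[OF d]]) (rule rational_plane_closed; assumption)+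

lemma algebraic_over_plane:
  assumes "algebraic_over (weights_in d (rational_plane w w')) y" "y \<in> weight_space d \<alpha>" "y \<noteq> 0"
  shows "\<alpha> \<in> rational_plane w w'"
proof -
  obtain k :: nat where "k > 0" "of_nat k * \<alpha> \<in> rational_plane w w'"
    using algebraic_over_weights_in[OF diagonal_derivation[OF d] rational_plane_closed(3) assms(2,3,1)] by blast
  then show ?thesis by (rule rational_plane_closed(4))
qed

lemma w1_nonzero: "w1 \<noteq> 0"
  using indep[of 1 0] by auto

lemma w2_not_multiple: "w2 \<notin> rational_plane w1 0"
proof
  assume "w2 \<in> rational_plane w1 0"
  then obtain k i :: int where k: "k > 0" "of_int k * w2 = of_int i * w1" unfolding rational_plane_def by auto
  then have "of_int (- i) * w1 + of_int k * w2 = 0" by simp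
  then show False using indep k(1) by fastforce
qed

lemma y1_nonconstant: "y1 \<notin> range (\<lambda>c. scale c 1)"
proof
  assume "y1 \<in> range (\<lambda>c. scale c 1)"
  then have "d y1 = 0" using derivationD(9)[OF diagonal_derivation[OF d]] by blast
  then show False using y1 w1_nonzero by (simp add: weight_space_def)
qed

text \<open>
  The vector y1 is transcendental over the constants, and y2 over the vectors with weights in the
  rational line of w1. So every weight vector is algebraic over those with weights in the rational
  plane.
\<close>

lemma weights_in_plane: "weights d \<subseteq> rational_plane w1 w2"
proof
  fix \<alpha> assume "\<alpha> \<in> weights d"
  then obtain a where a: "a \<in> weight_space d \<alpha>" "a \<noteq> 0" unfolding weights_def by blast
  have sub: "rational_plane w1 0 \<subseteq> rational_plane w1 w2"
  proof
    fix x assume "x \<in> rational_plane w1 0"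
    then obtain k i :: int where "k > 0" "of_int k * x = of_int i * w1" unfolding rational_plane_def by auto
    then show "x \<in> rational_plane w1 w2" by (intro rational_planeI[of k _ i _ 0]) auto
  qed
  have "algebraic_over (weights_in d (rational_plane w1 w2)) a"
  proof (rule algebraic_over_third[OF weights_in_plane_subalgebra weights_in_plane_subalgebra])
    show "weights_in d (rational_plane w1 0) \<subseteq> weights_in d (rational_plane w1 w2)"
      unfolding weights_in_def using sub by (intro span_mono) blast
    show "y1 \<in> weights_in d (rational_plane w1 0)"
      by (rule weights_in_base[OF _ y1(1)]) (rule rational_planeI[of 1 _ 1 _ 0], auto)
    show "y1 \<notin> range (\<lambda>c. scale c 1)" by (rule y1_nonconstant)
    show "y2 \<in> weights_in d (rational_plane w1 w2)"
      by (rule weights_in_base[OF _ y2(1)]) (rule rational_planeI[of 1 _ 0 _ 1], auto)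
    show "\<not> algebraic_over (weights_in d (rational_plane w1 0)) y2"
      using algebraic_over_plane[OF _ y2] w2_not_multiple by blast
  qed
  then show "\<alpha> \<in> rational_plane w1 w2" by (rule algebraic_over_plane[OF _ a])
qed

text \<open>
  For a nonzero weight \<open>\<alpha>\<close>, two vectors of this weight that are algebraically independent would make
  y1 and y2 algebraic over the vectors with weights in the rational line of \<open>\<alpha>\<close>, and this line would
  contain both w1 and w2. A nonconstant vector of weight zero together with y1 would make y2 algebraic
  over the vectors with weights in the rational line of w1.
\<close>

lemma weight_space_line:
  assumes x: "x \<in> weight_space d \<alpha>" "x \<noteq> 0" and y: "y \<in> weight_space d \<alpha>"
  shows "\<exists>c. y = scale c x"
proof (cases "\<alpha> = 0")
  case False
  note dd = diagonal_derivation[OF d]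
  have "algebraic_over (complex_poly_values x) y"
  proof (rule ccontr)
    assume na: "\<not> algebraic_over (complex_poly_values x) y"
    let ?R = "weights_in d (rational_plane \<alpha> 0)"
    have \<alpha>: "\<alpha> \<in> rational_plane \<alpha> 0" by (rule rational_planeI[of 1 _ 1 _ 0]) auto
    have xR: "x \<in> ?R" "y \<in> ?R" using weights_in_base[OF \<alpha>] x y by blast+
    have "complex_poly_values x \<subseteq> ?R"
    proof
      fix u assume "u \<in> complex_poly_values x"
      then obtain q where u: "u = poly (map_poly (\<lambda>c. scale c 1) q) x" unfolding complex_poly_values_def by blast
      show "u \<in> ?R" unfolding u
        by (rule poly_in_subalgebra[OF weights_in_plane_subalgebra _ xR(1)])
          (simp add: coeff_map_poly subalgebraD(4)[OF weights_in_plane_subalgebra])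
    qed
    moreover have "x \<in> complex_poly_values x"
      unfolding complex_poly_values_def by (rule range_eqI[of _ _ "[:0, 1:]"]) (simp add: map_poly_pCons)
    moreover have "x \<notin> range (\<lambda>c. scale c 1)"
    proof
      assume "x \<in> range (\<lambda>c. scale c 1)"
      then have "d x = 0" using derivationD(9)[OF dd] by blast
      then show False using x False by (simp add: weight_space_def)
    qed
    ultimately have alg: "algebraic_over ?R z" for z
      using algebraic_over_third[OF complex_poly_values_subalgebra weights_in_plane_subalgebra _ _ _ xR(2) na] by blast
    have "w1 \<in> rational_plane \<alpha> 0" "w2 \<in> rational_plane \<alpha> 0"
      using algebraic_over_plane[OF alg] y1 y2 by blast+
    then obtain k i k' i' :: int where k: "k > 0" "of_int k * w1 = of_int i * \<alpha>" and k': "k' > 0" "of_int k' * w2 = of_int i' * \<alpha>"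
      unfolding rational_plane_def by auto
    have "of_int (i' * k) * w1 + of_int (- i * k') * w2 = of_int i' * (of_int k * w1) - of_int i * (of_int k' * w2)"
      by (simp add: algebra_simps)
    also have "\<dots> = 0" unfolding k k' by (simp add: algebra_simps)
    finally have "i = 0" using indep k(1) k'(1) by fastforce
    then show False using k w1_nonzero by simp
  qed
  then show ?thesis by (rule same_weight_proportional[OF dd x y False])
next
  case True
  note dd = diagonal_derivation[OF d]
  have const: "z \<in> range (\<lambda>c. scale c 1)" if z: "z \<in> weight_space d 0" for z
  proof (rule ccontr)
    assume nc: "z \<notin> range (\<lambda>c. scale c 1)"
    have zero: "weight_space d 0 = {a. d a = 0}" by (simp add: weight_space_def)
    have "algebraic_over (weights_in d (rational_plane w1 0)) y2"
    proof (rule algebraic_over_third[OF kernel_subalgebra[OF dd] weights_in_plane_subalgebra])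
      show "{a. d a = 0} \<subseteq> weights_in d (rational_plane w1 0)"
        unfolding zero[symmetric] using weights_in_base[OF rational_plane_closed(1)] by blast
      show "z \<in> {a. d a = 0}" using z zero by blast
      show "y1 \<in> weights_in d (rational_plane w1 0)"
        by (rule weights_in_base[OF _ y1(1)]) (rule rational_planeI[of 1 _ 1 _ 0], auto)
      show "\<not> algebraic_over {a. d a = 0} y1"
      proof
        assume "algebraic_over {a. d a = 0} y1"
        then have "d y1 = 0" by (rule derivation_eq_0_if_algebraic[OF dd, rotated]) simp
        then show False using y1 w1_nonzero by (simp add: weight_space_def)
      qed
    qed (rule nc)
    then show False using algebraic_over_plane[OF _ y2] w2_not_multiple by blast
  qed
  obtain c c' where c: "x = scale c 1" "y = scale c' 1" using const x y True by blast
  then have "c \<noteq> 0" using x(2) by auto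
  then have "y = scale (c' / c) x" using c by simp
  then show ?thesis ..
qed

text \<open>
  By finite generation the weights lie in a lattice, and they generate a sublattice of rank two. Choose
  homogeneous fractions Z1 and Z2 whose weights form a basis of it. The weight spaces are lines, hence
  each is spanned by a Laurent monomial in Z1 and Z2. The set of exponents of the monomials in the
  algebra is saturated by normality, because a monomial with a power in the algebra is integral.
\<close>

lemma toric_if_independent_weights:
  assumes normal: "integrally_closed TYPE('a)"
  shows "algebra_isomorphic scale torus_algebra \<or> algebra_isomorphic scale line_times_Cstar_algebra
   \<or> makar_limanov scale = range (\<lambda>c. scale c 1)"
proof -
  note dd = diagonal_derivation[OF d] and dl = diagonal_linear[OF d]
  have "span (\<Union>\<alpha>. weight_space d \<alpha>) = UNIV" using d by (simp add: diagonal_def)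
  from generators_in_spanning_set[OF this]
  obtain S where S: "finite S" "S \<subseteq> (\<Union>\<alpha>. weight_space d \<alpha>)"
    "\<forall>R. subalgebra scale R \<longrightarrow> S \<subseteq> R \<longrightarrow> R = UNIV" by (elim exE conjE) (rule that)
  have "\<forall>s\<in>S. \<exists>\<alpha>. s \<in> weight_space d \<alpha>" using S(2) by blast
  then obtain w where w: "\<And>s. s \<in> S \<Longrightarrow> s \<in> weight_space d (w s)" by metis
  define S' where "S' = S - {0}"
  have S': "finite S'" unfolding S'_def using S(1) by simp
  have ww: "w s \<in> weights d" if "s \<in> S'" for s using that w[of s] unfolding S'_def weights_def by auto
  have weights_sub: "weights d \<subseteq> M"
    if M: "0 \<in> M" "\<And>x y. x \<in> M \<Longrightarrow> y \<in> M \<Longrightarrow> x + y \<in> M" "\<And>s. s \<in> S' \<Longrightarrow> w s \<in> M" for M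
  proof -
    have sub: "subalgebra scale (weights_in d M)" by (rule weights_in_subalgebra[OF dd M(1,2)])
    have "S \<subseteq> weights_in d M"
    proof
      fix s assume s: "s \<in> S"
      show "s \<in> weights_in d M"
        using weights_in_base[OF M(3) w[OF s]] subalgebraD(3)[OF sub] s unfolding S'_def
        by (cases "s = 0") auto
    qed
    then have all: "weights_in d M = UNIV" using S(3) sub by blast
    show ?thesis
    proof
      fix \<alpha> assume "\<alpha> \<in> weights d"
      then obtain a where "a \<in> weight_space d \<alpha>" "a \<noteq> 0" unfolding weights_def by blast
      then show "\<alpha> \<in> M" using weight_in_weights_in[OF dd, of a M \<alpha>] all by simp
    qed
  qed
  have "\<exists>t::int \<times> int \<times> int. fst t > 0 \<and>
      of_int (fst t) * w s = of_int (fst (snd t)) * w1 + of_int (snd (snd t)) * w2" if "s \<in> S'" for s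
  proof -
    have "w s \<in> rational_plane w1 w2" using ww[OF that] weights_in_plane by blast
    then obtain k i j :: int where "k > 0" "of_int k * w s = of_int i * w1 + of_int j * w2"
      unfolding rational_plane_def by blast
    then show ?thesis by (intro exI[of _ "(k, i, j)"]) simp
  qed
  then obtain t :: "'a \<Rightarrow> int \<times> int \<times> int" where t: "\<forall>s\<in>S'. fst (t s) > 0 \<and>
      of_int (fst (t s)) * w s = of_int (fst (snd (t s))) * w1 + of_int (snd (snd (t s))) * w2"
    using bchoice[of S'] by meson
  define k i j where "k s = fst (t s)" and "i s = fst (snd (t s))" and "j s = snd (snd (t s))" for s
  have k: "k s > 0" "of_int (k s) * w s = of_int (i s) * w1 + of_int (j s) * w2" if "s \<in> S'" for s
    using t that unfolding k_def i_def j_def by blast+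
  \<comment> \<open>a common denominator for the weights of the generators\<close>
  define n where "n = (\<Prod>s\<in>S'. k s)"
  have n: "n > 0" unfolding n_def using k(1) by (intro prod_pos) auto
  define pl where "pl a = (of_int (fst a) * w1 + of_int (snd a) * w2) / of_int n" for a :: "int \<times> int"
  have pl_add: "pl (a + b) = pl a + pl b" and pl_diff: "pl (a - b) = pl a - pl b" for a b
    using n by (simp_all add: pl_def field_simps)
  have pl_inj: "a = b" if "pl a = pl b" for a b
  proof -
    have "of_int (fst (a - b)) * w1 + of_int (snd (a - b)) * w2 = 0"
      using that n pl_diff[of a b] by (simp add: pl_def)
    then show ?thesis using indep[of "fst (a - b)" "snd (a - b)"] by (simp add: prod_eq_iff)
  qed
  have w_pl: "weights d \<subseteq> range pl"
  proof (rule weights_sub)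
    show "0 \<in> range pl" by (rule range_eqI[of _ _ 0]) (simp add: pl_def)
    show "x + y \<in> range pl" if "x \<in> range pl" "y \<in> range pl" for x y
      using that by (elim rangeE) (simp flip: pl_add)
    show "w s \<in> range pl" if s: "s \<in> S'" for s
    proof -
      have "k s dvd n" unfolding n_def using S' s by (intro dvd_prodI) auto
      then obtain l where l: "n = k s * l" by (elim dvdE)
      have "l \<noteq> 0" using l n by auto
      then have "w s = pl (l * i s, l * j s)"
        using k[OF s] unfolding pl_def l by (simp add: field_simps)
      then show ?thesis by blast
    qed
  qed
  \<comment> \<open>the group generated by the weights\<close>
  define G where "G = {\<alpha> - \<beta> | \<alpha> \<beta>. \<alpha> \<in> weights d \<and> \<beta> \<in> weights d}"
  have GI: "\<alpha> - \<beta> \<in> G" if "\<alpha> \<in> weights d" "\<beta> \<in> weights d" for \<alpha> \<beta> unfolding G_def using that by blast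
  have wG: "\<alpha> \<in> G" if "\<alpha> \<in> weights d" for \<alpha> using GI[OF that weights_closed(1)[OF dd]] by simp
  have G_diff: "x - y \<in> G" if xy: "x \<in> G" "y \<in> G" for x y
  proof -
    obtain a b a' b' where ab: "x = a - b" "y = a' - b'" and
      wt: "a \<in> weights d" "b \<in> weights d" "a' \<in> weights d" "b' \<in> weights d"
      using xy unfolding G_def by blast
    have "(a + b') - (b + a') \<in> G" by (intro GI weights_closed(2)[OF dd] wt)
    moreover have "(a + b') - (b + a') = x - y" using ab by simp
    ultimately show ?thesis by (simp only:)
  qed
  have G0: "0 \<in> G" using wG weights_closed(1)[OF dd] by blast
  have G_mult: "of_nat m * x \<in> G" if "x \<in> G" for m x
  proof (induction m)
    case (Suc m)
    have "of_nat m * x - (0 - x) \<in> G" using G_diff[OF Suc G_diff[OF G0 that]] .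
    then show ?case by (simp add: algebra_simps)
  qed (simp add: G0)
  \<comment> \<open>the same group in coordinates of the lattice\<close>
  define L where "L = {a. pl a \<in> G}"
  have "w1 \<in> weights d" "w2 \<in> weights d" using y1 y2 unfolding weights_def by blast+
  then have L1: "(n, 0) \<in> L" "(0, n) \<in> L" using wG n by (simp_all add: L_def pl_def)
  have L2: "x - y \<in> L" if "x \<in> L" "y \<in> L" for x y using that G_diff unfolding L_def by (simp add: pl_diff)
  obtain h1 h2 where h: "det2 h1 h2 \<noteq> 0" "\<forall>x. x \<in> L \<longleftrightarrow> (\<exists>i j. x = zscale i h1 + zscale j h2)"
    using sublattice_basis[OF L2 L1 n] by blast
  define \<omega> where "\<omega> m = pl (zscale (fst m) h1 + zscale (snd m) h2)" for m
  have \<omega>_add: "\<omega> (m + m') = \<omega> m + \<omega> m'" for m m'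
    by (simp add: \<omega>_def pl_add[symmetric] zscale_add_left algebra_simps)
  have \<omega>0: "\<omega> 0 = 0" using \<omega>_add[of 0 0] by simp
  have inj: "inj \<omega>"
  proof (rule injI)
    fix m m' assume "\<omega> m = \<omega> m'"
    then have eq: "zscale (fst m) h1 + zscale (snd m) h2 = zscale (fst m') h1 + zscale (snd m') h2"
      unfolding \<omega>_def by (rule pl_inj)
    have "det2 (zscale (fst m) h1 + zscale (snd m) h2) h2 = fst m * det2 h1 h2"
      "det2 h1 (zscale (fst m) h1 + zscale (snd m) h2) = snd m * det2 h1 h2" for m :: "int \<times> int"
      by (simp_all add: det2_def algebra_simps)
    then show "m = m'" using eq h(1) by (metis mult_cancel_right prod_eq_iff)
  qed
  have range_\<omega>: "\<alpha> \<in> G \<longleftrightarrow> \<alpha> \<in> range \<omega>" for \<alpha>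
  proof
    assume \<alpha>: "\<alpha> \<in> G"
    then obtain a b where "\<alpha> = a - b" "a \<in> weights d" "b \<in> weights d" unfolding G_def by blast
    then obtain x y where "\<alpha> = pl x - pl y" using w_pl by blast
    then have "\<alpha> = pl (x - y)" by (simp add: pl_diff)
    with \<alpha> have "x - y \<in> L" unfolding L_def by simp
    then obtain i j where "x - y = zscale i h1 + zscale j h2" using h(2) by blast
    then have "\<alpha> = \<omega> (i, j)" unfolding \<omega>_def using \<open>\<alpha> = pl (x - y)\<close> by simp
    then show "\<alpha> \<in> range \<omega>" by blast
  next
    assume "\<alpha> \<in> range \<omega>"
    then obtain m where m: "\<alpha> = \<omega> m" by blast
    have "zscale (fst m) h1 + zscale (snd m) h2 \<in> L" using h(2) by blast
    then show "\<alpha> \<in> G" unfolding m \<omega>_def L_def by simp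
  qed
  have frac: "\<exists>z. weight_fraction d \<alpha> z" if \<alpha>: "\<alpha> \<in> G" for \<alpha>
  proof -
    obtain a b where "\<alpha> = a - b" "a \<in> weights d" "b \<in> weights d" using \<alpha> unfolding G_def by blast
    then show ?thesis using weight_fractionI[of _ d a _ b] unfolding weights_def by blast
  qed
  have "\<omega> (1, 0) \<in> G" "\<omega> (0, 1) \<in> G" using range_\<omega> by blast+
  then obtain Z1 Z2 where Z: "weight_fraction d (\<omega> (1, 0)) Z1" "weight_fraction d (\<omega> (0, 1)) Z2"
    using frac by meson
  define X where "X m = Z1 powi (fst m) * Z2 powi (snd m)" for m :: "int \<times> int"
  have \<omega>_lin: "\<omega> m = of_int (fst m) * \<omega> (1, 0) + of_int (snd m) * \<omega> (0, 1)" for m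
    using n by (simp add: \<omega>_def pl_def field_simps)
  have X_frac: "weight_fraction d (\<omega> m) (X m)" for m
    unfolding X_def using weight_fraction_mult[OF dd weight_fraction_power_int[OF dd Z(1)] weight_fraction_power_int[OF dd Z(2)]]
      \<omega>_lin[of m] by simp
  have X_add: "X (m + m') = X m * X m'" for m m'
    unfolding X_def using weight_fraction_neq_0[OF Z(1)] weight_fraction_neq_0[OF Z(2)]
    by (simp add: power_int_add)
  have X0: "X 0 = 1" by (simp add: X_def)
  define S0 where "S0 = {m. \<omega> m \<in> weights d}"
  have S0_iff: "m \<in> S0 \<longleftrightarrow> (\<exists>b. X m = Fract b 1)" for m
  proof
    assume "m \<in> S0"
    then obtain a where a: "a \<in> weight_space d (\<omega> m)" "a \<noteq> 0" unfolding S0_def weights_def by blast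
    obtain P Q p q where PQ: "P \<in> weight_space d p" "Q \<in> weight_space d q" "P \<noteq> 0" "Q \<noteq> 0" "X m = Fract P Q" "\<omega> m = p - q"
      using X_frac[of m] unfolding weight_fraction_def by blast
    have "a * Q \<in> weight_space d p" using weight_space_mult[OF dd a(1) PQ(2)] PQ(6) by simp
    then obtain c where "P = scale c (a * Q)" using weight_space_line[of "a * Q" p P] PQ a by auto
    then have "X m = Fract (scale c a) 1" using PQ by (simp add: eq_fract scale_mult_left)
    then show "\<exists>b. X m = Fract b 1" by blast
  next
    assume "\<exists>b. X m = Fract b 1"
    then obtain b where b: "X m = Fract b 1" by blast
    have "weight_fraction d (\<omega> m) (Fract b 1)" using X_frac[of m] b by simp
    from weight_fraction_integral[OF dd this] show "m \<in> S0" unfolding S0_def weights_def by blast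
  qed
  define E where "E m = (SOME b. X m = Fract b 1)" for m
  have E: "X m = Fract (E m) 1" if "m \<in> S0" for m
    unfolding E_def using that S0_iff by (metis (mono_tags, lifting) someI_ex)
  have Eprop: "E m \<in> weight_space d (\<omega> m)" "E m \<noteq> 0" if "m \<in> S0" for m
    using weight_fraction_integral[OF dd] X_frac[of m] E[OF that] by metis+
  have E_eqI: "E m = b" if "m \<in> S0" "X m = Fract b 1" for m b
    using E[OF that(1)] that(2) by (simp add: eq_fract)
  have S0_plus: "m + m' \<in> S0" if "m \<in> S0" "m' \<in> S0" for m m'
    using that weights_closed(2)[OF dd] unfolding S0_def by (simp add: \<omega>_add)
  have S0_0: "0 \<in> S0" unfolding S0_def using weights_closed(1)[OF dd] by (simp add: \<omega>0)
  have X_pow: "X (zscale (int k) m) = X m ^ k" for k m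
    by (induction k) (simp_all add: X0 X_add zscale_add_left)
  interpret toric_algebra scale S0 "{m. \<exists>s\<in>S'. \<omega> m = w s}" d \<omega> E
  proof
    show "0 \<in> S0" by (rule S0_0)
    show "m + m' \<in> S0" if "m \<in> S0" "m' \<in> S0" for m m' using S0_plus[OF that] .
    show "m \<in> S0" if kk: "k > 0" "zscale k m \<in> S0" for k m
    proof -
      define l where "l = nat k"
      have l: "l > 0" "k = int l" unfolding l_def using kk by auto
      obtain a where a: "X m ^ l = Fract a 1" using kk(2) S0_iff X_pow[of l m] l(2) by metis
      \<comment> \<open>the monomial is a root of a monic polynomial over the algebra\<close>
      define p where "p = monom 1 l + [:- a:]"
      have "degree p = degree (monom (1::'a) l)"
        unfolding p_def by (rule degree_add_eq_left) (use l(1) in \<open>simp add: degree_monom_eq\<close>)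
      then have "degree p = l" by (simp add: degree_monom_eq)
      moreover have "coeff p l = 1" unfolding p_def using l(1) by (cases l) (simp_all add: coeff_pCons)
      ultimately have "lead_coeff p = 1" by simp
      moreover have mp: "map_poly (\<lambda>a. Fract a 1) p = monom 1 l + [:- Fract a 1:]"
        unfolding p_def using l(1)
        by (intro poly_eqI) (auto simp: coeff_map_poly coeff_pCons Zero_fract_def[symmetric]
            One_fract_def[symmetric] split: nat.splits)
      have "poly (map_poly (\<lambda>a. Fract a 1) p) (X m) = 0"
        unfolding mp a[symmetric] by (simp add: poly_monom)
      ultimately show ?thesis using normal S0_iff unfolding integrally_closed_def by blast
    qed
    show "\<exists>s\<in>S0. \<exists>s'\<in>S0. m = s - s'" for m
    proof -
      have "\<omega> m \<in> G" using range_\<omega> by blast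
      then obtain a b where ab: "\<omega> m = a - b" "a \<in> weights d" "b \<in> weights d" unfolding G_def by blast
      then obtain s s' where s: "a = \<omega> s" "b = \<omega> s'" using wG range_\<omega> by blast
      then have "\<omega> (m + s') = \<omega> s" using ab by (simp add: \<omega>_add)
      then have "m + s' = s" using inj by (simp add: inj_eq)
      then have "m = s - s'" by (metis add_diff_cancel_right')
      moreover have "s \<in> S0" "s' \<in> S0" using s ab(2,3) unfolding S0_def by simp_all
      ultimately show ?thesis by (intro bexI)
    qed
    show "finite {m. \<exists>s\<in>S'. \<omega> m = w s}"
    proof -
      have "finite (\<omega> -` (w ` S'))" using S' by (intro finite_vimageI inj) auto
      moreover have "{m. \<exists>s\<in>S'. \<omega> m = w s} = \<omega> -` (w ` S')" by auto
      ultimately show ?thesis by (simp only:)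
    qed
    show "{m. \<exists>s\<in>S'. \<omega> m = w s} \<subseteq> S0" 
    proof
      fix m assume "m \<in> {m. \<exists>s\<in>S'. \<omega> m = w s}"
      then obtain s where "s \<in> S'" "\<omega> m = w s" by blast
      then show "m \<in> S0" unfolding S0_def using ww[of s] by simp
    qed
    show "P m" if P: "P 0" "\<And>m m'. P m \<Longrightarrow> P m' \<Longrightarrow> P (m + m')" "\<And>g. g \<in> {m. \<exists>s\<in>S'. \<omega> m = w s} \<Longrightarrow> P g" "m \<in> S0" for P m
    proof -
      have "weights d \<subseteq> {\<alpha>. \<exists>m. \<omega> m = \<alpha> \<and> P m}"
      proof (rule weights_sub)
        show "0 \<in> {\<alpha>. \<exists>m. \<omega> m = \<alpha> \<and> P m}" using P(1) \<omega>0 by blast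
        show "x + y \<in> {\<alpha>. \<exists>m. \<omega> m = \<alpha> \<and> P m}"
          if "x \<in> {\<alpha>. \<exists>m. \<omega> m = \<alpha> \<and> P m}" "y \<in> {\<alpha>. \<exists>m. \<omega> m = \<alpha> \<and> P m}" for x y
          using that P(2) \<omega>_add by blast
        show "w s \<in> {\<alpha>. \<exists>m. \<omega> m = \<alpha> \<and> P m}" if "s \<in> S'" for s
        proof -
          have "w s \<in> range \<omega>" using wG[OF ww[OF that]] range_\<omega> by blast
          then obtain m where m: "w s = \<omega> m" by blast
          have "m \<in> {m. \<exists>s\<in>S'. \<omega> m = w s}" by (intro CollectI bexI[of _ s] m[symmetric] that)
          then have "P m" by (rule P(3))
          then show ?thesis unfolding m by (intro CollectI exI[of _ m]) simp
        qed
      qed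
      then have "\<exists>m'. \<omega> m' = \<omega> m \<and> P m'" using P(4) unfolding S0_def by blast
      then show ?thesis using inj by (auto simp: inj_eq)
    qed
    show "derivation scale d" by (rule dd)
    show "inj \<omega>" by (rule inj)
    show "E m \<in> weight_space d (\<omega> m)" "E m \<noteq> 0" if "m \<in> S0" for m using Eprop[OF that] .
    show "E 0 = 1" by (rule E_eqI[OF S0_0]) (simp add: X0 One_fract_def)
    show "E (m + m') = E m * E m'" if "m \<in> S0" "m' \<in> S0" for m m'
      by (rule E_eqI[OF S0_plus[OF that]]) (simp add: X_add E that)
    have "weight_space d \<alpha> \<subseteq> span (E ` S0)" for \<alpha>
    proof
      fix a assume a: "a \<in> weight_space d \<alpha>"
      show "a \<in> span (E ` S0)"
      proof (cases "a = 0")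
        case False
        then have \<alpha>: "\<alpha> \<in> weights d" using a unfolding weights_def by blast
        then obtain m where m: "\<alpha> = \<omega> m" using wG range_\<omega> by blast
        with \<alpha> have mS: "m \<in> S0" unfolding S0_def by simp
        obtain c where "a = scale c (E m)" using weight_space_line[OF Eprop[OF mS]] a m by blast
        then show ?thesis using mS by (auto intro: span_scale span_base)
      qed (simp add: span_zero)
    qed
    then have "(\<Union>\<alpha>. weight_space d \<alpha>) \<subseteq> span (E ` S0)" by blast
    then have "span (\<Union>\<alpha>. weight_space d \<alpha>) \<subseteq> span (E ` S0)" by (simp add: span_minimal)
    then show "span (E ` S0) = UNIV" using d unfolding diagonal_def by blast
  qed
  show ?thesis by (rule toric_trichotomy)
qed

end

end

section \<open>Commuting semisimple derivations\<close>

context complex_domain begin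

text \<open>
  The components of a d-eigenvector with respect to d' are d-eigenvectors, since d' preserves the
  eigenspaces of d.
\<close>

lemma joint_weight_vectors_span:
  assumes d: "diagonal d" and d': "diagonal d'" and comm: "\<And>a. d (d' a) = d' (d a)"
  shows "span (\<Union>\<alpha> \<beta>. weight_space d \<alpha> \<inter> weight_space d' \<beta>) = UNIV"
proof -
  let ?B = "\<Union>\<alpha> \<beta>. weight_space d \<alpha> \<inter> weight_space d' \<beta>"
  have "weight_space d \<alpha> \<subseteq> span ?B" for \<alpha>
  proof
    fix a assume a: "a \<in> weight_space d \<alpha>"
    obtain F x where F: "finite F" "\<And>\<beta>. x \<beta> \<in> weight_space d' \<beta>" "a = (\<Sum>\<beta>\<in>F. x \<beta>)"
      using diagonal_decomposition[OF d'] by blast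
    have "x \<beta> \<in> weight_space d \<alpha>" if "\<beta> \<in> F" for \<beta>
    proof (rule weight_components_mem[OF diagonal_linear[OF d'] subspace_weight_space[OF diagonal_linear[OF d]]])
      show "d' v \<in> weight_space d \<alpha>" if "v \<in> weight_space d \<alpha>" for v
        using that comm linearD(2)[OF diagonal_linear[OF d']] by (simp add: weight_space_def)
    qed (use F a that in auto)
    then have "x \<beta> \<in> ?B" if "\<beta> \<in> F" for \<beta> using that F(2) by blast
    then show "a \<in> span ?B" unfolding F(3) by (intro span_sum span_base)
  qed
  then have "(\<Union>\<alpha>. weight_space d \<alpha>) \<subseteq> span ?B" by blast
  then have "span (\<Union>\<alpha>. weight_space d \<alpha>) \<subseteq> span ?B" by (simp add: span_minimal)
  then show ?thesis using d unfolding diagonal_def by blast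
qed

end

context nontrivial_makar_limanov begin

text \<open>
  The weights of \<open>d + \<theta> d'\<close> determine the joint weights, including rational relations between those of
  the generators, if \<open>\<theta>\<close> avoids countably many values. If all these weights are rational multiples of
  one of them, then the joint weights are multiples of one of them and \<open>d'\<close> is a multiple of d.
  Otherwise there are two independent weights and the surface is toric.
\<close>

lemma commuting_diagonal_proportional:
  assumes normal: "integrally_closed TYPE('a)"
    and no_torus: "\<not> algebra_isomorphic scale torus_algebra"
    and no_line: "\<not> algebra_isomorphic scale line_times_Cstar_algebra"
    and d: "diagonal d" and d': "diagonal d'" and comm: "\<And>a. d (d' a) = d' (d a)"
    and nz: "d b \<noteq> 0"
  shows "\<exists>c. \<forall>a. d' a = scale c (d a)"
proof -
  let ?B = "\<Union>\<alpha> \<beta>. weight_space d \<alpha> \<inter> weight_space d' \<beta>"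
  note dd = diagonal_derivation[OF d] and dd' = diagonal_derivation[OF d']
  note spanB = joint_weight_vectors_span[OF d d' comm]
  obtain S where S: "finite S" "S \<subseteq> ?B" "\<forall>R. subalgebra scale R \<longrightarrow> S \<subseteq> R \<longrightarrow> R = UNIV"
    using generators_in_spanning_set[OF spanB] by (elim exE conjE) (rule that)
  have "\<forall>s\<in>S. \<exists>\<alpha> \<beta>. s \<in> weight_space d \<alpha> \<and> s \<in> weight_space d' \<beta>" using S(2) by blast
  then obtain u v where uv: "\<And>s. s \<in> S \<Longrightarrow> s \<in> weight_space d (u s)" "\<And>s. s \<in> S \<Longrightarrow> s \<in> weight_space d' (v s)"
    by metis
  have eq_if: "D = (\<lambda>a. 0)" if D: "derivation scale D" "\<And>s. s \<in> S \<Longrightarrow> D s = 0" for D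
  proof -
    have "S \<subseteq> {a. D a = 0}" using D(2) by blast
    then have "{a. D a = 0} = UNIV" using S(3) kernel_subalgebra[OF D(1)] by blast
    then show ?thesis by blast
  qed
  \<comment> \<open>for a parameter outside this countable set, a rational relation between the combined weights of two generators holds for their joint weights\<close>
  define bad where "bad = (\<lambda>(s, t, k, i). - (of_int k * u s - of_int i * u t) / (of_int k * v s - of_int i * v t))
    ` (S \<times> S \<times> (UNIV :: int set) \<times> (UNIV :: int set))"
  have "countable bad" unfolding bad_def using S(1) by (intro countable_image countable_SIGMA) (auto intro: countable_finite)
  then obtain \<theta> where \<theta>: "\<theta> \<notin> bad" using uncountable_complex by (metis UNIV_eq_I)
  define e where "e a = d a + scale \<theta> (d' a)" for a
  define x where "x s = u s + \<theta> * v s" for s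
  have sep: "of_int k * u s = of_int i * u t \<and> of_int k * v s = of_int i * v t"
    if "of_int k * x s = of_int i * x t" "s \<in> S" "t \<in> S" for s t and k i :: int
  proof -
    have eq: "\<theta> * (of_int k * v s - of_int i * v t) = - (of_int k * u s - of_int i * u t)"
      using that(1) unfolding x_def by (simp add: algebra_simps)
    have "of_int k * v s - of_int i * v t = 0"
    proof (rule ccontr)
      assume "of_int k * v s - of_int i * v t \<noteq> 0"
      then have "\<theta> = - (of_int k * u s - of_int i * u t) / (of_int k * v s - of_int i * v t)"
        using eq by (simp add: eq_divide_eq)
      then have "\<theta> \<in> bad" unfolding bad_def using that(2,3) by (intro image_eqI[of _ _ "(s, t, k, i)"]) auto
      then show False using \<theta> by blast
    qed
    then show ?thesis using eq by simp
  qed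
  have eS: "s \<in> weight_space e (x s)" if "s \<in> S" for s
    using uv[OF that] by (simp add: weight_space_def e_def x_def scale_left_distrib)
  have e: "diagonal e"
    unfolding diagonal_def
  proof
    show "derivation scale e" unfolding e_def by (intro derivation_add derivation_scale dd dd')
    have "?B \<subseteq> (\<Union>\<gamma>. weight_space e \<gamma>)"
    proof
      fix a assume "a \<in> ?B"
      then obtain \<alpha> \<beta> where "a \<in> weight_space d \<alpha>" "a \<in> weight_space d' \<beta>" by blast
      then have "a \<in> weight_space e (\<alpha> + \<theta> * \<beta>)" by (simp add: weight_space_def e_def scale_left_distrib)
      then show "a \<in> (\<Union>\<gamma>. weight_space e \<gamma>)" by blast
    qed
    then have "span ?B \<subseteq> span (\<Union>\<gamma>. weight_space e \<gamma>)" by (rule span_mono)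
    then show "span (\<Union>\<gamma>. weight_space e \<gamma>) = UNIV" using spanB by blast
  qed
  have "\<exists>s\<in>S. d s \<noteq> 0" using eq_if[OF dd] nz by metis
  then obtain s where s: "s \<in> S" "d s \<noteq> 0" by blast
  then have us: "u s \<noteq> 0" "s \<noteq> 0" using uv(1)[of s] derivationD(3)[OF dd] by (auto simp: weight_space_def)
  have xs: "x s \<noteq> 0" using sep[of 1 s 0 s] us s(1) by auto
  define c where "c = v s / u s"
  have "d' t = scale c (d t)" if t: "t \<in> S" for t
  proof (cases "t = 0")
    case False
    have "\<exists>i j::int. of_int i * x s + of_int j * x t = 0 \<and> \<not> (i = 0 \<and> j = 0)"
    proof (rule ccontr)
      assume "\<not> ?thesis"
      then have ind: "\<And>i j::int. of_int i * x s + of_int j * x t = 0 \<Longrightarrow> i = 0 \<and> j = 0" by blast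
      show False
        using toric_if_independent_weights[OF e eS[OF s(1)] us(2) eS[OF t] False ind normal]
          no_torus no_line makar_limanov_nontrivial by blast
    qed
    then obtain i j :: int where ij: "of_int i * x s + of_int j * x t = 0" "\<not> (i = 0 \<and> j = 0)" by blast
    then have j: "j \<noteq> 0" using xs by auto
    have "of_int j * x t = of_int (- i) * x s" using ij(1) by (simp add: eq_neg_iff_add_eq_0 add.commute)
    then have "of_int j * u t = of_int (- i) * u s" "of_int j * v t = of_int (- i) * v s"
      using sep[OF _ t s(1)] by blast+
    then have "u t = of_int (- i) / of_int j * u s" "v t = of_int (- i) / of_int j * v s"
      using j by (simp_all add: field_simps)
    then have "v t = c * u t" unfolding c_def using us by simp
    then show ?thesis using uv[OF t] by (simp add: weight_space_def)
  qed (simp add: derivationD(3)[OF dd] derivationD(3)[OF dd'])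
  then have "(\<lambda>a. d' a - scale c (d a)) = (\<lambda>a. 0)"
    by (intro eq_if derivation_diff derivation_scale dd dd') auto
  then show ?thesis by (intro exI[of _ c] allI) (metis eq_iff_diff_eq_0)
qed

end

section \<open>Components of a second semisimple derivation\<close>

context complex_domain begin

text \<open>
  For an eigenvector x of d in V, the vectors \<open>Tc \<alpha> x\<close> are the components of \<open>T x\<close>, which is in V.
\<close>

lemma component_stable:
  assumes d: "diagonal d" and V: "subspace V" "\<And>v. v \<in> V \<Longrightarrow> d v \<in> V" "\<And>v. v \<in> V \<Longrightarrow> T v \<in> V"
    and F: "finite F" "\<And>\<alpha>. homogeneous d \<alpha> (Tc \<alpha>)" "\<And>a. T a = (\<Sum>\<alpha>\<in>F. Tc \<alpha> a)"
    and \<alpha>: "\<alpha> \<in> F" and v: "v \<in> V"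
  shows "Tc \<alpha> v \<in> V"
proof -
  obtain G x where G: "finite G" "\<And>\<beta>. x \<beta> \<in> weight_space d \<beta>" "v = (\<Sum>\<beta>\<in>G. x \<beta>)"
    using diagonal_decomposition[OF d] by blast
  have l: "Vector_Spaces.linear scale scale (Tc \<alpha>)" for \<alpha>
    using F(2)[of \<alpha>] unfolding homogeneous_def by (blast intro: derivation_linear)
  have "Tc \<alpha> (x \<beta>) \<in> V" if \<beta>: "\<beta> \<in> G" for \<beta>
  proof -
    have xV: "x \<beta> \<in> V"
    proof (rule weight_components_mem[OF diagonal_linear[OF d] V(1,2) G(1,2) _ \<beta>])
      show "(\<Sum>\<beta>\<in>G. x \<beta>) \<in> V" using v G(3) by simp
    qed
    have "(\<Sum>\<gamma>\<in>(\<lambda>\<alpha>. \<beta> + \<alpha>) ` F. Tc (\<gamma> - \<beta>) (x \<beta>)) = T (x \<beta>)"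
      unfolding F(3) by (subst sum.reindex) (auto simp: inj_on_def)
    then have s: "(\<Sum>\<gamma>\<in>(\<lambda>\<alpha>. \<beta> + \<alpha>) ` F. Tc (\<gamma> - \<beta>) (x \<beta>)) \<in> V" using V(3)[OF xV] by simp
    have "Tc (\<beta> + \<alpha> - \<beta>) (x \<beta>) \<in> V"
    proof (rule weight_components_mem[OF diagonal_linear[OF d] V(1,2) _ _ s])
      show "Tc (\<gamma> - \<beta>) (x \<beta>) \<in> weight_space d \<gamma>" for \<gamma>
        using homogeneous_weight_space[OF F(2) G(2), of "\<gamma> - \<beta>" \<beta>] by simp
    qed (use F(1) \<alpha> in auto)
    then show ?thesis by simp
  qed
  then show ?thesis unfolding G(3) linearD(6)[OF l] by (intro subspace_sum[OF V(1)])
qed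

lemma subspace_weight_vector:
  assumes d: "diagonal d" and V: "subspace V" "\<And>v. v \<in> V \<Longrightarrow> d v \<in> V"
    and T: "Vector_Spaces.linear scale scale T" and v: "v \<in> V" "T v \<noteq> 0"
  shows "\<exists>\<beta> x. x \<in> V \<and> x \<in> weight_space d \<beta> \<and> T x \<noteq> 0"
proof -
  obtain G x where G: "finite G" "\<And>\<beta>. x \<beta> \<in> weight_space d \<beta>" "v = (\<Sum>\<beta>\<in>G. x \<beta>)"
    using diagonal_decomposition[OF d] by blast
  have "\<exists>\<beta>\<in>G. T (x \<beta>) \<noteq> 0"
  proof (rule ccontr)
    assume "\<not> ?thesis"
    then have "T v = 0" unfolding G(3) linearD(6)[OF T] by (intro sum.neutral) blast
    then show False using v(2) by blast
  qed
  then obtain \<beta> where \<beta>: "\<beta> \<in> G" "T (x \<beta>) \<noteq> 0" by blast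
  have "x \<beta> \<in> V"
  proof (rule weight_components_mem[OF diagonal_linear[OF d] V G(1,2) _ \<beta>(1)])
    show "(\<Sum>\<beta>\<in>G. x \<beta>) \<in> V" using v G(3) by simp
  qed
  then show ?thesis using \<beta> G(2) by blast
qed

lemma funpow_kernel_mult:
  assumes "derivation scale D" "D b = 0"
  shows "(D ^^ n) (b * x) = b * (D ^^ n) x"
  by (induction n) (simp_all add: derivationD(7)[OF assms(1)] assms(2))

lemma funpow_slice_power:
  assumes D: "derivation scale D" and s: "D s = scale c 1"
  shows "(D ^^ n) (s ^ n) = scale (fact n * c ^ n) 1"
proof (induction n)
  case (Suc n)
  note l = linearD[OF linear_funpow[OF derivation_linear[OF D]]]
  have "D (s ^ Suc n) = of_nat (Suc n) * (s ^ n * scale c 1)"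
    using derivation_power[OF D, of s "Suc n"] s by simp
  also have "\<dots> = scale (of_nat (Suc n) * c) (s ^ n)"
    unfolding of_nat_eq_scale by (simp flip: scale_mult_right)
  finally have "(D ^^ Suc n) (s ^ Suc n) = (D ^^ n) (scale (of_nat (Suc n) * c) (s ^ n))"
    by (simp only: funpow_Suc_right o_apply)
  then show ?case using Suc.IH by (simp add: l algebra_simps del: of_nat_Suc)
qed simp

text \<open>
  The slice theorem. Subtracting a suitable multiple of \<open>s ^ n\<close> lowers the index of nilpotency of an
  element.
\<close>

lemma LND_slice_span:
  assumes D: "D \<in> LND scale" and s: "D s = 1"
  shows "a \<in> span {k * s ^ n | k n. D k = 0}"
proof -
  note Dd = LND_D(1)[OF D] and l = linearD[OF linear_funpow[OF derivation_linear[OF LND_D(1)[OF D]]]]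
  let ?B = "{k * s ^ n | k n. D k = 0}"
  have "(D ^^ n) a = 0 \<Longrightarrow> a \<in> span ?B" for n a
  proof (induction n arbitrary: a)
    case (Suc n)
    define b where "b = scale (1 / fact n) ((D ^^ n) a)"
    have Db: "D b = 0" unfolding b_def using Suc.prems by (simp add: derivationD(2)[OF Dd])
    have sn: "(D ^^ n) (s ^ n) = scale (fact n) 1" using funpow_slice_power[OF Dd, of s 1 n] s by simp
    have "(D ^^ n) (b * s ^ n) = b * scale (fact n) 1"
      unfolding funpow_kernel_mult[OF Dd Db] sn ..
    also have "\<dots> = (D ^^ n) a" unfolding b_def by (simp add: scale_mult_scale)
    finally have "(D ^^ n) (b * s ^ n) = (D ^^ n) a" .
    then have "(D ^^ n) (a - b * s ^ n) = 0" by (simp add: l)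
    then have "a - b * s ^ n \<in> span ?B" by (rule Suc.IH)
    moreover have "b * s ^ n \<in> span ?B" using Db by (intro span_base) blast
    ultimately have "(a - b * s ^ n) + b * s ^ n \<in> span ?B" by (rule span_add)
    then show ?case by simp
  qed (simp add: span_zero)
  then show ?thesis using LND_D(2)[OF D, of a] by blast
qed

end

locale nontoric_surface = nontrivial_makar_limanov +
  assumes normal: "integrally_closed TYPE('a)"
    and no_torus: "\<not> algebra_isomorphic scale torus_algebra"
    and no_line: "\<not> algebra_isomorphic scale line_times_Cstar_algebra"
begin

lemmas commuting_proportional = commuting_diagonal_proportional[OF normal no_torus no_line]

text \<open>
  The elements of degree at most one: a locally nilpotent derivation D maps them to its kernel.
\<close>

definition K1 :: "'a set" where "K1 = {a. \<forall>D\<in>LND scale. D a \<in> K}"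

lemma subspace_K: "subspace K"
  by (rule subalgebraD(1)[OF K_subalgebra])

lemma K_K1: "K \<subseteq> K1"
  unfolding K1_def
proof (intro subsetI CollectI ballI)
  show "D k \<in> K" if "k \<in> K" "D \<in> LND scale" for k D
    unfolding LND_K[OF that(2,1)] by (rule subspace_0[OF subspace_K])
qed

lemma subspace_K1: "subspace K1"
  using subspace_K by (intro subspaceI) (auto simp: K1_def derivationD[OF LND_D(1)] subspace_add subspace_scale subspace_0)

lemma diagonal_K1:
  assumes d: "diagonal d" and a: "a \<in> K1"
  shows "d a \<in> K1"
  unfolding K1_def
proof (intro CollectI ballI)
  fix D assume D: "D \<in> LND scale"
  have "d (D a) \<in> K" "bracket d D a \<in> K"
    using diagonal_K[OF d] a D bracket_diagonal_LND[OF d D] unfolding K1_def by blast+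
  then have "d (D a) - bracket d D a \<in> K" by (rule subspace_diff[OF subspace_K])
  then show "D (d a) \<in> K" by (simp add: bracket_def)
qed

lemma slice_K1:
  assumes "D \<in> LND scale" "D s \<noteq> 0" "D (D s) = 0"
  shows "s \<in> K1"
  unfolding K1_def using LND_iff_slice[OF assms] by blast

text \<open>
  The plinth ideal of K, formed with all locally nilpotent derivations at once, so that it is stable
  under semisimple derivations.
\<close>

definition plinth :: "'a set" where
  "plinth = span {D a | D a. D \<in> LND scale \<and> a \<in> K1}"

lemma plinth_base: "D \<in> LND scale \<Longrightarrow> a \<in> K1 \<Longrightarrow> D a \<in> plinth"
  unfolding plinth_def by (intro span_base) blast

lemma subspace_plinth: "subspace plinth"
  by (simp add: plinth_def)

lemma plinth_K: "plinth \<subseteq> K"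
  unfolding plinth_def by (rule span_minimal[OF _ subspace_K]) (auto simp: K1_def)

lemma plinth_mult:
  assumes k: "k \<in> K" and p: "p \<in> plinth"
  shows "k * p \<in> plinth"
  using p[unfolded plinth_def]
proof (induction rule: span_induct_alt)
  case (step c x y)
  then obtain D a where D: "x = D a" "D \<in> LND scale" "a \<in> K1" by blast
  have "k * x \<in> plinth"
    using plinth_base[OF LND_mult_kernel[OF D(2) LND_K[OF D(2) k]] D(3)] D(1) by simp
  then have "scale c (k * x) + k * y \<in> plinth"
    using step(2) by (intro subspace_add[OF subspace_plinth] subspace_scale[OF subspace_plinth])
  then show ?case by (simp add: distrib_left scale_mult_right)
qed (simp add: subspace_0[OF subspace_plinth])

lemma diagonal_plinth:
  assumes d: "diagonal d" and p: "p \<in> plinth"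
  shows "d p \<in> plinth"
  using p[unfolded plinth_def]
proof (induction rule: span_induct_alt)
  case base
  then show ?case using subspace_0[OF subspace_plinth] derivationD(3)[OF diagonal_derivation[OF d]] by simp
next
  case (step c x y)
  then obtain D a where D: "x = D a" "D \<in> LND scale" "a \<in> K1" by blast
  have "D (d a) + bracket d D a \<in> plinth"
    using plinth_base[OF D(2) diagonal_K1[OF d D(3)]] plinth_base[OF bracket_diagonal_LND[OF d D(2)] D(3)]
    by (rule subspace_add[OF subspace_plinth])
  then have "d x \<in> plinth" unfolding D(1) bracket_def by simp
  then have "scale c (d x) + d y \<in> plinth"
    using step(2) by (intro subspace_add[OF subspace_plinth] subspace_scale[OF subspace_plinth])
  then show ?case by (simp add: derivationD[OF diagonal_derivation[OF d]])
qed

text \<open>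
  The plinth ideal is generated by the values \<open>D a\<close> with D and a homogeneous. If it contained 1, one of
  these values would have weight zero and be a nonzero constant, because K has only constants in weight
  zero if d is not zero on K. This gives a homogeneous slice s of D, and \<open>s D\<close> is semisimple and commutes
  with d. But \<open>s D\<close> vanishes on K and is not zero, so the two are not proportional.
\<close>

lemma one_notin_plinth:
  assumes d: "diagonal d" and x: "x \<in> K" "d x \<noteq> 0"
  shows "1 \<notin> plinth"
proof
  assume one: "1 \<in> plinth"
  note dd = diagonal_derivation[OF d] and dl = diagonal_linear[OF d]
  obtain D0 b where D0: "D0 \<in> LND scale" "D0 b \<noteq> 0"
  proof (cases rule: LND_cases)
    case 1
    have "{D a | D a. D \<in> LND scale \<and> a \<in> K1} \<subseteq> {0}" using fun_cong[OF 1] by blast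
    then have "plinth \<subseteq> {0}" unfolding plinth_def by (intro span_minimal) (auto simp: subspace_def)
    then show ?thesis using one by auto
  qed (use that in blast)
  have const: "z \<in> range (\<lambda>c. scale c 1)" if z: "z \<in> K" "d z = 0" for z
  proof (rule ccontr)
    assume nc: "z \<notin> range (\<lambda>c. scale c 1)"
    have "algebraic_over (K \<inter> {a. d a = 0}) x"
      by (rule algebraic_over_in_K[OF D0 subalgebra_Int[OF K_subalgebra kernel_subalgebra[OF dd]] _ _ nc x(1)])
        (use z in auto)
    then have "d x = 0" by (rule derivation_eq_0_if_algebraic[OF dd, rotated]) simp
    then show False using x(2) by simp
  qed
  define B where "B = {D a | D a \<alpha> \<beta>. D \<in> LND scale \<and> homogeneous d \<alpha> D \<and> a \<in> K1 \<and> a \<in> weight_space d \<beta>}"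
  have "D a \<in> span B" if D: "D \<in> LND scale" and a: "a \<in> K1" for D a
  proof -
    obtain F Dc where F': "finite F" "\<forall>\<alpha>. homogeneous d \<alpha> (Dc \<alpha>)" "\<forall>a. D a = (\<Sum>\<alpha>\<in>F. Dc \<alpha> a)"
      "\<forall>\<alpha>. Dc \<alpha> \<in> LND scale" using LND_decomposition[OF d D] by (elim exE conjE) (rule that)
    note F = F'[rule_format]
    obtain G y where G: "finite G" "\<And>\<beta>. y \<beta> \<in> weight_space d \<beta>" "a = (\<Sum>\<beta>\<in>G. y \<beta>)"
      using diagonal_decomposition[OF d] by blast
    have yK: "y \<beta> \<in> K1" if "\<beta> \<in> G" for \<beta>
      by (rule weight_components_mem[OF dl subspace_K1 diagonal_K1[OF d] G(1,2) _ that]) (use a G(3) in simp_all)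
    have "Dc \<alpha> (y \<beta>) \<in> span B" if "\<beta> \<in> G" for \<alpha> \<beta>
      unfolding B_def using F(2,4) yK[OF that] G(2) by (intro span_base) blast
    then have "(\<Sum>\<alpha>\<in>F. \<Sum>\<beta>\<in>G. Dc \<alpha> (y \<beta>)) \<in> span B" by (intro span_sum)
    moreover have "D a = (\<Sum>\<alpha>\<in>F. \<Sum>\<beta>\<in>G. Dc \<alpha> (y \<beta>))"
      unfolding F(3) G(3) by (intro sum.cong refl derivationD(6)[OF LND_D(1)[OF F(4)]])
    ultimately show ?thesis by simp
  qed
  then have "plinth \<subseteq> span B" unfolding plinth_def by (intro span_minimal) auto
  with one have oneB: "1 \<in> span B" by blast
  have "\<exists>D a \<alpha>. D \<in> LND scale \<and> homogeneous d \<alpha> D \<and> a \<in> K1 \<and> a \<in> weight_space d (- \<alpha>) \<and> D a \<noteq> 0"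
  proof (rule ccontr)
    assume neg: "\<not> ?thesis"
    have "B \<subseteq> weights_in d (- {0})"
    proof
      fix z assume "z \<in> B"
      then obtain D a \<alpha> \<beta> where z: "z = D a" "D \<in> LND scale" "homogeneous d \<alpha> D" "a \<in> K1" "a \<in> weight_space d \<beta>"
        unfolding B_def by blast
      have zw: "z \<in> weight_space d (\<beta> + \<alpha>)" unfolding z(1) by (rule homogeneous_weight_space[OF z(3,5)])
      show "z \<in> weights_in d (- {0})"
      proof (cases "\<beta> + \<alpha> = 0")
        case True
        then have "\<beta> = - \<alpha>" by (simp add: eq_neg_iff_add_eq_0)
        then have "z = 0" using neg z by blast
        then show ?thesis by (simp add: weights_in_def span_zero)
      next
        case False
        then show ?thesis using weights_in_base[OF _ zw] by simp
      qed
    qed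
    then have "span B \<subseteq> weights_in d (- {0})" unfolding weights_in_def by (simp add: span_minimal)
    then have "1 \<in> weights_in d (- {0})" using oneB by blast
    then have "0 \<in> - {0::complex}"
      using weight_in_weights_in[OF dd, of 1 "- {0}" 0] constant_weight_space[OF dd, of 1] by simp
    then show False by simp
  qed
  then obtain D a \<alpha> where D: "D \<in> LND scale" "homogeneous d \<alpha> D" "a \<in> K1" "a \<in> weight_space d (- \<alpha>)" "D a \<noteq> 0"
    by blast
  have "D a \<in> weight_space d 0" using homogeneous_weight_space[OF D(2,4)] by simp
  moreover have "D a \<in> K" using D(1,3) unfolding K1_def by blast
  ultimately obtain c where c: "D a = scale c 1" using const[of "D a"] by (auto simp: weight_space_def)
  have "c \<noteq> 0" using c D(5) by auto
  define s where "s = scale (1 / c) a"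
  have Ds: "D s = 1" unfolding s_def using c \<open>c \<noteq> 0\<close> by (simp add: derivationD(2)[OF LND_D(1)[OF D(1)]])
  have sw: "s \<in> weight_space d (- \<alpha>)" unfolding s_def by (rule subspace_scale[OF subspace_weight_space[OF dl] D(4)])
  define e where "e z = s * D z" for z
  have ed: "derivation scale e" unfolding e_def by (rule derivation_mult[OF LND_D(1)[OF D(1)]])
  have "{k * s ^ n | k n. D k = 0} \<subseteq> (\<Union>\<gamma>. weight_space e \<gamma>)"
  proof
    fix z assume "z \<in> {k * s ^ n | k n. D k = 0}"
    then obtain k n where z: "z = k * s ^ n" "D k = 0" by blast
    have "k \<in> weight_space e 0" using z(2) by (simp add: weight_space_def e_def)
    moreover have "s \<in> weight_space e 1" using Ds by (simp add: weight_space_def e_def)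
    ultimately have "z \<in> weight_space e (0 + of_nat n * 1)"
      unfolding z(1) by (intro weight_space_mult[OF ed] weight_space_power[OF ed])
    then show "z \<in> (\<Union>\<gamma>. weight_space e \<gamma>)" by blast
  qed
  then have "span {k * s ^ n | k n. D k = 0} \<subseteq> span (\<Union>\<gamma>. weight_space e \<gamma>)" by (rule span_mono)
  then have e: "diagonal e" unfolding diagonal_def using ed LND_slice_span[OF D(1) Ds] by blast
  have comm: "d (e z) = e (d z)" for z
  proof -
    have "d (D z) = D (d z) + scale \<alpha> (D z)" using D(2) by (simp add: homogeneous_def)
    moreover have "d s = - scale \<alpha> s" using sw by (simp add: weight_space_def)
    ultimately show ?thesis unfolding e_def
      by (simp add: derivationD(7)[OF dd] distrib_left scale_mult_left[symmetric] scale_mult_right[symmetric])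
  qed
  obtain c' where c': "\<forall>z. e z = scale c' (d z)" using commuting_proportional[OF d e comm x(2)] by blast
  have "e x = 0" unfolding e_def using LND_K[OF D(1) x(1)] by simp
  then have "c' = 0" using c' x(2) by simp
  then have "e s = 0" using c' by simp
  then have "s = 0" unfolding e_def using Ds by simp
  then show False using Ds derivationD(3)[OF LND_D(1)[OF D(1)]] by simp
qed

text \<open>
  Otherwise there is an eigenvector x in K for which \<open>W x\<close> is a nonzero constant, since the kernel of W
  on K consists of constants. Then x has weight -r. Let p be a homogeneous element of the plinth ideal.
  By comparing the weights of x and p, either a power of x is a multiple of a power of p, hence in the
  plinth ideal, or a product of such powers is a constant in the plinth ideal. In the first case, W maps
  the power \<open>x ^ m\<close> in m steps to a nonzero constant in the plinth ideal. In both cases the plinth ideal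
  contains 1.
\<close>

lemma homogeneous_vanishes_on_K:
  assumes d: "diagonal d" and int: "weights d \<subseteq> \<int>" and LND: "D0 \<in> LND scale" "D0 b \<noteq> 0"
    and W: "homogeneous d r W" "r \<noteq> 0" "\<And>k. k \<in> K \<Longrightarrow> W k \<in> K" "\<And>p. p \<in> plinth \<Longrightarrow> W p \<in> plinth"
    and nil: "\<And>k \<beta>. k \<in> K \<Longrightarrow> k \<in> weight_space d \<beta> \<Longrightarrow> \<exists>n. (W ^^ n) k = 0"
    and k: "k \<in> K"
  shows "W k = 0"
proof (rule ccontr)
  assume Wk: "W k \<noteq> 0"
  note dd = diagonal_derivation[OF d] and dl = diagonal_linear[OF d]
  have Wd: "derivation scale W" using W(1) by (simp add: homogeneous_def)
  note Wl = derivation_linear[OF Wd]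
  obtain \<beta> a where a: "a \<in> K" "a \<in> weight_space d \<beta>" "W a \<noteq> 0"
    using subspace_weight_vector[OF d subspace_K diagonal_K[OF d] Wl k Wk] by blast
  have pw: "(W ^^ n) a \<in> K \<and> (W ^^ n) a \<in> weight_space d (\<beta> + of_nat n * r)" for n
  proof (induction n)
    case (Suc n)
    then have "W ((W ^^ n) a) \<in> K" "W ((W ^^ n) a) \<in> weight_space d (\<beta> + of_nat n * r + r)"
      using W(3) homogeneous_weight_space[OF W(1)] by blast+
    then show ?case by (simp add: algebra_simps)
  qed (use a in simp)
  obtain N where N: "(W ^^ N) a = 0" using nil[OF a(1,2)] by blast
  have "\<exists>n. W ((W ^^ n) a) \<noteq> 0 \<and> W (W ((W ^^ n) a)) = 0"
  proof -
    have "(W ^^ Suc N) a = 0" using N linearD(3)[OF Wl] by simp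
    moreover have "(W ^^ Suc 0) a \<noteq> 0" using a(3) by simp
    ultimately obtain m where "(W ^^ Suc m) a \<noteq> 0" "(W ^^ Suc (Suc m)) a = 0"
      using ex_least_nat_less[of "\<lambda>n. (W ^^ Suc n) a = 0" N] by auto
    then show ?thesis by auto
  qed
  then obtain n where n: "W ((W ^^ n) a) \<noteq> 0" "W (W ((W ^^ n) a)) = 0" by blast
  define x where "x = (W ^^ n) a"
  define \<xi> where "\<xi> = \<beta> + of_nat n * r"
  have x: "x \<in> K" "x \<in> weight_space d \<xi>" "W x \<noteq> 0" "W (W x) = 0"
    using pw[of n] n unfolding x_def \<xi>_def by auto
  have alg: "algebraic_over R y"
    if "subalgebra scale R" "R \<subseteq> K" "z \<in> R" "z \<notin> range (\<lambda>c. scale c 1)" "y \<in> K" for R y z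
    using algebraic_over_in_K[OF LND that] .
  have "W x \<in> range (\<lambda>c. scale c 1)"
  proof (rule ccontr)
    assume nc: "W x \<notin> range (\<lambda>c. scale c 1)"
    have "algebraic_over (K \<inter> {a. W a = 0}) x"
      by (rule alg[OF subalgebra_Int[OF K_subalgebra kernel_subalgebra[OF Wd]] _ _ nc x(1)])
        (use W(3) x in auto)
    then have "W x = 0" by (rule derivation_eq_0_if_algebraic[OF Wd, rotated]) simp
    then show False using x(3) by simp
  qed
  then obtain c where c: "W x = scale c 1" by blast
  have c0: "c \<noteq> 0" using c x(3) by auto
  have "W x \<in> weight_space d (\<xi> + r)" by (rule homogeneous_weight_space[OF W(1) x(2)])
  then have "scale (\<xi> + r) (W x) = 0" using c derivationD(9)[OF dd, of c] by (simp add: weight_space_def)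
  then have \<xi>: "\<xi> = - r" using x(3) by (simp add: eq_neg_iff_add_eq_0)
  have x0: "x \<noteq> 0" using x(3) linearD(3)[OF Wl] by auto
  have dx: "d x \<noteq> 0" using x(2) \<xi> W(2) x0 by (simp add: weight_space_def)
  have "\<xi> \<in> \<int>" using int x(2) x0 unfolding weights_def by blast
  then obtain i :: int where i: "\<xi> = of_int i" by (elim Ints_cases)
  have i0: "i \<noteq> 0" using i \<xi> W(2) by auto
  have const: "\<exists>c. z = scale c 1" if z: "z \<in> K" "z \<in> weight_space d 0" for z
  proof (rule ccontr)
    assume "\<not> ?thesis"
    then have nc: "z \<notin> range (\<lambda>c. scale c 1)" by blast
    have "algebraic_over (K \<inter> {a. d a = 0}) x"
      by (rule alg[OF subalgebra_Int[OF K_subalgebra kernel_subalgebra[OF dd]] _ _ nc x(1)])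
        (use z in \<open>auto simp: weight_space_def\<close>)
    then have "d x = 0" by (rule derivation_eq_0_if_algebraic[OF dd, rotated]) simp
    then show False using dx by simp
  qed
  obtain D1 s where D1: "D1 \<in> LND scale" "D1 s \<noteq> 0" "D1 (D1 s) = 0" using LND_local_slice[OF LND] LND(1) by blast
  have "D1 s \<in> plinth" by (rule plinth_base[OF D1(1) slice_K1[OF D1]])
  then obtain \<gamma> p where p: "p \<in> plinth" "p \<in> weight_space d \<gamma>" "p \<noteq> 0"
    using subspace_weight_vector[OF d subspace_plinth diagonal_plinth[OF d] linear_id, of "D1 s"] D1(2) by (auto simp: id_def)
  have pK: "p \<in> K" using p(1) plinth_K by blast
  have "\<gamma> \<in> \<int>" using int p(2,3) unfolding weights_def by blast
  then obtain j :: int where j: "\<gamma> = of_int j" by (elim Ints_cases)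
  have one_if: "1 \<in> plinth" if "scale c' 1 \<in> plinth" "c' \<noteq> 0" for c'
    using subspace_scale[OF subspace_plinth that(1), of "1 / c'"] that(2) by simp
  have pow_plinth: "p ^ Suc m \<in> plinth" for m
    using plinth_mult[OF subalgebraD(9)[OF K_subalgebra pK] p(1), of m] by (simp add: mult.commute)
  define m l where "m = nat \<bar>j\<bar>" and "l = nat \<bar>i\<bar>"
  have l0: "l > 0" unfolding l_def using i0 by simp
  then have pl: "p ^ l \<in> plinth" using pow_plinth[of "l - 1"] by simp
  have xm: "x ^ m \<in> weight_space d (of_nat m * \<xi>)" and pw': "p ^ l \<in> weight_space d (of_nat l * \<gamma>)"
    using weight_space_power[OF dd x(2)] weight_space_power[OF dd p(2)] by blast+
  have xmK: "x ^ m \<in> K" by (rule subalgebraD(9)[OF K_subalgebra x(1)])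
  have "1 \<in> plinth"
  proof (cases "i * j > 0")
    case True
    have "of_nat m * \<xi> = of_nat l * \<gamma>"
    proof -
      have "int m * i = int l * j" unfolding m_def l_def using True by (auto simp: zero_less_mult_iff)
      then have "(of_int (int m * i) :: complex) = of_int (int l * j)" by (simp only:)
      then show ?thesis unfolding i j by simp
    qed
    with xm have xm': "x ^ m \<in> weight_space d (of_nat l * \<gamma>)" by simp
    have lg: "of_nat l * \<gamma> \<noteq> 0" using l0 True unfolding j by auto
    have "algebraic_over (complex_poly_values (p ^ l)) (x ^ m)"
    proof (rule alg[OF complex_poly_values_subalgebra _ _ _ xmK, of _ "p ^ l"])
      show "complex_poly_values (p ^ l) \<subseteq> K"
      proof
        fix u assume "u \<in> complex_poly_values (p ^ l)"
        then obtain q where u: "u = poly (map_poly (\<lambda>c. scale c 1) q) (p ^ l)" unfolding complex_poly_values_def by blast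
        show "u \<in> K" unfolding u
          by (rule poly_in_subalgebra[OF K_subalgebra _ subalgebraD(9)[OF K_subalgebra pK]])
            (simp add: coeff_map_poly subalgebraD(4)[OF K_subalgebra])
      qed
      show "p ^ l \<in> complex_poly_values (p ^ l)"
        unfolding complex_poly_values_def by (rule range_eqI[of _ _ "[:0, 1:]"]) (simp add: map_poly_pCons)
      show "p ^ l \<notin> range (\<lambda>c. scale c 1)"
      proof
        assume "p ^ l \<in> range (\<lambda>c. scale c 1)"
        then obtain c'' where "p ^ l = scale c'' 1" by blast
        then have "d (p ^ l) = 0" by (simp only: derivationD(9)[OF dd])
        then show False using pw' lg p(3) by (simp add: weight_space_def)
      qed
    qed
    then obtain c' where "x ^ m = scale c' (p ^ l)"
      using same_weight_proportional[OF dd pw' _ xm' lg] p(3) by auto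
    then have "x ^ m \<in> plinth" using subspace_scale[OF subspace_plinth pl] by simp
    then have "(W ^^ q) (x ^ m) \<in> plinth" for q by (induction q) (simp_all add: W(4))
    then have "scale (fact m * c ^ m) 1 \<in> plinth" using funpow_slice_power[OF Wd c, of m] by metis
    then show ?thesis using one_if c0 by simp
  next
    case False
    have "of_nat m * \<xi> + of_nat l * \<gamma> = 0"
    proof -
      have "int m * i + int l * j = 0"
        unfolding m_def l_def using False i0 by (auto simp: zero_less_mult_iff not_less)
      then have "(of_int (int m * i + int l * j) :: complex) = 0" by (simp only: of_int_0)
      then show ?thesis unfolding i j by simp
    qed
    then have "x ^ m * p ^ l \<in> weight_space d 0" using weight_space_mult[OF dd xm pw'] by simp
    moreover have xp: "x ^ m * p ^ l \<in> plinth" by (rule plinth_mult[OF xmK pl])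
    ultimately obtain c' where c': "x ^ m * p ^ l = scale c' 1" using const plinth_K by blast
    have "c' \<noteq> 0" using c' x0 p(3) by auto
    then show ?thesis using one_if xp c' by simp
  qed
  then show False using one_notin_plinth[OF d x(1) dx] by blast
qed

text \<open>
  Among the components of nonzero weight that are not locally nilpotent, let W be the one whose weight r
  is extremal, of absolute value as large as possible in its direction. The components beyond W are
  locally nilpotent, so they vanish on K and map K1 to K. Therefore W is nilpotent on K, hence zero on
  K, and it is nilpotent on K1 modulo K. For a homogeneous local slice s of a derivation E, the commutator
  of W and E is a multiple of E by a fraction with numerator \<open>\<tau>\<close>. If \<open>\<tau>\<close> is not zero, then no iterate of
  W maps s to K. So \<open>\<tau>\<close> is zero, which means that W maps s to K and is locally nilpotent.
\<close>

lemma diagonal_component_LND: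
  assumes d: "diagonal d" and int: "weights d \<subseteq> \<int>" and T: "diagonal T"
    and F: "finite F" "\<And>\<alpha>. homogeneous d \<alpha> (Tc \<alpha>)" "\<And>a. T a = (\<Sum>\<alpha>\<in>F. Tc \<alpha> a)"
    and \<alpha>: "\<alpha> \<in> F" "\<alpha> \<noteq> 0"
  shows "Tc \<alpha> \<in> LND scale"
proof (rule ccontr)
  assume n\<alpha>: "Tc \<alpha> \<notin> LND scale"
  note dd = diagonal_derivation[OF d] and dl = diagonal_linear[OF d]
  define Z where "Z = {\<alpha>\<in>F. \<alpha> \<noteq> 0 \<and> Tc \<alpha> \<notin> LND scale}"
  have Tcd: "derivation scale (Tc \<alpha>)" for \<alpha> using F(2)[of \<alpha>] by (simp add: homogeneous_def)
  have Zint: "\<alpha> \<in> \<int>" if "\<alpha> \<in> Z" for \<alpha>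
  proof -
    have "Tc \<alpha> \<noteq> (\<lambda>a. 0)" using that zero_LND unfolding Z_def by auto
    then obtain a where "Tc \<alpha> a \<noteq> 0" by (auto simp: fun_eq_iff)
    then obtain \<beta> x where x: "x \<in> weight_space d \<beta>" "Tc \<alpha> x \<noteq> 0"
      using subspace_weight_vector[OF d subspace_UNIV _ derivation_linear[OF Tcd], of a] by blast
    then have "x \<noteq> 0" using derivationD(3)[OF Tcd] by auto
    then have "\<beta> \<in> \<int>" "\<beta> + \<alpha> \<in> \<int>"
      using int x homogeneous_weight_space[OF F(2) x(1)] unfolding weights_def by blast+
    then show ?thesis using Ints_diff[of "\<beta> + \<alpha>" \<beta>] by simp
  qed
  have "\<exists>\<phi>::complex \<Rightarrow> real. (\<forall>x y. \<phi> (x + y) = \<phi> x + \<phi> y) \<and> (\<exists>\<alpha>\<in>Z. \<phi> \<alpha> > 0)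
      \<and> (\<forall>\<alpha>\<in>Z. \<forall>\<beta>\<in>Z. \<phi> \<alpha> = \<phi> \<beta> \<longrightarrow> \<alpha> = \<beta>)"
  proof -
    \<comment> \<open>the real part or its negative, according to the sign of the weight\<close>
    have aZ: "\<alpha> \<in> Z" unfolding Z_def using \<alpha> n\<alpha> by blast
    have inj: "\<beta> = \<gamma>" if bg: "\<beta> \<in> Z" "\<gamma> \<in> Z" "Re \<beta> = Re \<gamma>" for \<beta> \<gamma>
    proof -
      obtain k k' :: int where "\<beta> = of_int k" "\<gamma> = of_int k'" using Zint bg(1,2) by (metis Ints_cases)
      then show ?thesis using bg(3) by simp
    qed
    have "Re \<alpha> \<noteq> 0"
    proof
      assume "Re \<alpha> = 0"
      obtain k :: int where "\<alpha> = of_int k" using Zint[OF aZ] by (elim Ints_cases)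
      then show False using \<open>Re \<alpha> = 0\<close> \<alpha>(2) by simp
    qed
    then consider "Re \<alpha> > 0" | "- Re \<alpha> > 0" by linarith
    then show ?thesis
    proof cases
      case 1
      then show ?thesis using aZ inj by (intro exI[of _ Re]) auto
    next
      case 2
      then show ?thesis using aZ inj by (intro exI[of _ "\<lambda>x. - Re x"]) auto
    qed
  qed
  then obtain \<phi> :: "complex \<Rightarrow> real" where \<phi>: "\<And>x y. \<phi> (x + y) = \<phi> x + \<phi> y" "\<exists>\<alpha>\<in>Z. \<phi> \<alpha> > 0"
    "\<And>\<alpha> \<beta>. \<alpha> \<in> Z \<Longrightarrow> \<beta> \<in> Z \<Longrightarrow> \<phi> \<alpha> = \<phi> \<beta> \<Longrightarrow> \<alpha> = \<beta>" by blast
  have \<phi>0: "\<phi> 0 = 0" using \<phi>(1)[of 0 0] by simp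
  have finZ: "finite Z" "Z \<noteq> {}" unfolding Z_def using F(1) \<alpha> n\<alpha> by auto
  then have "Max (\<phi> ` Z) \<in> \<phi> ` Z" by simp
  then obtain r where r: "r \<in> Z" "\<phi> r = Max (\<phi> ` Z)" by auto
  have r_max: "\<phi> \<beta> \<le> \<phi> r" if "\<beta> \<in> Z" for \<beta> unfolding r(2) using that finZ by simp
  then have r_pos: "\<phi> r > 0" using \<phi>(2) by force
  define W where "W = Tc r"
  have W: "r \<in> F" "r \<noteq> 0" "W \<notin> LND scale" using r(1) unfolding Z_def W_def by auto
  have Wh: "homogeneous d r W" unfolding W_def by (rule F(2))
  note Wd = Tcd[of r, folded W_def]
  have other: "\<phi> \<beta> < \<phi> r \<or> Tc \<beta> \<in> LND scale" if "\<beta> \<in> F" "\<beta> \<noteq> r" for \<beta>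
  proof (cases "\<beta> \<in> Z")
    case True
    then have "\<phi> \<beta> \<noteq> \<phi> r" using \<phi>(3) r(1) that(2) by blast
    then show ?thesis using r_max[OF True] by simp
  next
    case False
    then show ?thesis using that(1) r_pos \<phi>0 unfolding Z_def by auto
  qed
  \<comment> \<open>used below for the algebra modulo zero, for K modulo zero and for K1 modulo K\<close>
  have nilp: "\<exists>n. (W ^^ n) a \<in> U"
    if V: "subspace V" "\<And>v. v \<in> V \<Longrightarrow> d v \<in> V" "\<And>v. v \<in> V \<Longrightarrow> T v \<in> V"
      and U: "subspace U" "\<And>v. v \<in> U \<Longrightarrow> d v \<in> U" "\<And>v. v \<in> U \<Longrightarrow> T v \<in> U" "U \<subseteq> V"
      and LND: "\<And>D v. D \<in> LND scale \<Longrightarrow> v \<in> V \<Longrightarrow> D v \<in> U"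
      and a: "a \<in> V" "a \<in> weight_space d \<beta>" for U V a \<beta>
  proof -
    obtain N c where rec: "(T ^^ N) a = (\<Sum>j<N. scale (c j) ((T ^^ j) a))"
      by (rule diagonal_locally_finite[OF T])
    have "(Tc r ^^ N) a \<in> U"
    proof (rule extremal_component_nilpotent[OF dl V(1) U(1,4,2) F(1) W(1) F(3), where \<phi> = \<phi>])
      show "Vector_Spaces.linear scale scale (Tc \<alpha>)" for \<alpha> by (rule derivation_linear[OF Tcd])
      show "d (Tc \<alpha> a) = Tc \<alpha> (d a) + scale \<alpha> (Tc \<alpha> a)" for \<alpha> a
        using F(2)[of \<alpha>] by (simp add: homogeneous_def)
      show "Tc \<alpha> v \<in> V" if "\<alpha> \<in> F" "v \<in> V" for \<alpha> v
        by (rule component_stable[OF d V F that])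
      show "Tc \<alpha> v \<in> U" if "\<alpha> \<in> F" "v \<in> U" for \<alpha> v
        by (rule component_stable[OF d U(1-3) F that])
      show "\<phi> \<alpha> < \<phi> r \<or> (\<forall>v\<in>V. Tc \<alpha> v \<in> U)" if "\<alpha> \<in> F" "\<alpha> \<noteq> r" for \<alpha>
        using other[OF that] LND by blast
      show "\<phi> r > 0 \<or> (\<forall>j<N. c j = 0)" using r_pos by blast
    qed (use \<phi>(1) a rec in auto)
    then show ?thesis unfolding W_def by blast
  qed
  have zero: "subspace {0}" "\<And>v. v \<in> {0} \<Longrightarrow> d v \<in> {0}" "\<And>v. v \<in> {0} \<Longrightarrow> T v \<in> {0}"
    using derivationD(3)[OF dd] derivationD(3)[OF diagonal_derivation[OF T]] by (auto simp: subspace_def)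
  show False
  proof (cases rule: LND_cases)
    case 1
    have D0: "D v \<in> {0}" if "D \<in> LND scale" for D v using fun_cong[OF 1[OF that], of v] by simp
    have "W \<in> LND scale"
    proof (rule LND_iff_nilpotent_on_spanning_set[OF Wd])
      show "span (\<Union>\<alpha>. weight_space d \<alpha>) = UNIV" using d by (simp add: diagonal_def)
      fix a assume "a \<in> (\<Union>\<alpha>. weight_space d \<alpha>)"
      then obtain \<beta> where "a \<in> weight_space d \<beta>" by blast
      then have "\<exists>n. (W ^^ n) a \<in> {0}" using D0 by (intro nilp[of UNIV "{0}" a \<beta>] zero) auto
      then show "\<exists>n. (W ^^ n) a = 0" by simp
    qed
    then show False using W(3) by blast
  next
    case (2 D0 b)
    have WK: "W k = 0" if "k \<in> K" for k
    proof (rule homogeneous_vanishes_on_K[OF d int 2(1,2) Wh W(2) _ _ _ that])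
      show "W k \<in> K" if "k \<in> K" for k unfolding W_def
        by (rule component_stable[OF d subspace_K diagonal_K[OF d] diagonal_K[OF T] F W(1) that])
      show "W p \<in> plinth" if "p \<in> plinth" for p unfolding W_def
        by (rule component_stable[OF d subspace_plinth diagonal_plinth[OF d] diagonal_plinth[OF T] F W(1) that])
      show "\<exists>n. (W ^^ n) k = 0" if "k \<in> K" "k \<in> weight_space d \<beta>" for k \<beta>
      proof -
        have "\<exists>n. (W ^^ n) k \<in> {0}"
          by (rule nilp[OF subspace_K diagonal_K[OF d] diagonal_K[OF T] zero _ _ that])
            (use LND_K subspace_0[OF subspace_K] in auto)
        then show ?thesis by simp
      qed
    qed
    obtain g E c where E: "E \<in> LND scale" "homogeneous d g E" "E c \<noteq> 0"
      using homogeneous_LND_exists[OF d 2(1,2)] by blast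
    obtain \<beta> a where a: "a \<in> weight_space d \<beta>" "E a \<noteq> 0"
      using subspace_weight_vector[OF d subspace_UNIV _ derivation_linear[OF LND_D(1)[OF E(1)]], of c] E(3) by blast
    obtain m where m: "(E ^^ m) (E a) \<noteq> 0" "(E ^^ Suc m) (E a) = 0"
      by (rule LND_last_nonzero[OF E(1) a(2)])
    define s where "s = (E ^^ m) a"
    have s: "E s \<noteq> 0" "E (E s) = 0" using m unfolding s_def by (simp_all add: funpow_swap1)
    have "(E ^^ m) a \<in> weight_space d (\<beta> + of_nat m * g)" for m
    proof (induction m)
      case (Suc m)
      then have "E ((E ^^ m) a) \<in> weight_space d (\<beta> + of_nat m * g + g)"
        by (rule homogeneous_weight_space[OF E(2)])
      then show ?case by (simp add: algebra_simps)
    qed (use a in simp)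
    then have sw: "s \<in> weight_space d (\<beta> + of_nat m * g)" unfolding s_def .
    note tK = slice_derivative_K[OF E(1) s] and sK1 = slice_K1[OF E(1) s]
    have WK1: "W v \<in> K1" if "v \<in> K1" for v unfolding W_def
      by (rule component_stable[OF d subspace_K1 diagonal_K1[OF d] diagonal_K1[OF T] F W(1) that])
    have EK: "E v \<in> K" if "v \<in> K1" for v using that E(1) unfolding K1_def by blast
    define \<tau> where "\<tau> = bracket W E s"
    have \<tau>: "\<tau> = - E (W s)" unfolding \<tau>_def bracket_def using WK[OF tK] by simp
    have prp: "E s * bracket W E v = \<tau> * E v" for v
      unfolding \<tau>_def
    proof (rule derivation_proportional[OF E(1) s])
      show "derivation scale (bracket W E)" by (rule derivation_bracket[OF Wd LND_D(1)[OF E(1)]])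
      show "bracket W E k = 0" if "k \<in> K" for k
        unfolding bracket_def using LND_K[OF E(1) that] WK[OF that] derivationD(3)[OF Wd] derivationD(3)[OF LND_D(1)[OF E(1)]] by simp
      show "bracket W E s \<in> K" unfolding \<tau>_def[symmetric] \<tau> using EK[OF WK1[OF sK1]] by (rule subspace_neg[OF subspace_K])
    qed
    have "E (W s) = 0"
    proof (rule ccontr)
      assume "E (W s) \<noteq> 0"
      then have \<tau>0: "\<tau> \<noteq> 0" using \<tau> by simp
      have st: "(W ^^ n) s \<in> K1 \<and> E ((W ^^ n) s) \<noteq> 0" for n
      proof (induction n)
        case (Suc n)
        let ?v = "(W ^^ n) s"
        have "bracket W E ?v = - E (W ?v)" unfolding bracket_def using WK[OF EK[of ?v]] Suc by simp
        then have "E s * E (W ?v) = - (\<tau> * E ?v)" using prp[of ?v] by (simp add: minus_equation_iff)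
        then have "E (W ?v) \<noteq> 0" using \<tau>0 Suc by auto
        then show ?case using WK1 Suc by simp
      qed (use sK1 s in simp)
      have "\<exists>n. (W ^^ n) s \<in> K"
      proof (rule nilp[OF subspace_K1 diagonal_K1[OF d] diagonal_K1[OF T] subspace_K diagonal_K[OF d] diagonal_K[OF T] K_K1 _ sK1 sw])
        show "D v \<in> K" if "D \<in> LND scale" "v \<in> K1" for D v using that unfolding K1_def by blast
      qed
      then show False using st LND_K[OF E(1)] by blast
    qed
    then have "W s \<in> K" by (rule kernel_LND[OF E(1,3)])
    then have "W \<in> LND scale" using LND_iff_slice[OF E(1) s] Wd WK by blast
    then show False using W(3) by blast
  qed
qed

end

section \<open>Conjugation by exponentials\<close>

context complex_domain begin

lemma lnd_exp_eq_sum: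
  assumes "Vector_Spaces.linear scale scale D" "(D ^^ n) a = 0"
  shows "lnd_exp scale D a = (\<Sum>i<n. scale (1 / fact i) ((D ^^ i) a))"
  unfolding lnd_exp_def
proof (rule Sum_any.expand_superset)
  show "{i. scale (1 / fact i) ((D ^^ i) a) \<noteq> 0} \<subseteq> {..<n}"
    using funpow_eq_0_mono[OF assms] by (auto simp: not_less[symmetric])
qed simp

lemma LND_uminus: "D \<in> LND scale \<Longrightarrow> (\<lambda>x. - D x) \<in> LND scale"
proof -
  assume D: "D \<in> LND scale"
  have "(\<lambda>x. (- 1) * D x) \<in> LND scale"
    by (rule LND_mult_kernel[OF D]) (simp add: derivationD[OF LND_D(1)[OF D]])
  then show ?thesis by simp
qed

lemma funpow_uminus:
  assumes "Vector_Spaces.linear scale scale D"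
  shows "((\<lambda>x. - D x) ^^ n) a = scale ((- 1) ^ n) ((D ^^ n) a)"
  by (induction n) (simp_all add: linearD[OF assms])

lemma lnd_exp_linear:
  assumes D: "D \<in> LND scale"
  shows "Vector_Spaces.linear scale scale (lnd_exp scale D)"
proof (rule linearI)
  note l = derivation_linear[OF LND_D(1)[OF D]]
  note ln = linearD[OF linear_funpow[OF l]]
  fix x y c
  obtain n m where n: "(D ^^ n) x = 0" and m: "(D ^^ m) y = 0" using LND_D(2)[OF D] by meson
  have x: "(D ^^ max n m) x = 0" by (rule funpow_eq_0_mono[OF l n]) simp
  have y: "(D ^^ max n m) y = 0" by (rule funpow_eq_0_mono[OF l m]) simp
  have xy: "(D ^^ max n m) (x + y) = 0" using x y by (simp add: ln)
  show "lnd_exp scale D (x + y) = lnd_exp scale D x + lnd_exp scale D y"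
    unfolding lnd_exp_eq_sum[OF l x] lnd_exp_eq_sum[OF l y] lnd_exp_eq_sum[OF l xy]
    by (simp add: ln scale_right_distrib sum.distrib)
  have cx: "(D ^^ n) (scale c x) = 0" using n by (simp add: ln)
  show "lnd_exp scale D (scale c x) = scale c (lnd_exp scale D x)"
    unfolding lnd_exp_eq_sum[OF l n] lnd_exp_eq_sum[OF l cx]
    by (simp add: ln scale_sum_right mult.commute)
qed

text \<open>
  The coefficient of \<open>(D ^^ k) a\<close> in the product of the two exponential series is an alternating sum of
  binomial coefficients divided by the factorial of k.
\<close>

lemma lnd_exp_inverse:
  assumes D: "D \<in> LND scale"
  shows "lnd_exp scale (\<lambda>x. - D x) (lnd_exp scale D a) = a"
proof -
  note l = derivation_linear[OF LND_D(1)[OF D]]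
  note l' = derivation_linear[OF LND_D(1)[OF LND_uminus[OF D]]]
  note ln = linearD[OF linear_funpow[OF l]]
  obtain n where n: "(D ^^ n) a = 0" using LND_D(2)[OF D] by blast
  define e where "e = (\<Sum>j<n. scale (1 / fact j) ((D ^^ j) a))"
  have DD: "(D ^^ i) ((D ^^ j) a) = (D ^^ (i + j)) a" for i j by (simp add: funpow_add)
  have De: "(D ^^ i) e = (\<Sum>j<n. scale (1 / fact j) ((D ^^ (i + j)) a))" for i
    unfolding e_def by (simp add: ln DD)
  have "(D ^^ n) e = 0" unfolding De using funpow_eq_0_mono[OF l n] by simp
  then have "((\<lambda>x. - D x) ^^ n) e = 0" by (simp add: funpow_uminus[OF l])
  then have "lnd_exp scale (\<lambda>x. - D x) e = (\<Sum>i<n. scale (1 / fact i) (((\<lambda>x. - D x) ^^ i) e))"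
    by (rule lnd_exp_eq_sum[OF l'])
  also have "\<dots> = (\<Sum>i<n. \<Sum>j<n. scale ((- 1) ^ i / (fact i * fact j)) ((D ^^ (i + j)) a))"
    unfolding funpow_uminus[OF l] De by (simp add: scale_sum_right)
  also have "\<dots> = (\<Sum>(i, j)\<in>{..<n} \<times> {..<n}. scale ((- 1) ^ i / (fact i * fact j)) ((D ^^ (i + j)) a))"
    by (simp add: sum.cartesian_product)
  also have "\<dots> = (\<Sum>(i, j)\<in>{(i, j). i + j < n}. scale ((- 1) ^ i / (fact i * fact j)) ((D ^^ (i + j)) a))"
    by (intro sum.mono_neutral_right) (auto intro!: funpow_eq_0_mono[OF l n])
  also have "\<dots> = (\<Sum>k<n. \<Sum>i\<le>k. scale ((- 1) ^ i / (fact i * fact (k - i))) ((D ^^ (i + (k - i))) a))"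
    by (rule sum.triangle_reindex)
  also have "\<dots> = (\<Sum>k<n. if k = 0 then a else 0)"
  proof (rule sum.cong[OF refl])
    fix k
    have "(\<Sum>i\<le>k. scale ((- 1) ^ i / (fact i * fact (k - i))) ((D ^^ (i + (k - i))) a))
        = scale (\<Sum>i\<le>k. (- 1) ^ i / (fact i * fact (k - i))) ((D ^^ k) a)"
      by (simp add: scale_sum_left)
    also have "(\<Sum>i\<le>k. (- 1) ^ i / (fact i * fact (k - i))) = ((\<Sum>i\<le>k. (- 1) ^ i * of_nat (k choose i)) / fact k :: complex)"
      unfolding sum_divide_distrib by (intro sum.cong refl) (simp add: binomial_fact)
    also have "\<dots> = (if k = 0 then 1 else 0)"
      using choose_alternating_sum[of k, where 'a = complex] by auto
    finally show "(\<Sum>i\<le>k. scale ((- 1) ^ i / (fact i * fact (k - i))) ((D ^^ (i + (k - i))) a)) = (if k = 0 then a else 0)"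
      by auto
  qed
  also have "\<dots> = a" using n by (cases n) (simp_all add: lessThan_Suc_atMost)
  finally show ?thesis unfolding e_def lnd_exp_eq_sum[OF l n] .
qed

lemma lnd_exp_inverse':
  assumes D: "D \<in> LND scale"
  shows "lnd_exp scale D (lnd_exp scale (\<lambda>x. - D x) a) = a"
  using lnd_exp_inverse[OF LND_uminus[OF D]] by simp

text \<open>
  The derivation d satisfies \<open>d D^i = D^i d + i D^(i-1) [d, D]\<close>. Summation over i gives
  \<open>d exp(D) = exp(D) (d + [d, D])\<close>.
\<close>

lemma lnd_exp_conjugate:
  assumes D: "D \<in> LND scale" and d: "Vector_Spaces.linear scale scale d"
    and E: "Vector_Spaces.linear scale scale (bracket d D)"
    and comm: "\<And>a. bracket d D (D a) = D (bracket d D a)"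
  shows "lnd_exp scale (\<lambda>x. - D x) (d (lnd_exp scale D a)) = d a + bracket d D a"
proof -
  note l = derivation_linear[OF LND_D(1)[OF D]]
  let ?E = "bracket d D"
  have EDn: "?E ((D ^^ n) a) = (D ^^ n) (?E a)" for n a
    by (induction n) (simp_all add: comm)
  have dD: "d (D x) = D (d x) + ?E x" for x by (simp add: bracket_def)
  have dDn: "d ((D ^^ Suc i) a) = (D ^^ Suc i) (d a) + scale (of_nat (Suc i)) ((D ^^ i) (?E a))" for i
  proof (induction i)
    case (Suc i)
    have "d ((D ^^ Suc (Suc i)) a) = D (d ((D ^^ Suc i) a)) + ?E ((D ^^ Suc i) a)"
      using dD[of "(D ^^ Suc i) a"] by simp
    also have "\<dots> = (D ^^ Suc (Suc i)) (d a) + (scale (of_nat (Suc i)) ((D ^^ Suc i) (?E a)) + (D ^^ Suc i) (?E a))"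
      unfolding Suc EDn by (simp add: linearD[OF l])
    also have "scale (of_nat (Suc i)) ((D ^^ Suc i) (?E a)) + (D ^^ Suc i) (?E a)
        = scale (of_nat (Suc (Suc i))) ((D ^^ Suc i) (?E a))"
      by (metis scale_left_distrib scale_one of_nat_Suc add.commute)
    finally show ?case .
  qed (simp add: dD)
  obtain n0 n1 n2 where n0: "(D ^^ n0) a = 0" and n1: "(D ^^ n1) (d a) = 0" and n2: "(D ^^ n2) (?E a) = 0"
    using LND_D(2)[OF D] by meson
  define n where "n = max n0 (max n1 n2)"
  have na: "(D ^^ Suc n) a = 0" and nd: "(D ^^ Suc n) (d a) = 0" and nE: "(D ^^ n) (?E a) = 0"
    using funpow_eq_0_mono[OF l n0, of "Suc n"] funpow_eq_0_mono[OF l n1, of "Suc n"]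
      funpow_eq_0_mono[OF l n2, of n] unfolding n_def by simp_all
  have "d (lnd_exp scale D a) = d a + (\<Sum>i<n. scale (1 / fact (Suc i)) (d ((D ^^ Suc i) a)))"
    unfolding lnd_exp_eq_sum[OF l na] sum.lessThan_Suc_shift by (simp add: linearD[OF d])
  also have "\<dots> = (d a + (\<Sum>i<n. scale (1 / fact (Suc i)) ((D ^^ Suc i) (d a))))
      + (\<Sum>i<n. scale (1 / fact (Suc i)) (scale (of_nat (Suc i)) ((D ^^ i) (?E a))))"
    unfolding dDn scale_right_distrib sum.distrib by simp
  also have "d a + (\<Sum>i<n. scale (1 / fact (Suc i)) ((D ^^ Suc i) (d a))) = lnd_exp scale D (d a)"
    unfolding lnd_exp_eq_sum[OF l nd] sum.lessThan_Suc_shift by simp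
  also have "(\<Sum>i<n. scale (1 / fact (Suc i)) (scale (of_nat (Suc i)) ((D ^^ i) (?E a)))) = lnd_exp scale D (?E a)"
    unfolding lnd_exp_eq_sum[OF l nE]
  proof (rule sum.cong[OF refl])
    fix i
    have "1 / fact (Suc i) * of_nat (Suc i) = (1 / fact i :: complex)"
      by (simp add: fact_Suc divide_simps del: of_nat_Suc)
    then show "scale (1 / fact (Suc i)) (scale (of_nat (Suc i)) ((D ^^ i) (?E a))) = scale (1 / fact i) ((D ^^ i) (?E a))"
      by (simp only: scale_scale)
  qed
  finally have "d (lnd_exp scale D a) = lnd_exp scale D (d a + ?E a)"
    by (simp only: linearD(1)[OF lnd_exp_linear[OF D]])
  then show ?thesis by (simp only: lnd_exp_inverse[OF D])
qed

lemma diagonal_conjugate: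
  assumes d: "diagonal d" and D: "D \<in> LND scale" and e: "derivation scale e"
    and eq: "\<And>a. e a = lnd_exp scale (\<lambda>x. - D x) (d (lnd_exp scale D a))"
  shows "diagonal e"
  unfolding diagonal_def
proof
  note ll = linearD[OF lnd_exp_linear[OF LND_uminus[OF D]]]
  have "a \<in> span (\<Union>\<alpha>. weight_space e \<alpha>)" for a
  proof -
    obtain F x where F: "finite F" "\<And>\<alpha>. x \<alpha> \<in> weight_space d \<alpha>" "lnd_exp scale D a = (\<Sum>\<alpha>\<in>F. x \<alpha>)"
      using diagonal_decomposition[OF d] by blast
    have "lnd_exp scale (\<lambda>x. - D x) (x \<alpha>) \<in> weight_space e \<alpha>" for \<alpha>
      by (rule weight_spaceI) (simp add: eq lnd_exp_inverse'[OF D] ll weight_spaceD[OF F(2)])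
    then have "(\<Sum>\<alpha>\<in>F. lnd_exp scale (\<lambda>x. - D x) (x \<alpha>)) \<in> span (\<Union>\<alpha>. weight_space e \<alpha>)"
      by (intro span_sum span_base) blast
    then show ?thesis using lnd_exp_inverse[OF D, of a] unfolding F(3) ll(6) by simp
  qed
  then show "span (\<Union>\<alpha>. weight_space e \<alpha>) = UNIV" by blast
qed (rule e)

end

context nontoric_surface begin

text \<open>
  Let \<open>n1\<close> be the sum of the components of T of nonzero weight; it is locally nilpotent, and so is
  \<open>n = [d, T] = [d, n1]\<close>. Since n commutes with the locally nilpotent derivations, \<open>ad d\<close> and \<open>ad T\<close>
  commute on them (\<open>ad_comm\<close>). Decompose \<open>n1\<close> into components \<open>M \<mu>\<close> with respect to \<open>ad T\<close>, and let D be
  the sum of \<open>M \<mu> / \<mu>\<close> over the nonzero \<open>\<mu>\<close>. Then \<open>[T, D] = n1 - M 0\<close>. The component of weight zero of n is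
  \<open>[d, M 0]\<close>. It vanishes because \<open>n = - [T, d]\<close> is a commutator with T. Consequently \<open>[d, [T, D]] = n\<close>,
  and \<open>d + [d, D]\<close> commutes with T.
\<close>

theorem diagonal_conjugate_proportional:
  assumes d: "diagonal d" and int: "weights d \<subseteq> \<int>" and nz: "d b \<noteq> 0" and T: "diagonal T"
  shows "\<exists>c. \<exists>D\<in>LND scale. \<forall>a. T a = scale c (lnd_exp scale (\<lambda>x. - D x) (d (lnd_exp scale D a)))"
proof -
  note dd = diagonal_derivation[OF d] and dl = diagonal_linear[OF d]
  note Td = diagonal_derivation[OF T] and Tl = diagonal_linear[OF T]
  obtain F Tc where F': "finite F" "\<forall>\<alpha>. homogeneous d \<alpha> (Tc \<alpha>)" "\<forall>a. T a = (\<Sum>\<alpha>\<in>F. Tc \<alpha> a)"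
    "\<forall>\<alpha>. \<alpha> \<notin> F \<longrightarrow> Tc \<alpha> = (\<lambda>a. 0)"
    using derivation_components[OF d Td] by (elim exE conjE) (rule that)
  note F = F'[rule_format]
  have Tc_LND: "Tc \<alpha> \<in> LND scale" if "\<alpha> \<in> F" "\<alpha> \<noteq> 0" for \<alpha>
    by (rule diagonal_component_LND[OF d int T F(1-3) that])
  define n1 where "n1 a = (\<Sum>\<alpha>\<in>F - {0}. Tc \<alpha> a)" for a
  have n1: "n1 \<in> LND scale" unfolding n1_def by (rule LND_sum) (use Tc_LND in blast)
  have T_split: "T a = Tc 0 a + n1 a" for a
  proof (cases "0 \<in> F")
    case True
    then show ?thesis unfolding F(3) n1_def using F(1) by (simp add: sum.remove)
  next
    case False
    then show ?thesis unfolding F(3) n1_def using F(4)[OF False] by simp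
  qed
  define n where "n = bracket d T"
  have n_eq: "n a = bracket d n1 a" for a
  proof -
    have "d (Tc 0 a) = Tc 0 (d a)" using F(2)[of 0] by (simp add: homogeneous_def)
    then show ?thesis unfolding n_def bracket_def T_split by (simp add: derivationD(1)[OF dd])
  qed
  have n_LND: "n \<in> LND scale"
    using bracket_diagonal_LND[OF d n1] n_eq by (metis ext)
  have dT: "d (T a) = T (d a) + n a" for a unfolding n_def bracket_def by simp
  have ad_comm: "T (bracket d M a) - bracket d M (T a) = bracket d (bracket T M) a" if M: "M \<in> LND scale" for M a
  proof -
    have "T (d (M a)) = d (T (M a)) - n (M a)" "d (T a) = T (d a) + n a" by (simp_all add: dT)
    then show ?thesis using LND_commute[OF n_LND M, of a] unfolding bracket_def
      by (simp add: derivationD(1,4)[OF Td] derivationD(1,4)[OF dd] derivationD(1)[OF LND_D(1)[OF M]] algebra_simps)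
  qed
  obtain G M where G': "finite G" "\<forall>\<mu>. homogeneous T \<mu> (M \<mu>)" "\<forall>a. n1 a = (\<Sum>\<mu>\<in>G. M \<mu> a)"
    "\<forall>\<mu>. M \<mu> \<in> LND scale" using LND_decomposition[OF T n1] by (elim exE conjE) (rule that)
  note G = G'[rule_format]
  have TM: "bracket T (M \<mu>) a = scale \<mu> (M \<mu> a)" for \<mu> a
    using G(2)[of \<mu>] by (simp add: homogeneous_def bracket_def)
  have X_hom: "homogeneous T \<mu> (bracket d (M \<mu>))" for \<mu>
    unfolding homogeneous_def
  proof (intro conjI allI)
    show "derivation scale (bracket d (M \<mu>))" by (rule derivation_bracket[OF dd LND_D(1)[OF G(4)]])
    fix a
    have "bracket d (bracket T (M \<mu>)) a = scale \<mu> (bracket d (M \<mu>) a)"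
      unfolding bracket_def[of d] TM by (simp add: derivationD(2)[OF dd] scale_right_diff_distrib)
    then show "T (bracket d (M \<mu>) a) = bracket d (M \<mu>) (T a) + scale \<mu> (bracket d (M \<mu>) a)"
      using ad_comm[OF G(4), of \<mu> a] by (simp add: algebra_simps)
  qed
  obtain H C where H': "finite H" "\<forall>\<mu>. homogeneous T \<mu> (C \<mu>)" "\<forall>a. d a = (\<Sum>\<mu>\<in>H. C \<mu> a)"
    "\<forall>\<mu>. \<mu> \<notin> H \<longrightarrow> C \<mu> = (\<lambda>a. 0)"
    using derivation_components[OF T dd] by (elim exE conjE) (rule that)
  note H = H'[rule_format]
  have sum_X: "(\<Sum>\<mu>\<in>G. bracket d (M \<mu>) a) = n a" for a
    unfolding n_eq bracket_def G(3) by (simp add: derivationD(6)[OF dd] sum_subtractf)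
  have sum_C: "(\<Sum>\<mu>\<in>H. scale \<mu> (C \<mu> a)) = - n a" for a
  proof -
    have "T (C \<mu> a) - C \<mu> (T a) = scale \<mu> (C \<mu> a)" for \<mu> using H(2)[of \<mu>] by (simp add: homogeneous_def)
    then have "(\<Sum>\<mu>\<in>H. scale \<mu> (C \<mu> a)) = (\<Sum>\<mu>\<in>H. T (C \<mu> a) - C \<mu> (T a))" by simp
    also have "\<dots> = T (d a) - d (T a)" unfolding H(3) by (simp add: sum_subtractf derivationD(6)[OF Td])
    finally show ?thesis using dT[of a] by simp
  qed
  have X0_weight: "bracket d (M 0) a = 0" if a: "a \<in> weight_space T \<beta>" and 0: "0 \<in> G" for a \<beta>
  proof -
    \<comment> \<open>the component of weight \<mu> of [d, T] + [T, d] = 0; the second summand vanishes for \<mu> = 0\<close>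
    define y where "y \<mu> = (if \<mu> \<in> G then bracket d (M \<mu>) a else 0) + (if \<mu> \<in> H then scale \<mu> (C \<mu> a) else 0)" for \<mu>
    have sum0: "(\<Sum>\<mu>\<in>G \<union> H. y \<mu>) = 0"
    proof -
      have "(\<Sum>\<mu>\<in>G \<union> H. if \<mu> \<in> G then bracket d (M \<mu>) a else 0) = n a"
        using sum_X[of a] G(1) H(1) by (simp add: sum.If_cases Int_absorb1)
      moreover have "(\<Sum>\<mu>\<in>G \<union> H. if \<mu> \<in> H then scale \<mu> (C \<mu> a) else 0) = - n a"
        using sum_C[of a] G(1) H(1) by (simp add: sum.If_cases Int_absorb1)
      ultimately show ?thesis unfolding y_def sum.distrib by simp
    qed
    have "y 0 = 0"
    proof (rule weight_vectors_zero[OF Tl _ _ _ sum0, where w = "\<lambda>\<mu>. \<beta> + \<mu>"])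
      have sub: "subspace (weight_space T (\<beta> + \<mu>))" for \<mu> by (rule subspace_weight_space[OF Tl])
      show "y \<mu> \<in> weight_space T (\<beta> + \<mu>)" for \<mu>
        unfolding y_def using homogeneous_weight_space[OF X_hom[of \<mu>] a] homogeneous_weight_space[OF H(2)[of \<mu>] a]
        by (intro subspace_add[OF sub]) (auto intro: subspace_scale[OF sub] subspace_0[OF sub])
    qed (use G(1) H(1) 0 in \<open>auto simp: inj_on_def\<close>)
    then show ?thesis using 0 unfolding y_def by (simp split: if_splits)
  qed
  have X0: "bracket d (M 0) a = 0" if 0: "0 \<in> G" for a
  proof -
    obtain A x where A: "finite A" "\<And>\<beta>. x \<beta> \<in> weight_space T \<beta>" "a = (\<Sum>\<beta>\<in>A. x \<beta>)"
      using diagonal_decomposition[OF T] by blast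
    show ?thesis
      unfolding A(3) derivationD(6)[OF derivation_bracket[OF dd LND_D(1)[OF G(4)]]]
      using X0_weight[OF A(2) 0] by simp
  qed
  define D where "D a = (\<Sum>\<mu>\<in>G - {0}. scale (1 / \<mu>) (M \<mu> a))" for a
  have D: "D \<in> LND scale" unfolding D_def by (rule LND_sum[OF LND_scale[OF G(4)]])
  note Dd = LND_D(1)[OF D]
  have TD: "bracket T D a = (\<Sum>\<mu>\<in>G - {0}. M \<mu> a)" for a
  proof -
    have "bracket T D a = (\<Sum>\<mu>\<in>G - {0}. scale (1 / \<mu>) (bracket T (M \<mu>) a))"
      unfolding bracket_def D_def
      by (simp add: derivationD(2,6)[OF Td] sum_subtractf scale_right_diff_distrib)
    also have "\<dots> = (\<Sum>\<mu>\<in>G - {0}. M \<mu> a)" unfolding TM by (intro sum.cong refl) simp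
    finally show ?thesis .
  qed
  have dTD: "bracket d (bracket T D) a = n a" for a
  proof -
    have "bracket d (bracket T D) a = (\<Sum>\<mu>\<in>G - {0}. bracket d (M \<mu>) a)"
      unfolding bracket_def[of d] TD by (simp add: derivationD(6)[OF dd] sum_subtractf)
    also have "\<dots> = (\<Sum>\<mu>\<in>G. bracket d (M \<mu>) a)"
      using X0 G(1) by (cases "0 \<in> G") (simp_all add: sum.remove)
    finally show ?thesis unfolding sum_X .
  qed
  define e where "e a = d a + bracket d D a" for a
  have dD: "bracket d D \<in> LND scale" by (rule bracket_diagonal_LND[OF d D])
  have ed: "derivation scale e" unfolding e_def by (intro derivation_add dd LND_D(1)[OF dD])
  have conj: "e a = lnd_exp scale (\<lambda>x. - D x) (d (lnd_exp scale D a))" for a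
    unfolding e_def
    by (rule lnd_exp_conjugate[OF D dl derivation_linear[OF LND_D(1)[OF dD]] LND_commute[OF dD D], symmetric])
  have e: "diagonal e" by (rule diagonal_conjugate[OF d D ed conj])
  have comm: "e (T a) = T (e a)" for a
  proof -
    have "T (bracket d D a) = bracket d D (T a) + n a" using ad_comm[OF D, of a] dTD[of a] by (simp add: algebra_simps)
    then show ?thesis unfolding e_def by (simp add: derivationD(1)[OF Td] dT)
  qed
  have "e (lnd_exp scale (\<lambda>x. - D x) b) \<noteq> 0"
  proof
    assume "e (lnd_exp scale (\<lambda>x. - D x) b) = 0"
    then have "lnd_exp scale (\<lambda>x. - D x) (d b) = 0" unfolding conj lnd_exp_inverse'[OF D] .
    then have "d b = lnd_exp scale D 0" using lnd_exp_inverse'[OF D, of "d b"] by simp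
    then show False using nz linearD(3)[OF lnd_exp_linear[OF D]] by simp
  qed
  then obtain c where "\<forall>a. T a = scale c (e a)" using commuting_proportional[OF e T comm] by blast
  then show ?thesis unfolding conj using D by (intro exI[of _ c] bexI[of _ D])
qed

end

section \<open>Actions of the multiplicative group\<close>

lemma two_powi_inject:
  assumes "(2::complex) powi i = 2 powi j"
  shows "i = j"
proof -
  have *: "i \<ge> j" if eq: "(2::complex) powi i = 2 powi j" for i j :: int
  proof (rule ccontr)
    assume "\<not> i \<ge> j"
    define n where "n = nat (j - i)"
    have n: "n > 0" "j = i + int n" unfolding n_def using \<open>\<not> i \<ge> j\<close> by auto
    have "(2::complex) powi i * 2 ^ n = 2 powi i * 1" using eq unfolding n(2) by (simp add: power_int_add)
    then have "(2::complex) ^ n = 1" by simp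
    then have "of_nat (2 ^ n) = (of_nat 1 :: complex)" by simp
    then have "(2::nat) ^ n = 1" by (simp only: of_nat_eq_iff)
    then show False using n(1) by simp
  qed
  show ?thesis using *[OF assms] *[OF assms[symmetric]] by simp
qed

text \<open>
  Apply the hypothesis to a primitive n-th root of unity.
\<close>

lemma effective_action_dvd:
  assumes "effective_action \<rho>" "n > 0" "\<And>l. l \<noteq> 0 \<Longrightarrow> l ^ n = 1 \<Longrightarrow> \<rho> l = id"
  shows "n = 1"
proof -
  define z where "z = cis (2 * pi / n)"
  have "z ^ n = 1" unfolding z_def using assms(2) by (simp add: DeMoivre)
  moreover have "z \<noteq> 0" by (simp add: z_def)
  ultimately have "z = 1" using assms unfolding effective_action_def by blast
  then have "cos (2 * pi / n) = 1" unfolding z_def by (simp add: complex_eq_iff)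
  then obtain k :: int where "2 * pi / n = real_of_int k * 2 * pi" using cos_one_2pi_int by blast
  then have "real_of_int (k * int n) = 1" using assms(2) by (simp add: field_simps)
  then have "k * int n = 1" by linarith
  then have "int n dvd 1" by (metis dvd_triv_right)
  then show ?thesis by simp
qed

context complex_domain begin

text \<open>
  A Laurent polynomial with coefficients in the algebra that vanishes at all powers of 2 is zero: the
  coefficients satisfy a system of Vandermonde type.
\<close>

lemma coefficient_zero_if_powers_of_two:
  fixes g :: "int \<Rightarrow> 'a"
  assumes "finite I" "\<And>k. (\<Sum>i\<in>I. scale ((2 powi i) ^ k) (g i)) = 0" "i \<in> I"
  shows "g i = 0"
proof -
  have "\<forall>i\<in>I. g i = 0" using assms(1,2)
  proof (induction I arbitrary: g rule: finite_induct)
    case (insert j I)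
    have "(\<Sum>i\<in>I. scale ((2 powi i) ^ k) (scale (2 powi i - 2 powi j) (g i))) = 0" for k
    proof -
      have "(\<Sum>i\<in>insert j I. scale ((2 powi i) ^ k) (scale (2 powi i - 2 powi j) (g i)))
          = (\<Sum>i\<in>insert j I. scale ((2 powi i) ^ Suc k) (g i))
            - scale (2 powi j) (\<Sum>i\<in>insert j I. scale ((2 powi i) ^ k) (g i))"
        unfolding scale_sum_right sum_subtractf[symmetric]
        by (intro sum.cong refl) (simp add: right_diff_distrib scale_left_diff_distrib scale_right_diff_distrib mult.commute)
      also have "\<dots> = 0" unfolding insert.prems by simp
      finally show ?thesis using insert.hyps by simp
    qed
    then have sc: "\<forall>i\<in>I. scale (2 powi i - 2 powi j) (g i) = 0" by (rule insert.IH)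
    have I: "g i = 0" if i: "i \<in> I" for i
    proof -
      have "i \<noteq> j" using i insert.hyps by blast
      then have "(2 powi i - 2 powi j :: complex) \<noteq> 0" using two_powi_inject[of i j] by auto
      then show ?thesis using bspec[OF sc i] by simp
    qed
    have "(\<Sum>i\<in>insert j I. g i) = 0" using insert.prems[of 0] by simp
    then have "g j = 0" using I insert.hyps by simp
    with I show ?case by blast
  qed simp
  then show ?thesis using assms(3) by blast
qed

context
  fixes \<rho> :: "complex \<Rightarrow> 'a \<Rightarrow> 'a"
  assumes \<rho>: "Cstar_action scale \<rho>"
begin

abbreviation "part \<equiv> graded_part scale \<rho>"

lemma action_linear: "l \<noteq> 0 \<Longrightarrow> Vector_Spaces.linear scale scale (\<rho> l)"
  using \<rho> unfolding Cstar_action_def algebra_hom_def by blast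

lemma action_mult: "l \<noteq> 0 \<Longrightarrow> \<rho> l (x * y) = \<rho> l x * \<rho> l y"
  using \<rho> unfolding Cstar_action_def algebra_hom_def by blast

lemma subspace_part: "subspace (part i)"
  by (rule subspaceI) (auto simp: graded_part_def linearD[OF action_linear] scale_right_distrib mult.commute)

lemma part_mult: "x \<in> part i \<Longrightarrow> y \<in> part j \<Longrightarrow> x * y \<in> part (i + j)"
  by (auto simp: graded_part_def action_mult scale_mult_scale power_int_add)

text \<open>
  Comparing the Laurent polynomials in m on both sides of \<open>\<rho> (l m) a = \<rho> l (\<rho> m a)\<close> shows that each
  coefficient \<open>f i\<close> is homogeneous of degree i.
\<close>

lemma graded_decomposition:
  "\<exists>I f. finite I \<and> (\<forall>i. f i \<in> part i) \<and> a = (\<Sum>i\<in>I. f i)"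
proof -
  obtain f :: "int \<Rightarrow> 'a" where f: "finite {i. f i \<noteq> 0}"
    "\<forall>l. l \<noteq> 0 \<longrightarrow> \<rho> l a = (\<Sum>i | f i \<noteq> 0. scale (l powi i) (f i))"
    using \<rho> unfolding Cstar_action_def by blast
  let ?I = "{i. f i \<noteq> 0}"
  have fp: "f i \<in> part i" for i
    unfolding graded_part_def
  proof (intro CollectI allI impI)
    fix l :: complex assume l: "l \<noteq> 0"
    show "\<rho> l (f i) = scale (l powi i) (f i)"
    proof (cases "i \<in> ?I")
      case True
      have "(\<Sum>i\<in>?I. scale ((2 powi i) ^ k) (\<rho> l (f i) - scale (l powi i) (f i))) = 0" for k
      proof -
        have p: "(2 powi i) ^ k = ((2::complex) ^ k) powi i" for i
          by (simp add: power_int_power power_int_power' mult.commute)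
        have "\<rho> (l * 2 ^ k) a = \<rho> l (\<rho> (2 ^ k) a)"
          using \<rho> l unfolding Cstar_action_def by simp
        then have "(\<Sum>i\<in>?I. scale ((l * 2 ^ k) powi i) (f i)) = (\<Sum>i\<in>?I. scale ((2 ^ k) powi i) (\<rho> l (f i)))"
          using f(2) l by (simp add: linearD[OF action_linear[OF l]])
        then show ?thesis unfolding p
          by (simp add: scale_right_diff_distrib sum_subtractf power_int_mult_distrib mult.commute)
      qed
      then have "\<rho> l (f i) - scale (l powi i) (f i) = 0"
        using coefficient_zero_if_powers_of_two[OF f(1), of "\<lambda>i. \<rho> l (f i) - scale (l powi i) (f i)" i] True by blast
      then show ?thesis by simp
    next
      case False
      then show ?thesis by (simp add: linearD(3)[OF action_linear[OF l]])
    qed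
  qed
  have "\<rho> 1 a = a" using \<rho> unfolding Cstar_action_def by simp
  then have s: "a = (\<Sum>i\<in>?I. f i)" using f(2)[rule_format, of 1] by simp
  show ?thesis by (intro exI[of _ ?I] exI[of _ f] conjI allI f(1) fp s)
qed

text \<open>
  The parts are eigenspaces of \<open>\<rho> 2\<close> with distinct eigenvalues.
\<close>

lemma graded_unique:
  assumes "finite I" "\<And>i. i \<in> I \<Longrightarrow> g i \<in> part i" "(\<Sum>i\<in>I. g i) = 0" "i \<in> I"
  shows "g i = 0"
proof (rule weight_vectors_zero[OF action_linear[of 2] assms(1) _ _ assms(3,4), where w = "\<lambda>i. 2 powi i"])
  show "inj_on (\<lambda>i. 2 powi i :: complex) I" by (intro inj_onI two_powi_inject)
  show "g i \<in> weight_space (\<rho> 2) (2 powi i)" if "i \<in> I" for i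
    using assms(2)[OF that] by (simp add: graded_part_def weight_space_def)
qed simp

text \<open>
  The linear map that multiplies the part of degree i by i satisfies the Leibniz rule on products of
  homogeneous elements.
\<close>

lemma generator_exists: "\<exists>\<delta>. infinitesimal_generator scale \<rho> \<delta>"
proof -
  have "\<forall>a. \<exists>I f. finite I \<and> (\<forall>i. f i \<in> part i) \<and> a = (\<Sum>i\<in>I. f i)"
    using graded_decomposition by blast
  then obtain I f where f: "\<And>a. finite (I a)" "\<And>a i. f a i \<in> part i" "\<And>a. a = (\<Sum>i\<in>I a. f a i)" by metis
  define \<delta> where "\<delta> a = (\<Sum>i\<in>I a. scale (of_int i) (f a i))" for a
  have \<delta>: "\<delta> a = (\<Sum>i\<in>J. scale (of_int i) (g i))" if J: "finite J" "\<And>i. g i \<in> part i" "a = (\<Sum>i\<in>J. g i)" for a J g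
  proof -
    define h where "h i = (if i \<in> I a then f a i else 0) - (if i \<in> J then g i else 0)" for i
    have hp: "h i \<in> part i" for i
      unfolding h_def using f(2) J(2) subspace_0[OF subspace_part] by (intro subspace_diff[OF subspace_part]) auto
    have "(\<Sum>i\<in>I a \<union> J. h i) = a - a"
      unfolding h_def sum_subtractf using f(1,3)[of a] J(1,3) by (simp add: sum.If_cases Int_absorb1)
    then have h0: "h i = 0" if "i \<in> I a \<union> J" for i
      using graded_unique[of "I a \<union> J" h i] hp f(1) J(1) that by simp
    have "\<delta> a - (\<Sum>i\<in>J. scale (of_int i) (g i)) = (\<Sum>i\<in>I a \<union> J. scale (of_int i) (h i))"
      unfolding h_def scale_right_diff_distrib sum_subtractf \<delta>_def using f(1) J(1)
      by (simp add: if_distrib[of "scale _"] sum.If_cases Int_absorb1 cong: if_cong)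
    also have "\<dots> = 0" using h0 by simp
    finally show ?thesis by simp
  qed
  have \<delta>_part: "\<delta> a = scale (of_int i) a" if "a \<in> part i" for a i
    using \<delta>[of "{i}" "\<lambda>j. if j = i then a else 0" a] that subspace_0[OF subspace_part] by simp
  have lin: "Vector_Spaces.linear scale scale \<delta>"
  proof (rule linearI)
    fix x y c
    let ?g = "\<lambda>i. (if i \<in> I x then f x i else 0) + (if i \<in> I y then f y i else 0)"
    have "\<delta> (x + y) = (\<Sum>i\<in>I x \<union> I y. scale (of_int i) (?g i))"
    proof (rule \<delta>)
      show "?g i \<in> part i" for i
        using f(2) subspace_0[OF subspace_part] by (intro subspace_add[OF subspace_part]) auto
      show "x + y = (\<Sum>i\<in>I x \<union> I y. ?g i)"
        using f(1,3)[of x] f(1,3)[of y] unfolding sum.distrib by (simp add: sum.If_cases Int_absorb1)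
    qed (use f(1) in simp)
    also have "\<dots> = \<delta> x + \<delta> y"
      unfolding scale_right_distrib sum.distrib \<delta>_def using f(1)
      by (simp add: if_distrib[of "scale _"] sum.If_cases Int_absorb1 cong: if_cong)
    finally show "\<delta> (x + y) = \<delta> x + \<delta> y" .
    have "\<delta> (scale c x) = (\<Sum>i\<in>I x. scale (of_int i) (scale c (f x i)))"
    proof (rule \<delta>)
      show "scale c (f x i) \<in> part i" for i by (rule subspace_scale[OF subspace_part f(2)])
      show "scale c x = (\<Sum>i\<in>I x. scale c (f x i))" using f(3)[of x] by (metis scale_sum_right)
    qed (rule f(1))
    then show "\<delta> (scale c x) = scale c (\<delta> x)" unfolding \<delta>_def by (simp add: scale_sum_right mult.commute)
  qed
  note l = linearD[OF lin]
  have "\<delta> (x * y) = \<delta> x * y + x * \<delta> y" for x y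
  proof -
    have "\<delta> (f x i * f y j) = \<delta> (f x i) * f y j + f x i * \<delta> (f y j)" for i j
      using \<delta>_part[OF part_mult[OF f(2)[of x i] f(2)[of y j]]] \<delta>_part[OF f(2)[of x i]] \<delta>_part[OF f(2)[of y j]]
      by (simp add: scale_left_distrib scale_mult_left[symmetric] scale_mult_right[symmetric])
    then have "\<delta> ((\<Sum>i\<in>I x. f x i) * (\<Sum>j\<in>I y. f y j))
        = \<delta> (\<Sum>i\<in>I x. f x i) * (\<Sum>j\<in>I y. f y j) + (\<Sum>i\<in>I x. f x i) * \<delta> (\<Sum>j\<in>I y. f y j)"
      unfolding sum_product l(6) by (simp add: sum.distrib)
    then show ?thesis using f(3) by metis
  qed
  then have "derivation scale \<delta>" unfolding derivation_def using lin by blast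
  then show ?thesis unfolding infinitesimal_generator_def using \<delta>_part by blast
qed

context
  fixes \<delta> :: "'a \<Rightarrow> 'a"
  assumes \<delta>: "infinitesimal_generator scale \<rho> \<delta>"
begin

lemma generator_derivation: "derivation scale \<delta>"
  using \<delta> by (simp add: infinitesimal_generator_def)

lemma part_weight_space: "part i \<subseteq> weight_space \<delta> (of_int i)"
  using \<delta> by (auto simp: infinitesimal_generator_def weight_space_def)

lemma generator_diagonal: "diagonal \<delta>"
  unfolding diagonal_def
proof
  have "a \<in> span (\<Union>\<alpha>. weight_space \<delta> \<alpha>)" for a
  proof -
    obtain I f where f': "finite I" "\<forall>i. f i \<in> part i" "a = (\<Sum>i\<in>I. f i)"
      using graded_decomposition[of a] by (elim exE conjE) (rule that)
    note f = f'[rule_format]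
    have "f i \<in> (\<Union>\<alpha>. weight_space \<delta> \<alpha>)" for i using f(2) part_weight_space by blast
    then show ?thesis unfolding f(3) by (intro span_sum span_base)
  qed
  then show "span (\<Union>\<alpha>. weight_space \<delta> \<alpha>) = UNIV" by blast
qed (rule generator_derivation)

lemma weight_space_generator:
  assumes a: "a \<in> weight_space \<delta> \<alpha>" "a \<noteq> 0"
  obtains i :: int where "\<alpha> = of_int i" "a \<in> part i"
proof -
  note l = derivation_linear[OF generator_derivation]
  obtain I f where f': "finite I" "\<forall>i. f i \<in> part i" "a = (\<Sum>i\<in>I. f i)"
      using graded_decomposition[of a] by (elim exE conjE) (rule that)
    note f = f'[rule_format]
  have "\<exists>i\<in>I. f i \<noteq> 0"
  proof (rule ccontr)
    assume "\<not> ?thesis"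
    then have "(\<Sum>i\<in>I. f i) = 0" by (intro sum.neutral) blast
    then show False using a(2) f(3) by simp
  qed
  then obtain j where j: "j \<in> I" "f j \<noteq> 0" by blast
  have fw: "scale (\<alpha> - of_int i) (f i) \<in> weight_space \<delta> (of_int i)" for i
    using f(2) part_weight_space subspace_scale[OF subspace_weight_space[OF l]] by blast
  have fd: "\<delta> (f i) = scale (of_int i) (f i)" for i
    using f(2)[of i] part_weight_space[of i] by (auto simp: weight_space_def)
  have "(\<Sum>i\<in>I. scale (\<alpha> - of_int i) (f i)) = scale \<alpha> a - \<delta> a"
    unfolding f(3) linearD(6)[OF l] fd scale_sum_right sum_subtractf[symmetric] scale_left_diff_distrib ..
  also have "\<dots> = 0" using a(1) by (simp add: weight_space_def)
  finally have s0: "(\<Sum>i\<in>I. scale (\<alpha> - of_int i) (f i)) = 0" .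
  have z: "scale (\<alpha> - of_int i) (f i) = 0" if "i \<in> I" for i
    by (rule weight_vectors_zero[OF l f(1) _ fw s0 that]) (simp add: inj_on_def)
  have \<alpha>: "\<alpha> = of_int j" using z[OF j(1)] j(2) by simp
  have "f i = 0" if "i \<in> I" "i \<noteq> j" for i using z[OF that(1)] that(2) \<alpha> by simp
  then have "a = (\<Sum>i\<in>I. if i = j then f j else 0)" unfolding f(3) by (intro sum.cong) auto
  then have "a = f j" using f(1) j(1) by simp
  then show thesis using that[OF \<alpha>] f(2) by simp
qed

lemma weights_generator: "weights \<delta> \<subseteq> \<int>"
proof
  fix \<alpha> assume "\<alpha> \<in> weights \<delta>"
  then obtain a where "a \<in> weight_space \<delta> \<alpha>" "a \<noteq> 0" unfolding weights_def by blast
  then show "\<alpha> \<in> \<int>" by (rule weight_space_generator) simp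
qed

text \<open>
  If n divides all degrees that occur, then the n-th roots of unity act trivially.
\<close>

lemma effective_weights_dvd:
  assumes "effective_action \<rho>" "n > 0" "\<And>i. part i \<noteq> {0} \<Longrightarrow> n dvd i"
  shows "n = 1"
proof -
  have "nat n = 1"
  proof (rule effective_action_dvd[OF assms(1)])
    fix l :: complex assume l: "l \<noteq> 0" "l ^ nat n = 1"
    show "\<rho> l = id"
    proof
      fix a
      obtain I f where f': "finite I" "\<forall>i. f i \<in> part i" "a = (\<Sum>i\<in>I. f i)"
      using graded_decomposition[of a] by (elim exE conjE) (rule that)
    note f = f'[rule_format]
      have "\<rho> l (f i) = f i" for i
      proof (cases "f i = 0")
        case False
        then have "part i \<noteq> {0}" using f(2) by blast
        then have "n dvd i" by (rule assms(3))
        then obtain k where "i = n * k" by (elim dvdE)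
        then have "l powi i = (l powi n) powi k" by (simp add: power_int_mult)
        also have "l powi n = 1" using l(2) assms(2) by (simp add: power_int_def)
        finally show ?thesis using f(2)[of i] l(1) by (simp add: graded_part_def)
      qed (simp add: linearD(3)[OF action_linear[OF l(1)]])
      then show "\<rho> l a = id a" unfolding f(3) by (simp add: linearD(6)[OF action_linear[OF l(1)]])
    qed
  qed (use assms(2) in simp)
  then show ?thesis by simp
qed

lemma generator_nonzero:
  assumes "\<rho> l \<noteq> id" "l \<noteq> 0"
  shows "\<exists>b. \<delta> b \<noteq> 0"
proof (rule ccontr)
  assume neg: "\<not> ?thesis"
  have "\<rho> l a = a" for a
  proof -
    obtain I f where f': "finite I" "\<forall>i. f i \<in> part i" "a = (\<Sum>i\<in>I. f i)"
      using graded_decomposition[of a] by (elim exE conjE) (rule that)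
    note f = f'[rule_format]
    have "\<rho> l (f i) = f i" for i
    proof (cases "f i = 0")
      case False
      have "\<delta> (f i) = scale (of_int i) (f i)" using f(2) part_weight_space by (auto simp: weight_space_def)
      then have "i = 0" using neg False by simp
      then show ?thesis using f(2)[of i] assms(2) by (simp add: graded_part_def)
    qed (simp add: linearD(3)[OF action_linear[OF assms(2)]])
    then show ?thesis unfolding f(3) by (simp add: linearD(6)[OF action_linear[OF assms(2)]])
  qed
  then show False using assms(1) by (auto simp: fun_eq_iff)
qed

end

end

lemma effective_nontrivial:
  assumes "effective_action \<rho>"
  shows "\<rho> 2 \<noteq> id"
proof
  assume "\<rho> 2 = id"
  then have "(2::complex) = 1" using assms[unfolded effective_action_def, rule_format, of 2] by simp
  then show False by simp
qed

end

context nontoric_surface begin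

text \<open>
  Multiplication by c maps the degrees of the first action onto those of the second. Write c as a reduced
  fraction \<open>p / q\<close>. Then q divides all degrees of the first action and p all degrees of the second, so
  both are 1 up to sign.
\<close>

lemma effective_actions_conjugate:
  assumes \<rho>1: "Cstar_action scale \<rho>1" "effective_action \<rho>1" and \<rho>2: "Cstar_action scale \<rho>2" "effective_action \<rho>2"
  shows "\<exists>\<rho>'\<in>{\<rho>2, \<lambda>l. \<rho>2 (inverse l)}. \<exists>D\<in>LND scale. \<forall>l a. l \<noteq> 0 \<longrightarrow>
    \<rho>' l a = lnd_exp scale (\<lambda>x. - D x) (\<rho>1 l (lnd_exp scale D a))"
proof -
  obtain \<delta>1 where \<delta>1: "infinitesimal_generator scale \<rho>1 \<delta>1" using generator_exists[OF \<rho>1(1)] by blast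
  obtain \<delta>2 where \<delta>2: "infinitesimal_generator scale \<rho>2 \<delta>2" using generator_exists[OF \<rho>2(1)] by blast
  note g1 = \<rho>1(1) \<delta>1 and g2 = \<rho>2(1) \<delta>2
  obtain b1 where b1: "\<delta>1 b1 \<noteq> 0" using generator_nonzero[OF g1 effective_nontrivial[OF \<rho>1(2)]] by auto
  obtain b2 where b2: "\<delta>2 b2 \<noteq> 0" using generator_nonzero[OF g2 effective_nontrivial[OF \<rho>2(2)]] by auto
  obtain c D where D: "D \<in> LND scale"
    and c': "\<forall>a. \<delta>2 a = scale c (lnd_exp scale (\<lambda>x. - D x) (\<delta>1 (lnd_exp scale D a)))"
    using diagonal_conjugate_proportional[OF generator_diagonal[OF g1] weights_generator[OF g1] b1 generator_diagonal[OF g2]]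
    by (elim exE bexE) (rule that)
  note c = c'[rule_format]
  let ?e = "lnd_exp scale D" and ?e' = "lnd_exp scale (\<lambda>x. - D x)"
  note le = linearD[OF lnd_exp_linear[OF D]] and le' = linearD[OF lnd_exp_linear[OF LND_uminus[OF D]]]
  have c0: "c \<noteq> 0" using c[of b2] b2 by auto
  have e'_inj: "?e' a \<noteq> 0" if "a \<noteq> 0" for a using lnd_exp_inverse'[OF D, of a] le(3) that by metis
  have e_inj: "?e a \<noteq> 0" if "a \<noteq> 0" for a using lnd_exp_inverse[OF D, of a] le'(3) that by metis
  have e'_weight: "?e' a \<in> weight_space \<delta>2 (c * of_int i)" if "a \<in> graded_part scale \<rho>1 i" for a i
    using part_weight_space[OF g1, of i] that unfolding weight_space_def
    by (auto simp: c lnd_exp_inverse'[OF D] le')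
  have W12: "\<exists>k::int. c * of_int i = of_int k \<and> graded_part scale \<rho>2 k \<noteq> {0}" if i: "graded_part scale \<rho>1 i \<noteq> {0}" for i
  proof -
    obtain a where a: "a \<in> graded_part scale \<rho>1 i" "a \<noteq> 0"
      using i subspace_0[OF subspace_part[OF \<rho>1(1)], of i] by blast
    show ?thesis
    proof (rule weight_space_generator[OF g2 e'_weight[OF a(1)] e'_inj[OF a(2)]])
      fix k :: int assume "c * of_int i = of_int k" "?e' a \<in> graded_part scale \<rho>2 k"
      then show ?thesis using e'_inj[OF a(2)] by (intro exI[of _ k]) blast
    qed
  qed
  have W21: "\<exists>i::int. c * of_int i = of_int k \<and> graded_part scale \<rho>1 i \<noteq> {0}" if k: "graded_part scale \<rho>2 k \<noteq> {0}" for k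
  proof -
    obtain a where a: "a \<in> graded_part scale \<rho>2 k" "a \<noteq> 0"
      using k subspace_0[OF subspace_part[OF \<rho>2(1)], of k] by blast
    have "scale c (?e' (\<delta>1 (?e a))) = scale (of_int k) a"
      using part_weight_space[OF g2, of k] a(1) c[of a] by (auto simp: weight_space_def)
    then have "scale (1 / c) (scale c (?e' (\<delta>1 (?e a)))) = scale (1 / c) (scale (of_int k) a)" by simp
    then have "?e' (\<delta>1 (?e a)) = scale (of_int k / c) a" using c0 by simp
    then have "?e (?e' (\<delta>1 (?e a))) = scale (of_int k / c) (?e a)" by (simp add: le)
    then have "?e a \<in> weight_space \<delta>1 (of_int k / c)" by (simp add: lnd_exp_inverse'[OF D] weight_space_def)
    then show ?thesis
    proof (rule weight_space_generator[OF g1 _ e_inj[OF a(2)]])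
      fix i :: int assume "of_int k / c = of_int i" "?e a \<in> graded_part scale \<rho>1 i"
      then show ?thesis using e_inj[OF a(2)] c0 by (intro exI[of _ i]) (auto simp: field_simps)
    qed
  qed
  have "\<exists>i. i \<noteq> 0 \<and> graded_part scale \<rho>1 i \<noteq> {0}"
  proof (rule ccontr)
    assume neg: "\<not> ?thesis"
    have "(2::int) = 1"
    proof (rule effective_weights_dvd[OF g1 \<rho>1(2)])
      show "2 dvd i" if "graded_part scale \<rho>1 i \<noteq> {0}" for i
      proof (cases "i = 0")
        case False
        then show ?thesis using neg that by blast
      qed simp
    qed simp
    then show False by simp
  qed
  then obtain i0 where i0: "i0 \<noteq> 0" "graded_part scale \<rho>1 i0 \<noteq> {0}" by blast
  obtain k0 :: int where "c * of_int i0 = of_int k0" using W12[OF i0(2)] by blast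
  then have "c = of_int k0 / of_int i0" using i0(1) by (simp add: field_simps)
  then have "c \<in> \<rat>" by simp
  then obtain p q :: int where pq: "q > 0" "coprime p q" "c = of_int p / of_int q" by (rule Rats_cases')
  have eq_int: "p * i = q * k" if "c * of_int i = of_int k" for i k :: int
  proof -
    have "of_int (p * i) = (of_int (q * k) :: complex)" using that pq by (simp add: field_simps)
    then show ?thesis by (simp only: of_int_eq_iff)
  qed
  have "q = 1"
  proof (rule effective_weights_dvd[OF g1 \<rho>1(2) pq(1)])
    fix i assume "graded_part scale \<rho>1 i \<noteq> {0}"
    then obtain k :: int where "c * of_int i = of_int k" using W12 by blast
    then have "q dvd p * i" using eq_int by (metis dvd_triv_left)
    then show "q dvd i" using pq(2) by (metis coprime_commute coprime_dvd_mult_right_iff)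
  qed
  moreover have "\<bar>p\<bar> = 1"
  proof (rule effective_weights_dvd[OF g2 \<rho>2(2)])
    show "\<bar>p\<bar> > 0" using pq c0 by auto
    fix k assume "graded_part scale \<rho>2 k \<noteq> {0}"
    then obtain i :: int where "c * of_int i = of_int k" using W21 by blast
    then have "p * i = k" using eq_int \<open>q = 1\<close> by fastforce
    then show "\<bar>p\<bar> dvd k" by auto
  qed
  ultimately have c_cases: "c = 1 \<or> c = -1" using pq(3) by (auto simp: abs_if split: if_splits)
  have key: "\<rho>' l a = ?e' (\<rho>1 l (?e a))"
    if l: "l \<noteq> 0" and lin: "Vector_Spaces.linear scale scale (\<rho>' l)"
      and w: "\<And>i x. x \<in> graded_part scale \<rho>1 i \<Longrightarrow> \<rho>' l (?e' x) = scale (l powi i) (?e' x)" for \<rho>' l a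
  proof -
    obtain I f where f': "finite I" "\<forall>i. f i \<in> graded_part scale \<rho>1 i" "?e a = (\<Sum>i\<in>I. f i)"
      using graded_decomposition[OF \<rho>1(1), of "?e a"] by (elim exE conjE) (rule that)
    note f = f'[rule_format]
    have "?e' (\<rho>1 l (?e a)) = (\<Sum>i\<in>I. scale (l powi i) (?e' (f i)))"
      unfolding f(3) using f(2) l by (simp add: linearD(6)[OF action_linear[OF \<rho>1(1) l]] le' graded_part_def)
    also have "\<dots> = \<rho>' l (?e' (?e a))" unfolding f(3) le'(6) linearD(6)[OF lin] using w[OF f(2)] by simp
    finally show ?thesis unfolding lnd_exp_inverse[OF D] by simp
  qed
  have part2: "?e' x \<in> graded_part scale \<rho>2 k" if x: "x \<in> graded_part scale \<rho>1 i" "c * of_int i = of_int k" for x i k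
  proof (cases "?e' x = 0")
    case True
    then show ?thesis using subspace_0[OF subspace_part[OF \<rho>2(1)]] by simp
  next
    case False
    show ?thesis
    proof (rule weight_space_generator[OF g2 e'_weight[OF x(1)] False])
      fix j :: int assume "c * of_int i = of_int j" "?e' x \<in> graded_part scale \<rho>2 j"
      then show ?thesis using x(2) by simp
    qed
  qed
  from c_cases show ?thesis
  proof
    assume c1: "c = 1"
    have w: "\<rho>2 l (?e' x) = scale (l powi i) (?e' x)" if "l \<noteq> 0" "x \<in> graded_part scale \<rho>1 i" for l x i
      using part2[OF that(2), of i] that(1) c1 by (simp add: graded_part_def)
    have "\<forall>l a. l \<noteq> 0 \<longrightarrow> \<rho>2 l a = ?e' (\<rho>1 l (?e a))"
    proof (intro allI impI)
      show "\<rho>2 l a = ?e' (\<rho>1 l (?e a))" if l: "l \<noteq> 0" for l a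
        by (rule key[where \<rho>' = \<rho>2, OF l action_linear[OF \<rho>2(1) l]]) (rule w[OF l])
    qed
    then show ?thesis using D by (intro bexI[of _ \<rho>2] bexI[of _ D]) simp_all
  next
    assume c1: "c = -1"
    have w: "\<rho>2 (inverse l) (?e' x) = scale (l powi i) (?e' x)" if "l \<noteq> 0" "x \<in> graded_part scale \<rho>1 i" for l x i
      using part2[OF that(2), of "- i"] that(1) c1 by (simp add: graded_part_def power_int_minus power_int_inverse)
    have "\<forall>l a. l \<noteq> 0 \<longrightarrow> \<rho>2 (inverse l) a = ?e' (\<rho>1 l (?e a))"
    proof (intro allI impI)
      show "\<rho>2 (inverse l) a = ?e' (\<rho>1 l (?e a))" if l: "l \<noteq> 0" for l a
      proof (rule key[where \<rho>' = "\<lambda>l. \<rho>2 (inverse l)", OF l])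
        show "Vector_Spaces.linear scale scale (\<rho>2 (inverse l))" using action_linear[OF \<rho>2(1)] l by simp
      qed (rule w[OF l])
    qed
    then show ?thesis using D by (intro bexI[of _ "\<lambda>l. \<rho>2 (inverse l)"] bexI[of _ D]) simp_all
  qed
qed

end

theorem theorem3p3:
  fixes scale :: "complex \<Rightarrow> 'a::idom \<Rightarrow> 'a"
    and \<rho> :: "complex \<Rightarrow> 'a \<Rightarrow> 'a"
    and \<delta> :: "'a \<Rightarrow> 'a"
  assumes "normal_affine_surface scale"
    and "Cstar_action scale \<rho>" and "nontrivial_action \<rho>"
    and "infinitesimal_generator scale \<rho> \<delta>"
    and "makar_limanov scale \<noteq> range (\<lambda>c. scale c 1)"
    and "\<not> algebra_isomorphic scale torus_algebra"
    and "\<not> algebra_isomorphic scale line_times_Cstar_algebra"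
  shows "(\<forall>\<delta>'. semisimple_derivation scale \<delta>' \<longrightarrow>
            (\<exists>c. \<exists>D\<in>LND scale. \<forall>a.
               \<delta>' a = scale c (lnd_exp scale (\<lambda>x. - D x) (\<delta> (lnd_exp scale D a)))))
       \<and> (\<forall>\<rho>1 \<rho>2.
            Cstar_action scale \<rho>1 \<and> effective_action \<rho>1 \<and>
            Cstar_action scale \<rho>2 \<and> effective_action \<rho>2 \<longrightarrow>
            (\<exists>\<rho>'\<in>{\<rho>2, \<lambda>l. \<rho>2 (inverse l)}.
               (\<exists>D\<in>LND scale. \<forall>l a. l \<noteq> 0 \<longrightarrow>
                  \<rho>' l a = lnd_exp scale (\<lambda>x. - D x) (\<rho>1 l (lnd_exp scale D a))) \<and>
               (makar_limanov scale = UNIV \<longrightarrow> (\<forall>l. l \<noteq> 0 \<longrightarrow> \<rho>' l = \<rho>1 l))))"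
proof -
  have "complex_algebra scale" "finitely_generated_algebra scale" "krull_dim TYPE('a) = 2" "integrally_closed TYPE('a)"
    using assms(1) by (auto simp: normal_affine_surface_def)
  then interpret nontoric_surface scale
    using assms(5-7)
    by (simp add: nontoric_surface_def nontoric_surface_axioms_def nontrivial_makar_limanov_def
        nontrivial_makar_limanov_axioms_def affine_surface_def affine_surface_axioms_def
        affine_domain_def affine_domain_axioms_def complex_domain_def)
  show ?thesis
  proof (intro conjI allI impI)
    fix \<delta>' assume "semisimple_derivation scale \<delta>'"
    then have \<delta>': "diagonal \<delta>'" by (rule semisimple_imp_diagonal)
    obtain l where "l \<noteq> 0" "\<rho> l \<noteq> id" using assms(3) unfolding nontrivial_action_def by blast
    then obtain b where b: "\<delta> b \<noteq> 0" using generator_nonzero[OF assms(2,4)] by blast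
    show "\<exists>c. \<exists>D\<in>LND scale. \<forall>a. \<delta>' a = scale c (lnd_exp scale (\<lambda>x. - D x) (\<delta> (lnd_exp scale D a)))"
      by (rule diagonal_conjugate_proportional[OF generator_diagonal[OF assms(2,4)] weights_generator[OF assms(2,4)] b \<delta>'])
  next
    fix \<rho>1 \<rho>2
    assume "Cstar_action scale \<rho>1 \<and> effective_action \<rho>1 \<and> Cstar_action scale \<rho>2 \<and> effective_action \<rho>2"
    then have h: "Cstar_action scale \<rho>1" "effective_action \<rho>1" "Cstar_action scale \<rho>2" "effective_action \<rho>2"
      by simp_all
    obtain \<rho>' D where \<rho>': "\<rho>' \<in> {\<rho>2, \<lambda>l. \<rho>2 (inverse l)}" and D: "D \<in> LND scale"
      and conj: "\<forall>l a. l \<noteq> 0 \<longrightarrow> \<rho>' l a = lnd_exp scale (\<lambda>x. - D x) (\<rho>1 l (lnd_exp scale D a))"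
      using effective_actions_conjugate[OF h] by (elim bexE) (rule that)
    have same: "\<rho>' l = \<rho>1 l" if triv: "makar_limanov scale = UNIV" and l: "l \<noteq> 0" for l
    proof -
      have D0: "D a = 0" for a using triv D unfolding makar_limanov_def by blast
      have "lnd_exp scale D a = a" "lnd_exp scale (\<lambda>x. - D x) a = a" for a
        using lnd_exp_eq_sum[OF derivation_linear[OF LND_D(1)[OF D]], of 1 a]
          lnd_exp_eq_sum[OF derivation_linear[OF LND_D(1)[OF LND_uminus[OF D]]], of 1 a] by (simp_all add: D0)
      then show ?thesis using conj l by (intro ext) simp
    qed
    show "\<exists>\<rho>'\<in>{\<rho>2, \<lambda>l. \<rho>2 (inverse l)}.
        (\<exists>D\<in>LND scale. \<forall>l a. l \<noteq> 0 \<longrightarrow> \<rho>' l a = lnd_exp scale (\<lambda>x. - D x) (\<rho>1 l (lnd_exp scale D a))) \<and>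
        (makar_limanov scale = UNIV \<longrightarrow> (\<forall>l. l \<noteq> 0 \<longrightarrow> \<rho>' l = \<rho>1 l))"
    proof (rule bexI[OF _ \<rho>'], intro conjI impI allI)
      show "\<exists>D\<in>LND scale. \<forall>l a. l \<noteq> 0 \<longrightarrow> \<rho>' l a = lnd_exp scale (\<lambda>x. - D x) (\<rho>1 l (lnd_exp scale D a))"
        by (rule bexI[OF _ D]) (rule conj)
    qed (rule same)
  qed
qed

end
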